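(* Let $G\subseteq GL(V)$ be a finite complex reflection group such that $l(g)=\operatorname{codim}V^g$ for all $g\in G$. Then $\mathrm{HH}^\bullet(S(V),S(V)\#G)$ is generated as an algebra under cup product by its elements of cohomological degrees $0$ and $1$.
   Context: $V$ is a finite-dimensional complex vector space. A reflection is a non-identity element of $GL(V)$ fixing a hyperplane pointwise; a (finite) reflection group is a finite subgroup of $GL(V)$ generated by reflections. For $g\in G$, $V^g$ is the fixed space of $g$, and the reflection length $l(g)$ is the minimal $k$ such that $g$ is a product of $k$ reflections belonging to $G$ ($l(1)=0$). $S(V)\#G$ is the skew group algebra ($S(V)\otimes\mathbb CG$ with $(a\otimes g)(b\otimes h)=a\,{}^gb\otimes gh$), and $\mathrm{HH}^\bullet(S(V),S(V)\#G)=\operatorname{Ext}^\bullet_{S(V)\otimes S(V)^{op}}(S(V),S(V)\#G)$ is the Hochschild cohomology with the cup product. *)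

theory Defs
  imports "HOL-Analysis.Analysis" "HOL-Library.Poly_Mapping"
begin

section \<open>Linear groups on V = complex^'n\<close>

type_synonym 'n cmat = "complex^'n^'n"

definition fixed_space :: "'n::finite cmat \<Rightarrow> (complex^'n) set" where
  "fixed_space g = {v. g *v v = v}"

definition codim_fix :: "'n::finite cmat \<Rightarrow> nat" where
  "codim_fix g = CARD('n) - vec.dim (fixed_space g)"

definition is_GL :: "'n::finite cmat \<Rightarrow> bool" where
  "is_GL g \<longleftrightarrow> (\<exists>h. g ** h = mat 1 \<and> h ** g = mat 1)"

text \<open>A reflection: a non-identity invertible map fixing a hyperplane pointwise.\<close>
definition is_reflection :: "'n::finite cmat \<Rightarrow> bool" where
  "is_reflection g \<longleftrightarrow> is_GL g \<and> g \<noteq> mat 1 \<and>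
     (\<exists>H. vec.subspace H \<and> vec.dim H = CARD('n) - 1 \<and> H \<subseteq> fixed_space g)"

definition is_matgroup :: "'n::finite cmat set \<Rightarrow> bool" where
  "is_matgroup H \<longleftrightarrow> mat 1 \<in> H \<and> (\<forall>g\<in>H. is_GL g) \<and>
     (\<forall>g\<in>H. \<forall>h\<in>H. g ** h \<in> H) \<and>
     (\<forall>g\<in>H. \<exists>h\<in>H. g ** h = mat 1 \<and> h ** g = mat 1)"

definition matgroup_generated :: "'n::finite cmat set \<Rightarrow> 'n cmat set" where
  "matgroup_generated S = \<Inter>{H. is_matgroup H \<and> S \<subseteq> H}"

definition refls :: "'n::finite cmat set \<Rightarrow> 'n cmat set" where
  "refls G = {g \<in> G. is_reflection g}"

definition is_reflection_group :: "'n::finite cmat set \<Rightarrow> bool" where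
  "is_reflection_group G \<longleftrightarrow> finite G \<and> is_matgroup G \<and> G = matgroup_generated (refls G)"

definition mat_prod :: "'n::finite cmat list \<Rightarrow> 'n cmat" where
  "mat_prod rs = foldr (**) rs (mat 1)"

text \<open>Reflection length with respect to the reflections of G.\<close>
definition refl_length :: "'n::finite cmat set \<Rightarrow> 'n cmat \<Rightarrow> nat" where
  "refl_length G g = (LEAST k. \<exists>rs. length rs = k \<and> set rs \<subseteq> refls G \<and> mat_prod rs = g)"

section \<open>The symmetric algebra S(V) as polynomials in the basis vectors of V\<close>

type_synonym 'n spoly = "('n \<Rightarrow>\<^sub>0 nat) \<Rightarrow>\<^sub>0 complex"

definition pconst :: "complex \<Rightarrow> 'n spoly" where
  "pconst c = Poly_Mapping.single 0 c"

definition pvar :: "'n \<Rightarrow> 'n spoly" where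
  "pvar i = Poly_Mapping.single (Poly_Mapping.single i 1) 1"

text \<open>Image of the basis vector e_i under g: g e_i = sum_k g_{k,i} e_k.\<close>
definition lin_img :: "'n::finite cmat \<Rightarrow> 'n \<Rightarrow> 'n spoly" where
  "lin_img g i = (\<Sum>k\<in>UNIV. pconst (g $ k $ i) * pvar k)"

text \<open>The induced algebra automorphism of S(V).\<close>
definition act :: "'n::finite cmat \<Rightarrow> 'n spoly \<Rightarrow> 'n spoly" where
  "act g p = (\<Sum>m\<in>Poly_Mapping.keys p.
      pconst (Poly_Mapping.lookup p m) * (\<Prod>i\<in>UNIV. lin_img g i ^ Poly_Mapping.lookup m i))"

section \<open>The skew group algebra S(V)#G\<close>

text \<open>An element sum_g f_g g is represented by g |-> f_g (zero outside G).\<close>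
type_synonym 'n skew = "'n cmat \<Rightarrow> 'n spoly"

definition skew_carrier :: "'n::finite cmat set \<Rightarrow> 'n skew set" where
  "skew_carrier G = {F. \<forall>g. g \<notin> G \<longrightarrow> F g = 0}"

definition skew_mult :: "'n::finite cmat set \<Rightarrow> 'n skew \<Rightarrow> 'n skew \<Rightarrow> 'n skew" where
  "skew_mult G F H = (\<lambda>k. \<Sum>(g,h)\<in>{(g,h). g \<in> G \<and> h \<in> G \<and> g ** h = k}. F g * act g (H h))"

definition skew_embed :: "'n spoly \<Rightarrow> 'n::finite skew" where
  "skew_embed a = (\<lambda>g. if g = mat 1 then a else 0)"

definition skew_lmult :: "'n spoly \<Rightarrow> 'n::finite skew \<Rightarrow> 'n skew" where
  "skew_lmult a F = (\<lambda>g. a * F g)"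

definition skew_rmult :: "'n::finite skew \<Rightarrow> 'n spoly \<Rightarrow> 'n skew" where
  "skew_rmult F a = (\<lambda>g. F g * act g a)"

definition skew_scale :: "complex \<Rightarrow> 'n::finite skew \<Rightarrow> 'n skew" where
  "skew_scale c F = (\<lambda>g. pconst c * F g)"

section \<open>Hochschild cochain complex C^n(S(V), S(V)#G) = Hom_C(S(V)^{\<otimes>n}, S(V)#G)\<close>

text \<open>An n-cochain is a function on lists (only lists of length n matter),
  complex-multilinear in each of the n arguments, with values in S(V)#G.\<close>
type_synonym 'n cochain = "'n spoly list \<Rightarrow> 'n skew"

definition is_cochain :: "'n::finite cmat set \<Rightarrow> nat \<Rightarrow> 'n cochain \<Rightarrow> bool" where
  "is_cochain G n f \<longleftrightarrow>
     (\<forall>xs. length xs = n \<longrightarrow> f xs \<in> skew_carrier G) \<and>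
     (\<forall>xs i a b c. length xs = n \<longrightarrow> i < n \<longrightarrow>
        f (xs[i := pconst c * a + b]) = (\<lambda>g. pconst c * f (xs[i := a]) g + f (xs[i := b]) g))"

definition hoch_d :: "'n::finite cmat set \<Rightarrow> nat \<Rightarrow> 'n cochain \<Rightarrow> 'n cochain" where
  "hoch_d G n f xs =
     (\<lambda>g. skew_lmult (xs ! 0) (f (drop 1 xs)) g
       + (\<Sum>i=1..n. (-1) ^ i * f (take (i - 1) xs @ [xs ! (i - 1) * xs ! i] @ drop (i + 1) xs) g)
       + (-1) ^ (n + 1) * skew_rmult (f (take n xs)) (xs ! n) g)"

definition is_cocycle :: "'n::finite cmat set \<Rightarrow> nat \<Rightarrow> 'n cochain \<Rightarrow> bool" where
  "is_cocycle G n f \<longleftrightarrow> is_cochain G n f \<and> (\<forall>xs. length xs = n + 1 \<longrightarrow> hoch_d G n f xs = (\<lambda>g. 0))"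

text \<open>f and f' represent the same class in HH^n.\<close>
definition cohomologous :: "'n::finite cmat set \<Rightarrow> nat \<Rightarrow> 'n cochain \<Rightarrow> 'n cochain \<Rightarrow> bool" where
  "cohomologous G n f f' \<longleftrightarrow>
     (n = 0 \<and> f [] = f' []) \<or>
     (n > 0 \<and> (\<exists>h. is_cochain G (n - 1) h \<and>
        (\<forall>xs. length xs = n \<longrightarrow> (\<lambda>g. f xs g - f' xs g) = hoch_d G (n - 1) h xs)))"

text \<open>Cup product of a p-cochain with a cochain: (f \<smile> f')(a_1..a_{p+q}) = f(a_1..a_p) f'(a_{p+1}..a_{p+q}).\<close>
definition cup :: "'n::finite cmat set \<Rightarrow> nat \<Rightarrow> 'n cochain \<Rightarrow> 'n cochain \<Rightarrow> 'n cochain" where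
  "cup G p f f' xs = skew_mult G (f (take p xs)) (f' (drop p xs))"

text \<open>Iterated cup product of a list of (degree, cochain) pairs; empty product = unit.\<close>
fun cup_list :: "'n::finite cmat set \<Rightarrow> (nat \<times> 'n cochain) list \<Rightarrow> 'n cochain" where
  "cup_list G [] = (\<lambda>xs. skew_embed 1)"
| "cup_list G ((k, z) # r) = cup G k z (cup_list G r)"

text \<open>HH is generated as an algebra by its degree 0 and 1 parts: every class in HH^n
  is a finite sum of cup products of classes of degree 0 or 1 (scalars are degree 0 classes).\<close>
definition HH_generated_deg01 :: "'n::finite cmat set \<Rightarrow> bool" where
  "HH_generated_deg01 G \<longleftrightarrow>
     (\<forall>n f. is_cocycle G n f \<longrightarrow>
       (\<exists>terms :: (nat \<times> 'n cochain) list list.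
          (\<forall>t\<in>set terms. (\<forall>(k, z)\<in>set t. k \<le> 1 \<and> is_cocycle G k z) \<and> sum_list (map fst t) = n) \<and>
          cohomologous G n f (\<lambda>xs g. \<Sum>t\<leftarrow>terms. cup_list G t xs g)))"

end

(* The cohomology splits into contributions HH(S, S g) of the elements g of G.  A cocycle with values
   in S g is compared with its antisymmetrization on a basis y of V, a cocycle of the Koszul complex
   of S for the elements y_i - g y_i; a normalized cocycle whose antisymmetrization is exact is a
   coboundary.  If g = s_1 ... s_k with k = codim V^g, the y_i can be chosen dual to the functionals
   cutting out the reflecting hyperplanes (completed to a basis of the dual space).  The
   nonzero y_i - g y_i then are k independent linear forms, so every Koszul class is supported on index sets containing
   {1, ..., k}, and the class of such an index set is realized by the cup product of the divided
   differences a -> (a - s_j a) / alpha_j, of degree 1 in the components s_1, ..., s_k, with ordinary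
   derivations in the component 1. *)

theory Submission
  imports Defs "HOL-Library.Function_Algebras"
begin

section \<open>Koszul complexes of commuting operators\<close>

text \<open>Antisymmetrization loses nothing because an n-cocycle is a derivation with values in the
  (n-1)-cochains, and these embed in a coinduced bimodule, which is Koszul acyclic. Peeling off one
  argument therefore shifts Koszul classes injectively by one degree, and after n steps only values
  on tuples of the y_i remain; no comparison map of resolutions has to be written down. The obstacle
  is that 1 acts from the right as the identity only on cochains that vanish when their first
  argument is 1, whence the normalization. The hypothesis on lengths enters as a count: a word of
  codim V^g reflections has exactly as many letters as there are nonzero forms y_i - g y_i. Each
  letter supplies one factor of degree 1, and the letters multiply to g. In the dual coordinates
  such a cup product is the indicator of a single index tuple, so its antisymmetrization has one
  nonzero entry, a sign. Coefficients from S enter as factors of degree 0.\<close>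

locale ordered_index =
  fixes ord :: "'i::finite \<Rightarrow> nat"
  assumes inj_ord: "inj ord"
begin

text \<open>The sign of moving i to the front of the increasing arrangement of I.\<close>

definition sg :: "'i \<Rightarrow> 'i set \<Rightarrow> 'x::comm_ring_1" where
  "sg i I = (-1) ^ card {j \<in> I. ord j < ord i}"

text \<open>The Koszul cochain differential. A cochain assigns a value to every index set, so all
  degrees are treated at once and homogeneity is imposed only where it matters.\<close>

definition kd :: "('i \<Rightarrow> 'x \<Rightarrow> 'x) \<Rightarrow> ('i set \<Rightarrow> 'x) \<Rightarrow> 'i set \<Rightarrow> 'x::comm_ring_1" where
  "kd L \<phi> I = (\<Sum>i\<in>I. sg i I * L i (\<phi> (I - {i})))"

lemma sg_cases: "sg i I = (1 :: 'x::comm_ring_1) \<or> sg i I = (-1 :: 'x)"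
  unfolding sg_def by (simp add: minus_one_power_iff)

lemma sg_sq: "sg i I * sg i I = (1 :: 'x::comm_ring_1)"
  using sg_cases[of i I, where 'x='x] by auto

lemma sg_sq_left: "sg i I * (sg i I * x) = x"
  by (simp add: sg_sq flip: mult.assoc)

lemma sg_remove_larger: "ord i < ord j \<Longrightarrow> sg i (I - {j}) = sg i I"
proof -
  assume "ord i < ord j"
  then have "{l \<in> I - {j}. ord l < ord i} = {l \<in> I. ord l < ord i}" by auto
  then show ?thesis by (simp add: sg_def)
qed

lemma sg_remove_smaller:
  assumes "ord i < ord j" "i \<in> I" shows "sg j (I - {i}) = - sg j I"
proof -
  have "{l \<in> I. ord l < ord j} = insert i {l \<in> I - {i}. ord l < ord j}"
    using assms by auto
  then have "card {l \<in> I. ord l < ord j} = Suc (card {l \<in> I - {i}. ord l < ord j})"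
    by simp
  then show ?thesis by (simp add: sg_def)
qed

lemma sg_antisym:
  assumes "i \<in> I" "j \<in> I" "i \<noteq> j"
  shows "sg i I * sg j (I - {i}) = - (sg j I * sg i (I - {j}) :: 'x::comm_ring_1)"
proof -
  have "ord i \<noteq> ord j" using assms inj_ord by (auto dest: injD)
  then consider "ord i < ord j" | "ord j < ord i" by linarith
  then show ?thesis
    by cases (simp_all add: sg_remove_larger sg_remove_smaller assms)
qed

text \<open>Exchanging i and j reverses the product of signs, so the terms of (i, j) and (j, i)
  cancel. This is used for \<open>kd_kd\<close> and again for \<open>contract_kd\<close>.\<close>

lemma sum_sym_zero:
  fixes S :: "'i \<Rightarrow> 'i \<Rightarrow> 'x::comm_ring_1"
  assumes "\<And>i j. i \<in> I \<Longrightarrow> j \<in> I \<Longrightarrow> i \<noteq> j \<Longrightarrow> S i j = S j i"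
  shows "(\<Sum>i\<in>I. \<Sum>j\<in>I - {i}. sg i I * sg j (I - {i}) * S i j) = 0"
proof -
  define F where "F = (\<lambda>(i, j). sg i I * sg j (I - {i}) * S i j)"
  define P1 where "P1 = {(i,j). i \<in> I \<and> j \<in> I \<and> ord i < ord j}"
  define P2 where "P2 = {(i,j). i \<in> I \<and> j \<in> I \<and> ord j < ord i}"
  have eq: "Sigma I (\<lambda>i. I - {i}) = P1 \<union> P2"
  proof -
    have "i \<noteq> j \<longleftrightarrow> ord i < ord j \<or> ord j < ord i" for i j
      using inj_eq[OF inj_ord, of i j] by linarith
    then show ?thesis unfolding P1_def P2_def by blast
  qed
  have disj: "P1 \<inter> P2 = {}" unfolding P1_def P2_def by auto
  have "(\<Sum>i\<in>I. \<Sum>j\<in>I - {i}. sg i I * sg j (I - {i}) * S i j) = sum F (Sigma I (\<lambda>i. I - {i}))"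
    unfolding F_def by (subst sum.Sigma) (auto simp: split_def)
  also have "\<dots> = sum F P1 + sum F P2"
    unfolding eq by (rule sum.union_disjoint) (auto simp: disj)
  also have "sum F P2 = (\<Sum>p\<in>P1. - F p)"
  proof (rule sum.reindex_bij_witness[of _ prod.swap prod.swap])
    fix p assume "p \<in> P2"
    then obtain i j where p: "p = (i, j)" "i \<in> I" "j \<in> I" "ord j < ord i" unfolding P2_def by auto
    then have "i \<noteq> j" by auto
    with p show "- F (prod.swap p) = F p"
      using sg_antisym[of i I j, where 'x='x] assms[of i j] by (simp add: F_def)
  qed (auto simp: P1_def P2_def)
  finally show ?thesis by (simp add: sum_negf)
qed

end

text \<open>The operators act on all functions on lists, but one-sided inverses such as
  \<open>TI\<close> work only on genuine multilinear cochains; hence the carrier X. The ring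
  structure on the values serves to write signs.\<close>

locale koszul = ordered_index ord for ord :: "'i::finite \<Rightarrow> nat" +
  fixes L :: "'i \<Rightarrow> 'x::comm_ring_1 \<Rightarrow> 'x" and X :: "'x set"
  assumes L_add: "L i (x + y) = L i x + L i y"
    and L_closed: "x \<in> X \<Longrightarrow> L i x \<in> X"
    and L_comm: "x \<in> X \<Longrightarrow> L i (L j x) = L j (L i x)"
    and X_0: "0 \<in> X" and X_add: "x \<in> X \<Longrightarrow> y \<in> X \<Longrightarrow> x + y \<in> X"
    and X_neg: "x \<in> X \<Longrightarrow> - x \<in> X"
begin

lemma sg_closed: "x \<in> X \<Longrightarrow> sg i I * x \<in> X"
  using sg_cases[of i I, where 'x='x] X_neg by auto

lemma X_diff: "x \<in> X \<Longrightarrow> y \<in> X \<Longrightarrow> x - y \<in> X"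
  using X_add[of x "- y"] X_neg by simp

lemma X_sum: "(\<And>i. i \<in> A \<Longrightarrow> f i \<in> X) \<Longrightarrow> sum f A \<in> X"
  by (induction A rule: infinite_finite_induct) (auto simp: X_0 X_add)

lemma L_0: "L i 0 = 0" using L_add[of i 0 0] by simp
lemma L_neg: "L i (- x) = - L i x" using L_add[of i x "- x"] by (simp add: L_0 eq_neg_iff_add_eq_0 add.commute)
lemma L_diff: "L i (x - y) = L i x - L i y" using L_add[of i x "- y"] by (simp add: L_neg)
lemma L_sg: "L i (sg j J * x) = sg j J * L i x"
  using sg_cases[of j J, where 'x='x] by (auto simp: L_neg)
lemma L_sum: "L i (sum f A) = (\<Sum>a\<in>A. L i (f a))"
  by (induction A rule: infinite_finite_induct) (auto simp: L_0 L_add)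

lemma kd_closed: "(\<And>I. \<phi> I \<in> X) \<Longrightarrow> kd L \<phi> I \<in> X"
  unfolding kd_def by (intro X_sum sg_closed L_closed)

lemma kd_diff: "kd L (\<lambda>I. \<phi> I - \<psi> I) I = kd L \<phi> I - kd L \<psi> I"
  by (simp add: kd_def L_diff algebra_simps sum_subtractf)

lemma kd_add: "kd L (\<lambda>I. \<phi> I + \<psi> I) I = kd L \<phi> I + kd L \<psi> I"
  by (simp add: kd_def L_add algebra_simps sum.distrib)

lemma kd_kd:
  assumes "\<And>I. \<phi> I \<in> X"
  shows "kd L (kd L \<phi>) I = 0"
proof -
  have "kd L (kd L \<phi>) I = (\<Sum>i\<in>I. \<Sum>j\<in>I - {i}. sg i I * sg j (I - {i}) * L i (L j (\<phi> (I - {i} - {j}))))"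
    by (simp add: kd_def L_sum L_sg sum_distrib_left mult.assoc)
  also have "\<dots> = 0"
  proof (rule sum_sym_zero)
    fix i j
    have "I - {i} - {j} = I - {j} - {i}" by auto
    then show "L i (L j (\<phi> (I - {i} - {j}))) = L j (L i (\<phi> (I - {j} - {i})))"
      using L_comm[OF assms] by simp
  qed
  finally show ?thesis .
qed

text \<open>Lets a primitive of a homogeneous cochain be cut down to the single degree below
  it.\<close>

lemma kd_trunc:
  "kd L (\<lambda>J. if Suc (card J) = n then \<eta> J else 0) I = (if card I = n then kd L \<eta> I else 0)"
proof -
  have "Suc (card (I - {i})) = card I" if "i \<in> I" for i
    using that by (metis card.remove finite)
  then show ?thesis by (auto simp: kd_def L_0 intro!: sum.cong)
qed

text \<open>Both eliminations modify a cocycle by \<open>kd L \<eta>\<close> with \<open>\<eta> J = \<plusminus> T j (\<phi> (insert j J))\<close>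
  for one index \<open>j\<close> after the other.\<close>

lemma koszul_acyclic:
  fixes T :: "'i \<Rightarrow> 'x \<Rightarrow> 'x"
  assumes T_add: "\<And>i x y. T i (x + y) = T i x + T i y"
    and T_closed: "\<And>i x. x \<in> X \<Longrightarrow> T i x \<in> X"
    and LT: "\<And>i x. x \<in> X \<Longrightarrow> L i (T i x) = x"
    and comm: "\<And>i j x. x \<in> X \<Longrightarrow> i \<noteq> j \<Longrightarrow> L i (T j x) = T j (L i x)"
    and \<phi>X: "\<And>I. \<phi> I \<in> X" and closed: "\<And>I. kd L \<phi> I = 0" and \<phi>0: "\<phi> {} = 0"
  shows "\<exists>\<eta>. (\<forall>J. \<eta> J \<in> X) \<and> (\<forall>I. \<phi> I = kd L \<eta> I)"
proof -
  have T0: "T i 0 = 0" for i using T_add[of i 0 0] by simp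
  \<comment> \<open>The last invariant protects the vanishing already achieved: removing i in E from
    I may leave a set disjoint from E, and then it is L i that kills the correction term.\<close>
  have "\<exists>\<eta>. (\<forall>J. \<eta> J \<in> X) \<and>
        (\<forall>I. I \<inter> E \<noteq> {} \<longrightarrow> \<phi> I - kd L \<eta> I = 0) \<and> (\<forall>I. \<forall>e\<in>E. L e (\<phi> I - kd L \<eta> I) = 0)" for E
  proof (induction E rule: finite_induct[OF finite])
    case 1
    show ?case by (intro exI[of _ "\<lambda>_. 0"]) (auto simp: X_0)
  next
    case (2 j E)
    from 2(3) obtain \<eta> where \<eta>: "(\<forall>J. \<eta> J \<in> X) \<and>
        (\<forall>I. I \<inter> E \<noteq> {} \<longrightarrow> \<phi> I - kd L \<eta> I = 0) \<and> (\<forall>I. \<forall>e\<in>E. L e (\<phi> I - kd L \<eta> I) = 0)"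
      by (elim exE)
    from 2(2) have jE: "j \<notin> E" .
    from \<eta> have \<eta>X: "\<And>J. \<eta> J \<in> X"
      and van: "\<And>I. I \<inter> E \<noteq> {} \<Longrightarrow> \<phi> I - kd L \<eta> I = 0"
      and ker: "\<And>I e. e \<in> E \<Longrightarrow> L e (\<phi> I - kd L \<eta> I) = 0"
      by simp_all
    define \<omega> where "\<omega> = (\<lambda>I. \<phi> I - kd L \<eta> I)"
    have \<omega>X: "\<omega> I \<in> X" for I unfolding \<omega>_def by (intro X_diff \<phi>X kd_closed \<eta>X)
    have \<omega>c: "kd L \<omega> I = 0" for I unfolding \<omega>_def kd_diff closed by (simp add: kd_kd \<eta>X)
    define \<zeta> where "\<zeta> J = (if j \<in> J then 0 else sg j (insert j J) * T j (\<omega> (insert j J)))" for J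
    have \<zeta>X: "\<zeta> J \<in> X" for J unfolding \<zeta>_def by (auto intro!: X_0 sg_closed T_closed \<omega>X)
    have \<zeta>van: "J \<inter> E \<noteq> {} \<Longrightarrow> \<zeta> J = 0" for J
      unfolding \<zeta>_def using van[of "insert j J"] jE by (auto simp: \<omega>_def T0)
    have \<zeta>ker: "L e (\<zeta> J) = 0" if "e \<in> E" for e J
    proof -
      have "L e (\<omega> I) = 0" for I using ker[OF that] by (simp add: \<omega>_def)
      moreover have "e \<noteq> j" using that jE by auto
      ultimately show ?thesis by (simp add: \<zeta>_def L_0 L_sg comm[OF \<omega>X] T0)
    qed
    have d1: "kd L \<zeta> I = \<omega> I" if "j \<in> I" for I
    proof -
      have "kd L \<zeta> I = sg j I * L j (\<zeta> (I - {j})) + (\<Sum>i\<in>I - {j}. sg i I * L i (\<zeta> (I - {i})))"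
        unfolding kd_def by (simp add: sum.remove[OF _ that])
      also have "(\<Sum>i\<in>I - {j}. sg i I * L i (\<zeta> (I - {i}))) = 0"
        using that by (intro sum.neutral) (auto simp: \<zeta>_def L_0)
      also have "\<zeta> (I - {j}) = sg j I * T j (\<omega> I)"
        using that by (simp add: \<zeta>_def insert_absorb)
      finally show ?thesis by (simp add: L_sg LT \<omega>X sg_sq_left)
    qed
    have d2: "kd L \<zeta> I = 0" if "I \<inter> E \<noteq> {}" for I
      unfolding kd_def
    proof (intro sum.neutral ballI)
      fix i assume "i \<in> I"
      show "sg i I * L i (\<zeta> (I - {i})) = 0"
      proof (cases "i \<in> E")
        case True then show ?thesis by (simp add: \<zeta>ker)
      next
        case False
        then have "(I - {i}) \<inter> E \<noteq> {}" using that by auto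
        then show ?thesis by (simp add: \<zeta>van L_0)
      qed
    qed
    define \<omega>' where "\<omega>' = (\<lambda>I. \<omega> I - kd L \<zeta> I)"
    have \<omega>'eq: "\<phi> I - kd L (\<lambda>J. \<eta> J + \<zeta> J) I = \<omega>' I" for I
      by (simp add: \<omega>'_def \<omega>_def kd_add)
    have \<omega>'c: "kd L \<omega>' I = 0" for I unfolding \<omega>'_def kd_diff \<omega>c by (simp add: kd_kd \<zeta>X)
    have van': "\<omega>' I = 0" if "I \<inter> insert j E \<noteq> {}" for I
    proof (cases "j \<in> I")
      case True
      then show ?thesis by (simp add: \<omega>'_def d1)
    next
      case False
      then have "I \<inter> E \<noteq> {}" using that by auto
      then show ?thesis using van[of I] by (simp add: \<omega>'_def \<omega>_def d2)
    qed
    \<comment> \<open>At \<open>insert j I\<close> the cocycle identity has only one term left, the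
      one that removes j.\<close>
    have kerj: "L j (\<omega>' I) = 0" for I
    proof (cases "j \<in> I")
      case True then show ?thesis using van'[of I] by (auto simp: L_0)
    next
      case False
      have "0 = kd L \<omega>' (insert j I)" by (simp add: \<omega>'c)
      also have "\<dots> = sg j (insert j I) * L j (\<omega>' I) + (\<Sum>i\<in>I. sg i (insert j I) * L i (\<omega>' (insert j I - {i})))"
        unfolding kd_def using False by (simp add: sum.insert)
      also have "(\<Sum>i\<in>I. sg i (insert j I) * L i (\<omega>' (insert j I - {i}))) = 0"
        using False by (intro sum.neutral ballI) (subst van', auto simp: L_0)
      finally have "sg j (insert j I) * (sg j (insert j I) * L j (\<omega>' I)) = 0" by simp
      then show ?thesis by (simp add: sg_sq_left)
    qed
    have kere: "L e (\<omega>' I) = 0" if "e \<in> E" for e I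
    proof -
      have "L e (kd L \<zeta> I) = 0"
        unfolding kd_def L_sum L_sg
        using that by (intro sum.neutral ballI) (simp add: L_comm[OF \<zeta>X] \<zeta>ker L_0)
      then show ?thesis using ker[OF that] by (simp add: \<omega>'_def \<omega>_def L_diff)
    qed
    show ?case
      by (rule exI[of _ "\<lambda>J. \<eta> J + \<zeta> J"]) (auto simp: \<omega>'eq X_add \<eta>X \<zeta>X van' kerj kere)
  qed
  from this[of UNIV] obtain \<eta> where \<eta>X: "\<And>J. \<eta> J \<in> X"
    and van: "\<And>I. I \<noteq> {} \<Longrightarrow> \<phi> I - kd L \<eta> I = 0" by auto
  have "\<phi> I = kd L \<eta> I" for I
    using van[of I] \<phi>0 by (cases "I = {}") (auto simp: kd_def)
  with \<eta>X show ?thesis by blast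
qed

text \<open>Dual to \<open>koszul_acyclic\<close>: with a left inverse, L i is injective, and each
  such i pushes the cohomology onto the index sets containing i.\<close>

lemma koszul_regular:
  fixes T :: "'i \<Rightarrow> 'x \<Rightarrow> 'x"
  assumes T_add: "\<And>i x y. i \<in> K \<Longrightarrow> T i (x + y) = T i x + T i y"
    and T_closed: "\<And>i x. i \<in> K \<Longrightarrow> x \<in> X \<Longrightarrow> T i x \<in> X"
    and TL: "\<And>i x. i \<in> K \<Longrightarrow> x \<in> X \<Longrightarrow> T i (L i x) = x"
    and comm: "\<And>i j x. j \<in> K \<Longrightarrow> x \<in> X \<Longrightarrow> i \<noteq> j \<Longrightarrow> L i (T j x) = T j (L i x)"
    and \<phi>X: "\<And>I. \<phi> I \<in> X" and closed: "\<And>I. kd L \<phi> I = 0"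
  shows "\<exists>\<eta>. (\<forall>J. \<eta> J \<in> X) \<and> (\<forall>I. \<not> K \<subseteq> I \<longrightarrow> \<phi> I = kd L \<eta> I)"
proof -
  have "\<exists>\<eta>. (\<forall>J. \<eta> J \<in> X) \<and> (\<forall>I. \<not> E \<subseteq> I \<longrightarrow> \<phi> I = kd L \<eta> I)" if "E \<subseteq> K" for E
    using finite[of E] that
  proof (induction E rule: finite_induct)
    case empty
    show ?case by (intro exI[of _ "\<lambda>_. 0"]) (auto simp: X_0)
  next
    case (insert j E)
    then obtain \<eta> where \<eta>X: "\<And>J. \<eta> J \<in> X"
      and van: "\<And>I. \<not> E \<subseteq> I \<Longrightarrow> \<phi> I = kd L \<eta> I" by blast
    have j: "j \<in> K" using insert by simp
    have T0: "T j 0 = 0" using T_add[OF j, of 0 0] by simp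
    have Tneg: "T j (- x) = - T j x" for x
      using T_add[OF j, of x "- x"] by (simp add: T0 eq_neg_iff_add_eq_0 add.commute)
    have Tsg: "T j (sg i I * x) = sg i I * T j x" for i I x
      using sg_cases[of i I, where 'x='x] by (auto simp: Tneg)
    have Tsum: "T j (sum f A) = (\<Sum>a\<in>A. T j (f a))" for f and A :: "'i set"
      by (induction A rule: infinite_finite_induct) (auto simp: T0 T_add[OF j])
    define \<omega> where "\<omega> = (\<lambda>I. \<phi> I - kd L \<eta> I)"
    have \<omega>X: "\<omega> I \<in> X" for I unfolding \<omega>_def by (intro X_diff \<phi>X kd_closed \<eta>X)
    have \<omega>c: "kd L \<omega> I = 0" for I unfolding \<omega>_def kd_diff closed by (simp add: kd_kd \<eta>X)
    define \<zeta> where "\<zeta> J = (if j \<in> J then 0 else sg j (insert j J) * T j (\<omega> (insert j J)))" for J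
    have \<zeta>X: "\<zeta> J \<in> X" for J unfolding \<zeta>_def using j by (auto intro!: X_0 sg_closed T_closed \<omega>X)
    have \<zeta>van: "\<zeta> J = 0" if "\<not> E \<subseteq> J" for J
    proof -
      have "\<not> E \<subseteq> insert j J" using that \<open>j \<notin> E\<close> by auto
      then have "\<omega> (insert j J) = 0" using van by (simp add: \<omega>_def)
      then show ?thesis by (simp add: \<zeta>_def T0)
    qed
    have d2: "kd L \<zeta> I = 0" if "\<not> E \<subseteq> I" for I
      unfolding kd_def using that by (intro sum.neutral ballI) (subst \<zeta>van, auto simp: L_0)
    \<comment> \<open>Apply T j to the cocycle identity of \<omega> at \<open>insert j I\<close>. As
      a left inverse of L j it recovers \<omega> I, and it passes through the other L i.\<close>
    have d1: "kd L \<zeta> I = \<omega> I" if "j \<notin> I" for I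
    proof -
      let ?J = "insert j I"
      have "0 = kd L \<omega> ?J" by (simp add: \<omega>c)
      also have "\<dots> = sg j ?J * L j (\<omega> I) + (\<Sum>i\<in>I. sg i ?J * L i (\<omega> (?J - {i})))"
        unfolding kd_def using that by (simp add: sum.insert)
      finally have "sg j ?J * (sg j ?J * L j (\<omega> I) + (\<Sum>i\<in>I. sg i ?J * L i (\<omega> (?J - {i})))) = 0"
        by simp
      then have "L j (\<omega> I) = - (\<Sum>i\<in>I. sg j ?J * (sg i ?J * L i (\<omega> (?J - {i}))))"
        by (simp only: distrib_left sg_sq_left sum_distrib_left eq_neg_iff_add_eq_0)
      then have "T j (L j (\<omega> I)) = - (\<Sum>i\<in>I. sg j ?J * (sg i ?J * T j (L i (\<omega> (?J - {i})))))"
        by (simp only: Tneg Tsum Tsg)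
      moreover have "T j (L i (\<omega> (?J - {i}))) = L i (T j (\<omega> (?J - {i})))" if "i \<in> I" for i
        using comm[OF j \<omega>X, of i] that \<open>j \<notin> I\<close> by metis
      ultimately have "\<omega> I = - (\<Sum>i\<in>I. sg j ?J * sg i ?J * L i (T j (\<omega> (?J - {i}))))"
        by (simp add: TL[OF j \<omega>X] mult.assoc cong: sum.cong)
      also have "\<dots> = (\<Sum>i\<in>I. sg i I * L i (\<zeta> (I - {i})))"
        unfolding sum_negf[symmetric]
      proof (rule sum.cong[OF refl])
        fix i assume i: "i \<in> I"
        have ins: "insert j (I - {i}) = ?J - {i}" using i that by auto
        have ij: "i \<noteq> j" using i that by auto
        have *: "sg j ?J * sg i ?J = - (sg i I * sg j (?J - {i}) :: 'x)"
        proof -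
          have "sg i ?J * sg j (?J - {i}) = - (sg j ?J * sg i (?J - {j}) :: 'x)"
            by (rule sg_antisym) (use i ij in auto)
          moreover have "?J - {j} = I" using that by auto
          ultimately have "sg i ?J * sg j (?J - {i}) = - (sg j ?J * sg i I :: 'x)" by simp
          moreover have "(sg i I :: 'x) * sg i I = 1" "(sg j (?J - {i}) :: 'x) * sg j (?J - {i}) = 1"
            "(sg j ?J :: 'x) * sg j ?J = 1" by (simp_all add: sg_sq)
          ultimately show ?thesis
            using sg_cases[of i ?J, where 'x='x] sg_cases[of j "?J - {i}", where 'x='x]
              sg_cases[of j ?J, where 'x='x] sg_cases[of i I, where 'x='x] by (elim disjE) simp_all
        qed
        show "- (sg j ?J * sg i ?J * L i (T j (\<omega> (?J - {i})))) = sg i I * L i (\<zeta> (I - {i}))"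
          using that by (simp add: \<zeta>_def ins L_sg * mult.assoc)
      qed
      finally show ?thesis by (simp add: kd_def)
    qed
    have "\<phi> I = kd L (\<lambda>J. \<eta> J + \<zeta> J) I" if "\<not> insert j E \<subseteq> I" for I
    proof (cases "E \<subseteq> I")
      case True
      then show ?thesis using that d1[of I] by (auto simp: kd_add \<omega>_def)
    next
      case False
      then show ?thesis using d2[of I] van[of I] by (simp add: kd_add)
    qed
    then show ?case
      by (intro exI[of _ "\<lambda>J. \<eta> J + \<zeta> J"]) (auto simp: X_add \<eta>X \<zeta>X)
  qed
  from this[of K] show ?thesis by simp
qed

end

section \<open>Hochschild cochains of a twisted bimodule\<close>

text \<open>The coefficient bimodule is the algebra itself, with b acting on the right as
  multiplication by \<sigma> b. For \<sigma> the action of g this is S g.\<close>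

locale bar_cochains =
  fixes \<sigma> :: "'a::comm_ring_1 \<Rightarrow> 'a" and \<kappa> :: "complex \<Rightarrow> 'a"
  assumes \<sigma>_add: "\<sigma> (a + b) = \<sigma> a + \<sigma> b" and \<sigma>_mult: "\<sigma> (a * b) = \<sigma> a * \<sigma> b"
    and \<sigma>_1: "\<sigma> 1 = 1" and \<sigma>_\<kappa>: "\<sigma> (\<kappa> c) = \<kappa> c"
begin

definition lin :: "('a \<Rightarrow> 'a) \<Rightarrow> bool" where
  "lin \<phi> \<longleftrightarrow> (\<forall>c a b. \<phi> (\<kappa> c * a + b) = \<kappa> c * \<phi> a + \<phi> b)"

text \<open>The right action on cochains for which the Hochschild differential is
  \<open>a * q zs - rm a q zs\<close> on \<open>a # zs\<close>: an \<open>n\<close>-cocycle is then a derivation with values in the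
  \<open>(n - 1)\<close>-cochains, and a coboundary is an inner derivation.\<close>

fun rm :: "'a \<Rightarrow> ('a list \<Rightarrow> 'a) \<Rightarrow> 'a list \<Rightarrow> 'a" where
  "rm b q [] = q [] * \<sigma> b"
| "rm b q (a # zs) = q (b * a # zs) - rm a (\<lambda>xs. q (b # xs)) zs"

fun delta :: "('a list \<Rightarrow> 'a) \<Rightarrow> 'a list \<Rightarrow> 'a" where
  "delta q [] = 0"
| "delta q (a # zs) = a * q zs - rm a q zs"

text \<open>Recursion on the head fits the view of a cochain as a map from the algebra to shorter
  cochains. Vanishing on lists of any other length turns equality of cochains into equality of
  functions.\<close>

primrec mlin :: "nat \<Rightarrow> ('a list \<Rightarrow> 'a) \<Rightarrow> bool" where
  "mlin 0 q \<longleftrightarrow> (\<forall>a zs. q (a # zs) = 0)"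
| "mlin (Suc m) q \<longleftrightarrow> q [] = 0 \<and> (\<forall>a. mlin m (\<lambda>xs. q (a # xs))) \<and> (\<forall>xs. lin (\<lambda>a. q (a # xs)))"

definition van :: "nat \<Rightarrow> ('a list \<Rightarrow> 'a) \<Rightarrow> bool" where
  "van j q \<longleftrightarrow> (\<forall>us vs. length us = j \<longrightarrow> q (us @ 1 # vs) = 0)"

definition NC :: "nat \<Rightarrow> ('a list \<Rightarrow> 'a) \<Rightarrow> bool" where
  "NC m q \<longleftrightarrow> mlin m q \<and> (\<forall>j. van j q)"

lemma linD: "lin \<phi> \<Longrightarrow> \<phi> (\<kappa> c * a + b) = \<kappa> c * \<phi> a + \<phi> b"
  by (simp add: lin_def)


lemma lin_comb: "lin \<phi> \<Longrightarrow> lin \<psi> \<Longrightarrow> lin (\<lambda>a. r * \<phi> a + \<psi> a)"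
  by (simp add: lin_def algebra_simps)

lemma lin_const0: "lin (\<lambda>a. 0)" by (simp add: lin_def)

lemma lin_diff: "lin \<phi> \<Longrightarrow> lin \<psi> \<Longrightarrow> lin (\<lambda>a. \<phi> a - \<psi> a)"
  by (simp add: lin_def algebra_simps)

lemma lin_sum: "(\<And>i. i \<in> A \<Longrightarrow> lin (f i)) \<Longrightarrow> lin (\<lambda>a. \<Sum>i\<in>A. f i a)"
  by (induction A rule: infinite_finite_induct) (auto simp: lin_def algebra_simps)

lemma lin_mult_arg: "lin \<phi> \<Longrightarrow> lin (\<lambda>a. \<phi> (b * a))"
  unfolding lin_def by (metis (no_types, opaque_lifting) distrib_left mult.left_commute)

lemma rm_comb: "rm b (\<lambda>xs. r * p xs + q xs) zs = r * rm b p zs + rm b q zs"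
  by (induction zs arbitrary: b p q) (simp_all add: algebra_simps)

lemma rm_zero [simp]: "rm b (\<lambda>xs. 0) zs = 0"
  by (induction zs arbitrary: b) simp_all

lemma rm_scale: "rm b (\<lambda>xs. r * p xs) zs = r * rm b p zs"
  using rm_comb[of b r p "\<lambda>_. 0" zs] by simp

lemma rm_add: "rm b (\<lambda>xs. p xs + q xs) zs = rm b p zs + rm b q zs"
  using rm_comb[of b 1 p q zs] by simp

lemma rm_diff: "rm b (\<lambda>xs. p xs - q xs) zs = rm b p zs - rm b q zs"
  using rm_comb[of b "-1" q p zs] by simp


lemma rm_sum: "rm b (\<lambda>xs. \<Sum>i\<in>A. f i xs) zs = (\<Sum>i\<in>A. rm b (f i) zs)"
  by (induction A rule: infinite_finite_induct) (simp_all add: rm_add)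

text \<open>On a # zs both inner expansions contain \<open>rm (a * c)\<close> of q with b in front,
  and these copies cancel. Together with the left multiplication this makes the cochains a
  bimodule.\<close>

lemma rm_rm: "rm c (rm b q) zs = rm (c * b) q zs"
proof (induction zs arbitrary: b c q)
  case (Cons a zs)
  have "rm a (\<lambda>xs. rm b q (c # xs)) zs = rm a (\<lambda>xs. q (b * c # xs)) zs - rm (a * c) (\<lambda>xs. q (b # xs)) zs"
    by (simp add: rm_diff Cons.IH)
  then show ?case by (simp add: mult_ac)
qed (simp add: \<sigma>_mult mult_ac)

lemma rm_lin:
  assumes "\<And>xs. lin (\<lambda>a. q (a # xs))" shows "lin (\<lambda>a. rm a q xs)"
proof (cases xs)
  case Nil
  then show ?thesis by (simp add: lin_def \<sigma>_add \<sigma>_mult \<sigma>_\<kappa> algebra_simps)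
next
  case (Cons x ys)
  have "lin (\<lambda>a. q (a * x # ys))"
    using lin_mult_arg[OF assms[of ys], of x] by (simp add: mult.commute)
  moreover have "lin (\<lambda>a. rm x (\<lambda>xs. q (a # xs)) ys)"
    unfolding lin_def by (simp add: linD[OF assms] rm_comb)
  ultimately show ?thesis using Cons by (simp add: lin_diff)
qed

lemma mlin_zero: "mlin m (\<lambda>_. 0)"
  by (induction m) (simp_all add: lin_const0)

lemma mlin_comb: "mlin m p \<Longrightarrow> mlin m q \<Longrightarrow> mlin m (\<lambda>xs. r * p xs + q xs)"
  by (induction m arbitrary: p q) (auto intro: lin_comb)

lemma mlin_diff: "mlin m p \<Longrightarrow> mlin m q \<Longrightarrow> mlin m (\<lambda>xs. p xs - q xs)"
  using mlin_comb[of m q p "-1"] by simp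

lemma mlin_neg: "mlin m q \<Longrightarrow> mlin m (\<lambda>xs. - q xs)"
  using mlin_diff[OF mlin_zero] by simp

lemma mlin_length: "mlin m q \<Longrightarrow> length zs \<noteq> m \<Longrightarrow> q zs = 0"
  by (induction m arbitrary: q zs) (auto simp: neq_Nil_conv length_Suc_conv dest: spec split: list.splits,
      metis length_0_conv length_Cons list.exhaust)

lemma mlin_rm: "mlin m q \<Longrightarrow> mlin m (rm b q)"
proof (induction m arbitrary: b q)
  case 0
  then show ?case by simp
next
  case (Suc m)
  have "lin (\<lambda>a. rm b q (a # xs))" for xs
  proof -
    have "lin (\<lambda>a. rm a (\<lambda>ys. q (b # ys)) xs)"
    proof (rule rm_lin)
      show "lin (\<lambda>a. q (b # a # ys))" for ys
        using Suc.prems by (cases m) (auto simp: lin_const0)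
    qed
    moreover have "lin (\<lambda>a. q (b * a # xs))"
      using Suc.prems by (intro lin_mult_arg[of "\<lambda>a. q (a # xs)"]) simp
    ultimately show ?thesis by (simp add: lin_diff)
  qed
  moreover have "mlin m (\<lambda>xs. rm b q (a # xs))" for a
    using Suc by (auto intro!: mlin_diff Suc.IH)
  ultimately show ?case using Suc.prems by simp
qed

lemma mlin_delta: "mlin m q \<Longrightarrow> mlin (Suc m) (delta q)"
proof -
  assume q: "mlin m q"
  have "mlin m (\<lambda>zs. a * q zs - rm a q zs)" for a
    using mlin_comb[OF q mlin_neg[OF mlin_rm[OF q, of a]], of a] by simp
  moreover have "lin (\<lambda>a. a * q xs - rm a q xs)" for xs
  proof (intro lin_diff rm_lin)
    show "lin (\<lambda>a. q (a # ys))" for ys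
      using q by (cases m) (auto simp: lin_const0)
  qed (simp add: lin_def algebra_simps)
  ultimately show ?thesis by simp
qed


lemma delta_add: "delta (\<lambda>xs. p xs + q xs) zs = delta p zs + delta q zs"
  by (cases zs) (simp_all add: rm_add algebra_simps)

lemma delta_zero: "delta (\<lambda>xs. 0) zs = 0"
  by (cases zs) simp_all

text \<open>By the recursion for \<open>delta\<close>, the cocycles are the cochains on which the
  left and the right action agree.\<close>

definition cocycle :: "('a list \<Rightarrow> 'a) \<Rightarrow> bool" where
  "cocycle q \<longleftrightarrow> (\<forall>b zs. rm b q zs = b * q zs)"

lemma cocycle_delta: "cocycle (delta q)"
  unfolding cocycle_def
proof (intro allI)
  fix b zs show "rm b (delta q) zs = b * delta q zs"
    by (cases zs) (simp_all add: rm_diff rm_scale rm_rm algebra_simps)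
qed

lemma cocycle_diff: "cocycle p \<Longrightarrow> cocycle q \<Longrightarrow> cocycle (\<lambda>xs. p xs - q xs)"
  by (simp add: cocycle_def rm_diff algebra_simps)

lemma cocycle_sum: "(\<And>i. i \<in> A \<Longrightarrow> cocycle (f i)) \<Longrightarrow> cocycle (\<lambda>xs. \<Sum>i\<in>A. f i xs)"
  by (simp add: cocycle_def rm_sum sum_distrib_left)

lemma cocycle_scale: "cocycle q \<Longrightarrow> cocycle (\<lambda>xs. r * q xs)"
  by (simp add: cocycle_def rm_scale algebra_simps)

section \<open>Normalization of cocycles\<close>

lemma van_0: "van 0 q \<longleftrightarrow> (\<forall>vs. q (1 # vs) = 0)"
  by (simp add: van_def)

lemma van_Suc: "van (Suc j) q \<longleftrightarrow> (\<forall>a. van j (\<lambda>xs. q (a # xs)))"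
proof
  assume q: "van (Suc j) q"
  show "\<forall>a. van j (\<lambda>xs. q (a # xs))"
    unfolding van_def
  proof (intro allI impI)
    fix a and us vs :: "'a list" assume "length us = j"
    then have "length (a # us) = Suc j" by simp
    then have "q ((a # us) @ 1 # vs) = 0" using q unfolding van_def by blast
    then show "q (a # us @ 1 # vs) = 0" by simp
  qed
next
  assume "\<forall>a. van j (\<lambda>xs. q (a # xs))"
  then show "van (Suc j) q" unfolding van_def by (auto simp: length_Suc_conv)
qed

lemma vanD: "van j q \<Longrightarrow> length us = j \<Longrightarrow> q (us @ 1 # vs) = 0"
  by (simp add: van_def)

lemma van_comb: "van j p \<Longrightarrow> van j q \<Longrightarrow> van j (\<lambda>xs. r * p xs + q xs)"
  by (simp add: van_def)

lemma van_diff: "van j p \<Longrightarrow> van j q \<Longrightarrow> van j (\<lambda>xs. p xs - q xs)"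
  by (simp add: van_def)

text \<open>In general \<open>rm 1 q\<close> differs from q by an expansion of q with 1 in its first
  slot; normalization restores the unit law.\<close>

lemma rm_1: "van 0 q \<Longrightarrow> rm 1 q zs = q zs"
  by (cases zs) (simp_all add: \<sigma>_1 van_0)

lemma van_rm: "van j q \<Longrightarrow> van (Suc j) q \<Longrightarrow> van j (rm b q)"
proof (induction j arbitrary: b q)
  case 0
  then show ?case by (auto simp: van_0 van_Suc rm_1)
next
  case (Suc j)
  then show ?case by (auto simp: van_Suc intro!: van_diff)
qed

text \<open>Merging two entries to the left of the 1 leaves the 1 in slot j, where q vanishes. The
  mergers of the 1 with its two neighbours agree and have opposite signs. What survives is the tail
  of the expansion, starting at b.\<close>

lemma rm_two_ones:
  assumes "van j q" "length ws = j"
  shows "rm a q (ws @ 1 # b # zs) = (-1) ^ j * rm b (\<lambda>xs. q (a # ws @ 1 # xs)) zs"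
  using assms
proof (induction j arbitrary: a q ws)
  case (Suc j)
  then obtain w ws' where ws: "ws = w # ws'" "length ws' = j" by (auto simp: length_Suc_conv)
  have "q (a * w # ws' @ 1 # b # zs) = 0"
    using Suc.prems(1) ws(2) vanD[of j "\<lambda>xs. q (a * w # xs)"] by (simp add: van_Suc)
  moreover have "van j (\<lambda>xs. q (a # xs))" using Suc.prems by (simp add: van_Suc)
  ultimately show ?case using Suc.IH[OF _ ws(2)] ws by simp
qed simp

text \<open>Mergers to the left of the 1 vanish as in \<open>rm_two_ones\<close>, and the tail
  starting at the 1 vanishes by assumption; the merger of the 1 with its left neighbour
  remains.\<close>

lemma rm_insert_one:
  assumes "van j q" "length ws = j" "rm 1 (\<lambda>xs. q (a # ws @ xs)) zs = 0"
  shows "rm a q (ws @ 1 # zs) = (-1) ^ j * q (a # ws @ zs)"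
  using assms
proof (induction j arbitrary: a q ws)
  case (Suc j)
  then obtain w ws' where ws: "ws = w # ws'" "length ws' = j" by (auto simp: length_Suc_conv)
  have "q (a * w # ws' @ 1 # zs) = 0"
    using Suc.prems(1) ws(2) vanD[of j "\<lambda>xs. q (a * w # xs)"] by (simp add: van_Suc)
  moreover have "van j (\<lambda>xs. q (a # xs))" using Suc.prems by (simp add: van_Suc)
  ultimately show ?case using Suc.IH[OF _ ws(2), of "\<lambda>xs. q (a # xs)" w] ws Suc.prems(3) by simp
qed simp

text \<open>The alternating sign makes the coboundary of \<open>insert_one j f\<close> equal to f,
  and not to - f, on lists with 1 in slot j, for a cocycle f that is normalized in the earlier
  slots.\<close>

fun insert_one :: "nat \<Rightarrow> ('a list \<Rightarrow> 'a) \<Rightarrow> 'a list \<Rightarrow> 'a" where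
  "insert_one 0 f zs = f (1 # zs)"
| "insert_one (Suc j) f [] = 0"
| "insert_one (Suc j) f (a # zs) = - insert_one j (\<lambda>xs. f (a # xs)) zs"

lemma insert_one_comb:
  "insert_one j (\<lambda>xs. r * p xs + q xs) zs = r * insert_one j p zs + insert_one j q zs"
proof (induction j arbitrary: p q zs)
  case (Suc j) then show ?case by (cases zs) (simp_all add: algebra_simps)
qed simp

lemma insert_one_zero: "insert_one j (\<lambda>xs. 0) zs = 0"
  using insert_one_comb[of j 0 "\<lambda>_. 0" "\<lambda>_. 0" zs]
  by (induction j arbitrary: zs) (simp, case_tac zs, simp_all)

lemma insert_one_eq: "length ws = j \<Longrightarrow> insert_one j f (ws @ xs) = (-1) ^ j * f (ws @ 1 # xs)"
  by (induction j arbitrary: f ws) (auto simp: length_Suc_conv)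

lemma mlin_insert_one: "mlin (Suc m) f \<Longrightarrow> j \<le> m \<Longrightarrow> mlin m (insert_one j f)"
proof (induction j arbitrary: m f)
  case 0 then show ?case by simp
next
  case (Suc j)
  then obtain m' where m: "m = Suc m'" "j \<le> m'" by (cases m) auto
  have "lin (\<lambda>a. - insert_one j (\<lambda>ys. f (a # ys)) xs)" for xs
  proof -
    have "f ((\<kappa> c * a + b) # ys) = \<kappa> c * f (a # ys) + f (b # ys)" for c a b ys
      using Suc.prems(1) by (simp add: lin_def)
    then show ?thesis unfolding lin_def by (simp add: insert_one_comb)
  qed
  moreover have "mlin m' (\<lambda>xs. - insert_one j (\<lambda>ys. f (a # ys)) xs)" for a
    using Suc.IH[of m'] Suc.prems m by (intro mlin_neg) simp
  ultimately show ?case by (simp add: m)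
qed

lemma van_insert_one: "(\<And>i. i < j \<Longrightarrow> van i f) \<Longrightarrow> i < j \<Longrightarrow> van i (insert_one j f)"
proof (induction j arbitrary: f i)
  case (Suc j)
  show ?case
  proof (cases i)
    case 0
    then show ?thesis using Suc.prems(1)[of 0] by (simp add: van_0 insert_one_zero)
  next
    case (Suc i')
    have "van i'' (\<lambda>xs. f (a # xs))" if "i'' < j" for i'' a
      using Suc.prems(1)[of "Suc i''"] that by (simp add: van_Suc)
    then have "van i' (insert_one j (\<lambda>xs. f (a # xs)))" for a
      using Suc.IH Suc Suc.prems(2) by simp
    then show ?thesis using Suc by (simp add: van_Suc) (simp add: van_def)
  qed
qed simp

text \<open>For positive j, evaluate the cocycle identity on a list with 1 in slot j - 1 of the
  tail: one side is this expression up to sign by \<open>rm_two_ones\<close>, the other vanishes by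
  normalization. For j = 0 the identity for \<open>rm 1 f\<close> is already the claim.\<close>

lemma cocycle_rm_one:
  assumes c: "cocycle f" and v: "\<And>i. i < j \<Longrightarrow> van i f" and ws: "length ws = j"
  shows "rm b (\<lambda>xs. f (ws @ 1 # xs)) zs = 0"
proof (cases j)
  case 0
  have "rm 1 f (b # zs) = f (b # zs)" using c unfolding cocycle_def by (metis mult_1)
  then show ?thesis using 0 ws by simp
next
  case (Suc j')
  then obtain a ws' where w: "ws = a # ws'" "length ws' = j'" using ws by (auto simp: length_Suc_conv)
  have "rm a f (ws' @ 1 # b # zs) = a * f (ws' @ 1 # b # zs)" using c by (simp add: cocycle_def)
  also have "\<dots> = 0" using v[of j'] Suc w(2) by (simp add: van_def)
  finally have "(-1) ^ j' * rm b (\<lambda>xs. f (ws @ 1 # xs)) zs = 0"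
    using rm_two_ones[of j' f ws' a b zs] v[of j'] Suc w by simp
  then show ?thesis by (auto simp: minus_one_power_iff split: if_splits)
qed

text \<open>Slots are normalized from left to right. The correction by \<open>insert_one j f\<close>
  repairs slot j, and it inherits from f the vanishing in the slots before j, so these stay
  repaired.\<close>

lemma normalize_step:
  assumes c: "cocycle f" and v: "\<And>i. i < j \<Longrightarrow> van i f" and "i \<le> j"
  shows "van i (\<lambda>xs. f xs - delta (insert_one j f) xs)"
proof -
  define h where "h = insert_one j f"
  have hv: "van i h" if "i < j" for i using that v by (simp add: h_def van_insert_one)
  have heq: "h (ws @ xs) = (-1) ^ j * f (ws @ 1 # xs)" if "length ws = j" for ws xs
    using that by (simp add: h_def insert_one_eq)
  have hrm: "rm b (\<lambda>xs. h (ws @ xs)) zs = 0" if "length ws = j" for b ws zs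
    using that by (simp add: heq rm_scale cocycle_rm_one[OF c v])
  consider "i = j" | "i = 0" "i < j" | i' where "i = Suc i'" "i < j" using \<open>i \<le> j\<close> by (cases i) force+
  then show ?thesis
  proof cases
    case 1
    show ?thesis
    proof (cases j)
      case 0
      then have "rm 1 h zs = 0" for zs using hrm[of "[]"] by simp
      then show ?thesis unfolding h_def[symmetric] using 0 1 heq[of "[]"] by (simp add: van_0)
    next
      case (Suc j')
      have "delta h (ws @ 1 # vs) = f (ws @ 1 # vs)" if wj: "length ws = j" for ws vs
      proof -
        obtain a ws' where w: "ws = a # ws'" "length ws' = j'" using wj Suc by (auto simp: length_Suc_conv)
        have "h (ws' @ 1 # vs) = 0" using hv[of j'] w(2) Suc by (simp add: van_def)
        moreover have "rm a h (ws' @ 1 # vs) = (-1) ^ j' * h (a # ws' @ vs)"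
          using hv[of j'] hrm[OF wj] w Suc by (intro rm_insert_one) auto
        moreover have "h (a # ws' @ vs) = (-1) ^ j * f (ws @ 1 # vs)" using heq[OF wj, of vs] w by simp
        ultimately show ?thesis using w Suc by (simp flip: mult.assoc power_add)
      qed
      then show ?thesis using 1 by (simp add: van_def flip: h_def)
    qed
  next
    case 2
    then show ?thesis using v[of 0] hv[of 0] by (simp add: van_0 rm_1 flip: h_def)
  next
    case 3
    have "van i' (\<lambda>xs. a * h xs - rm a h xs)" for a
      using hv[of i'] hv[of i] 3 van_comb[of i' h "\<lambda>xs. - rm a h xs" a] van_rm[of i' h a]
      by (simp add: van_def)
    then have "van i (delta h)" using 3 by (simp add: van_Suc)
    then show ?thesis using v[of i] 3 by (simp add: van_diff flip: h_def)
  qed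
qed

text \<open>Degree 0 has no coboundaries, while \<open>n - 1\<close> is 0 there; the conditional
  keeps a spurious \<open>delta h\<close> out of that case.\<close>

lemma normalize:
  assumes "cocycle f" "mlin n f"
  shows "\<exists>h. mlin (n - 1) h \<and> cocycle (\<lambda>xs. f xs - delta h xs) \<and> NC n (\<lambda>xs. f xs - (if n = 0 then 0 else delta h xs))"
proof (cases n)
  case 0
  have "van j f" for j using assms 0 unfolding van_def by (auto intro!: mlin_length[of 0])
  then show ?thesis using assms 0 by (intro exI[of _ "\<lambda>_. 0"]) (auto simp: delta_zero NC_def)
next
  case (Suc m)
  have "\<exists>h. mlin m h \<and> (\<forall>i<j. van i (\<lambda>xs. f xs - delta h xs))" if "j \<le> n" for j
    using that
  proof (induction j)
    case 0
    then show ?case by (intro exI[of _ "\<lambda>_. 0"]) (auto simp: mlin_zero)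
  next
    case (Suc j)
    then obtain h where h: "mlin m h" "\<And>i. i < j \<Longrightarrow> van i (\<lambda>xs. f xs - delta h xs)" by auto
    define f' where "f' = (\<lambda>xs. f xs - delta h xs)"
    have f': "cocycle f'" "mlin n f'"
      unfolding f'_def using assms h mlin_delta[OF h(1)] \<open>n = Suc m\<close>
      by (auto intro!: cocycle_diff cocycle_delta mlin_diff simp del: mlin.simps)
    have "mlin m (insert_one j f')" using f' Suc \<open>n = Suc m\<close> by (intro mlin_insert_one) auto
    then have "mlin m (\<lambda>xs. h xs + insert_one j f' xs)" using h(1) mlin_comb[of m h _ 1] by simp
    moreover have "van i (\<lambda>xs. f' xs - delta (insert_one j f') xs)" if "i < Suc j" for i
      using that h(2) by (intro normalize_step f') (auto simp: f'_def)
    ultimately show ?case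
      by (intro exI[of _ "\<lambda>xs. h xs + insert_one j f' xs"]) (simp add: f'_def delta_add diff_diff_eq)
  qed
  from this[of n] obtain h where h: "mlin m h" "\<And>i. i < n \<Longrightarrow> van i (\<lambda>xs. f xs - delta h xs)" by auto
  have mlin: "mlin n (\<lambda>xs. f xs - delta h xs)" using assms h mlin_delta[OF h(1)] Suc by (auto intro!: mlin_diff simp del: mlin.simps)
  have "van i (\<lambda>xs. f xs - delta h xs)" for i
  proof (cases "i < n")
    case False
    then show ?thesis unfolding van_def using mlin_length[OF mlin] by auto
  qed (use h in auto)
  then show ?thesis using mlin h Suc by (intro exI[of _ h]) (auto simp: NC_def intro!: cocycle_diff cocycle_delta assms)
qed

end

section \<open>Comparison of the Hochschild and the Koszul complex\<close>

lemma monomial_induct [case_names zero step]: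
  fixes \<mu> :: "'i::finite \<Rightarrow>\<^sub>0 nat"
  assumes "P 0" "\<And>\<nu> i. P \<nu> \<Longrightarrow> P (\<nu> + Poly_Mapping.single i 1)"
  shows "P \<mu>"
proof (induction "\<Sum>i\<in>UNIV. Poly_Mapping.lookup \<mu> i" arbitrary: \<mu>)
  case 0
  then have "\<mu> = 0" by (intro poly_mapping_eqI) simp
  then show ?case using assms(1) by simp
next
  case (Suc n)
  then obtain i where i: "Poly_Mapping.lookup \<mu> i \<noteq> 0" by (metis Zero_not_Suc sum.neutral)
  define \<nu> where "\<nu> = Poly_Mapping.update i (Poly_Mapping.lookup \<mu> i - 1) \<mu>"
  have \<mu>: "\<mu> = \<nu> + Poly_Mapping.single i 1"
    using i unfolding \<nu>_def
    by (intro poly_mapping_eqI) (auto simp: lookup_update lookup_add lookup_single when_def)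
  have "Suc n = (\<Sum>i\<in>UNIV. Poly_Mapping.lookup \<nu> i) + (\<Sum>l\<in>UNIV. 1 when i = l)"
    using Suc.hyps(2) by (simp add: \<mu> lookup_add sum.distrib lookup_single)
  also have "(\<Sum>l\<in>UNIV. 1 when i = l) = (1::nat)" by (simp add: when_def)
  finally have "P \<nu>" using Suc.hyps(1)[of \<nu>] by simp
  then show ?case using assms(2) \<mu> by simp
qed

lemma sum_fun_apply: "sum f A x = (\<Sum>i\<in>A. f i x)"
  for f :: "'i \<Rightarrow> 'b \<Rightarrow> 'a::comm_monoid_add"
  by (induction A rule: infinite_finite_induct) simp_all

lemma (in ordered_index) sg_fun_apply: "(sg i I :: 'b \<Rightarrow> 'a::comm_ring_1) x = sg i I"
  by (simp add: sg_def minus_one_power_iff)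

text \<open>A polynomial algebra through its basis of monomials e \<mu> in the y i, with
  \<open>ext\<close> extending a function linearly from this basis. The y i are kept abstract
  because they will be coordinates adapted to g and not the standard variables.\<close>

locale bar_coords = bar_cochains \<sigma> \<kappa> + ordered_index ord
  for \<sigma> :: "'a::comm_ring_1 \<Rightarrow> 'a" and \<kappa> and ord :: "'i::finite \<Rightarrow> nat" +
  fixes y :: "'i \<Rightarrow> 'a" and e :: "('i \<Rightarrow>\<^sub>0 nat) \<Rightarrow> 'a"
    and ext :: "(('i \<Rightarrow>\<^sub>0 nat) \<Rightarrow> 'a) \<Rightarrow> 'a \<Rightarrow> 'a"
  assumes lin_ext: "lin (ext t)" and ext_e: "ext t (e \<mu>) = t \<mu>"
    and ext_comb: "ext (\<lambda>\<mu>. r * s \<mu> + t \<mu>) c = r * ext s c + ext t c"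
    and lin_eqI: "lin \<phi> \<Longrightarrow> lin \<psi> \<Longrightarrow> (\<And>\<mu>. \<phi> (e \<mu>) = \<psi> (e \<mu>)) \<Longrightarrow> \<phi> c = \<psi> c"
    and e_0: "e 0 = 1" and e_add: "e (\<mu> + Poly_Mapping.single i 1) = y i * e \<mu>"
begin

lemma ext_zero: "ext (\<lambda>\<mu>. 0) c = 0"
  using ext_comb[of 1 "\<lambda>_. 0" "\<lambda>_. 0" c] by simp

lemma y_e: "y i * e \<mu> = e (\<mu> + Poly_Mapping.single i (Suc 0))"
  using e_add[of \<mu> i] by simp

text \<open>The difference of the two actions of y i. On 0-cochains it is multiplication by y i -
  \<sigma> (y i), so that degree carries the ordinary Koszul complex of these elements.\<close>

definition L :: "'i \<Rightarrow> ('a list \<Rightarrow> 'a) \<Rightarrow> 'a list \<Rightarrow> 'a" where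
  "L i q = (\<lambda>zs. y i * q zs - rm (y i) q zs)"

definition contract :: "('i set \<Rightarrow> 'a list \<Rightarrow> 'a) \<Rightarrow> 'i set \<Rightarrow> 'a list \<Rightarrow> 'a" where
  "contract \<phi> I = (\<lambda>zs. \<Sum>i\<in>I. sg i I * \<phi> (I - {i}) (y i # zs))"

text \<open>For I with k elements this is the signed sum of f over all orderings of the y i, i in I,
  filled into the first k slots. It is a Koszul cochain whose values are cochains in the remaining
  slots.\<close>

primrec alt :: "nat \<Rightarrow> ('a list \<Rightarrow> 'a) \<Rightarrow> 'i set \<Rightarrow> 'a list \<Rightarrow> 'a" where
  "alt 0 f = (\<lambda>I. if I = {} then f else 0)"
| "alt (Suc k) f = contract (alt k f)"

lemma NC_comb: "NC m p \<Longrightarrow> NC m q \<Longrightarrow> NC m (\<lambda>xs. r * p xs + q xs)"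
  unfolding NC_def by (simp add: mlin_comb van_comb)

lemma NC_zero: "NC m (\<lambda>_. 0)" by (simp add: NC_def mlin_zero van_def)

lemma NC_add: "NC m p \<Longrightarrow> NC m q \<Longrightarrow> NC m (\<lambda>xs. p xs + q xs)"
  using NC_comb[of m p q 1] by simp

lemma NC_scale: "NC m p \<Longrightarrow> NC m (\<lambda>xs. r * p xs)"
  using NC_comb[OF _ NC_zero] by simp

lemma NC_neg: "NC m p \<Longrightarrow> NC m (\<lambda>xs. - p xs)"
  using NC_scale[of m p "-1"] by simp

lemma NC_diff: "NC m p \<Longrightarrow> NC m q \<Longrightarrow> NC m (\<lambda>xs. p xs - q xs)"
  using NC_comb[of m q p "-1"] by simp

lemma NC_sum: "(\<And>i. i \<in> A \<Longrightarrow> NC m (f i)) \<Longrightarrow> NC m (\<lambda>xs. \<Sum>i\<in>A. f i xs)"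
  by (induction A rule: infinite_finite_induct) (auto simp: NC_zero NC_add)

lemma NC_rm: "NC m q \<Longrightarrow> NC m (rm b q)"
  by (simp add: NC_def mlin_rm van_rm)

lemma mlin_lin_head: "mlin m q \<Longrightarrow> lin (\<lambda>a. q (a # xs))"
  by (cases m) (auto simp: lin_const0)

lemma NC_ext: "(\<And>\<mu>. NC m (g \<mu>)) \<Longrightarrow> NC m (\<lambda>xs. ext (\<lambda>\<mu>. g \<mu> xs) c)"
proof -
  have "mlin m (\<lambda>xs. ext (\<lambda>\<mu>. g \<mu> xs) c)" if "\<And>\<mu>. mlin m (g \<mu>)" for g
    using that
  proof (induction m arbitrary: g)
    case 0
    then show ?case by (simp add: ext_zero)
  next
    case (Suc m)
    have "lin (\<lambda>a. ext (\<lambda>\<mu>. g \<mu> (a # xs)) c)" for xs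
      using Suc.prems by (simp add: lin_def ext_comb)
    moreover have "mlin m (\<lambda>xs. ext (\<lambda>\<mu>. g \<mu> (a # xs)) c)" for a
      by (rule Suc.IH) (use Suc.prems in simp)
    ultimately show ?case using Suc.prems by (simp add: ext_zero)
  qed
  then show "(\<And>\<mu>. NC m (g \<mu>)) \<Longrightarrow> NC m (\<lambda>xs. ext (\<lambda>\<mu>. g \<mu> xs) c)"
    by (simp add: NC_def van_def ext_zero)
qed

text \<open>\<open>IC m\<close> is the coinduced bimodule of linear maps from the algebra to the normalized
  \<open>m\<close>-cochains; \<open>to_NC\<close> identifies its quotient by the normalized \<open>m\<close>-cochains with the
  normalized \<open>(m + 1)\<close>-cochains.\<close>

definition IC :: "nat \<Rightarrow> ('a list \<Rightarrow> 'a) \<Rightarrow> bool" where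
  "IC m q \<longleftrightarrow> q [] = 0 \<and> (\<forall>c. NC m (\<lambda>xs. q (c # xs))) \<and> (\<forall>xs. lin (\<lambda>c. q (c # xs)))"

text \<open>The counterpart of \<open>L\<close> on the coinduced bimodule, where the right action
  multiplies the head and leaves the tail alone.\<close>

fun LI :: "'i \<Rightarrow> ('a list \<Rightarrow> 'a) \<Rightarrow> 'a list \<Rightarrow> 'a" where
  "LI i q [] = 0"
| "LI i q (c # xs) = y i * q (c # xs) - q (y i * c # xs)"

text \<open>To invert \<open>LI i\<close>, a value on y i * e \<mu> must be y i times the value on e
  \<mu>, minus q at e \<mu>. The sum solves this recursion along the powers of y i, starting from 0
  on monomials free of y i.\<close>

fun TI :: "'i \<Rightarrow> ('a list \<Rightarrow> 'a) \<Rightarrow> 'a list \<Rightarrow> 'a" where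
  "TI i q [] = 0"
| "TI i q (c # xs) = ext (\<lambda>\<mu>. - (\<Sum>j<Poly_Mapping.lookup \<mu> i.
      y i ^ (Poly_Mapping.lookup \<mu> i - 1 - j) * q (e (Poly_Mapping.update i j \<mu>) # xs))) c"

text \<open>The copy of the m-cochains p inside the coinduced bimodule consists of the maps sending
  c to \<open>rm c p\<close>. Subtracting the one with the same value at c = 1 yields a
  representative that vanishes on 1.\<close>

fun to_NC :: "('a list \<Rightarrow> 'a) \<Rightarrow> 'a list \<Rightarrow> 'a" where
  "to_NC q [] = 0"
| "to_NC q (c # xs) = q (c # xs) - rm c (\<lambda>xs. q (1 # xs)) xs"

lemma NC_Suc: "NC (Suc m) q \<longleftrightarrow> IC m q \<and> van 0 q"
proof -
  have "(\<forall>j. van j q) \<longleftrightarrow> van 0 q \<and> (\<forall>j a. van j (\<lambda>xs. q (a # xs)))"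
    by (metis van_Suc not0_implies_Suc)
  then show ?thesis unfolding NC_def IC_def by auto
qed

lemma IC_comb: "IC m p \<Longrightarrow> IC m q \<Longrightarrow> IC m (\<lambda>xs. r * p xs + q xs)"
  by (simp add: IC_def NC_comb lin_comb)

lemma IC_LI: assumes "IC m q" shows "IC m (LI i q)"
  using assms NC_diff[OF NC_scale]
  by (auto simp: IC_def intro!: lin_diff lin_mult_arg[of "\<lambda>a. q (a # xs)" for xs]) (simp add: lin_def algebra_simps)

lemma IC_TI: "IC m q \<Longrightarrow> IC m (TI i q)"
  by (auto simp: IC_def lin_ext intro!: NC_ext NC_neg NC_sum NC_scale)

lemma update_add_single:
  "i \<noteq> l \<Longrightarrow> Poly_Mapping.update i j (\<mu> + Poly_Mapping.single l 1)
     = Poly_Mapping.update i j \<mu> + Poly_Mapping.single l (1::nat)"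
  by (rule poly_mapping_eqI) (auto simp: lookup_update lookup_add lookup_single when_def)

lemma update_add_single_same:
  "Poly_Mapping.update i j (\<mu> + Poly_Mapping.single i (1::nat)) = Poly_Mapping.update i j \<mu>"
  by (rule poly_mapping_eqI) (simp add: lookup_update lookup_add lookup_single when_def)

lemma update_same: "Poly_Mapping.update i (Poly_Mapping.lookup \<mu> i) \<mu> = \<mu>"
  by (rule poly_mapping_eqI) (simp add: lookup_update)

lemma TI_e: "TI i q (e \<mu> # xs) = - (\<Sum>j<Poly_Mapping.lookup \<mu> i.
      y i ^ (Poly_Mapping.lookup \<mu> i - 1 - j) * q (e (Poly_Mapping.update i j \<mu>) # xs))"
  by (simp add: ext_e)

lemma LI_TI: assumes q: "IC m q" shows "LI i (TI i q) = q"
proof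
  fix zs show "LI i (TI i q) zs = q zs"
  proof (cases zs)
    case Nil
    then show ?thesis using q by (simp add: IC_def)
  next
    case (Cons c xs)
    have lq: "lin (\<lambda>c. q (c # xs))" using q by (simp add: IC_def)
    have "LI i (TI i q) (c # xs) = q (c # xs)"
    proof (rule lin_eqI[of "\<lambda>c. LI i (TI i q) (c # xs)"])
      show "lin (\<lambda>c. LI i (TI i q) (c # xs))"
        using IC_LI[OF IC_TI[OF q]] by (simp add: IC_def del: LI.simps TI.simps)
      fix \<mu> :: "'i \<Rightarrow>\<^sub>0 nat"
      let ?k = "Poly_Mapping.lookup \<mu> i"
      let ?g = "\<lambda>j. q (e (Poly_Mapping.update i j \<mu>) # xs)"
      have "LI i (TI i q) (e \<mu> # xs) = (\<Sum>j<Suc ?k. y i ^ (?k - j) * ?g j) - (\<Sum>j<?k. y i * (y i ^ (?k - 1 - j) * ?g j))"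
        using update_add_single_same[of i _ \<mu>]
        by (simp only: LI.simps y_e TI_e sum_distrib_left) (simp add: lookup_add sum_distrib_left sum_negf)
      also have "(\<Sum>j<?k. y i * (y i ^ (?k - 1 - j) * ?g j)) = (\<Sum>j<?k. y i ^ (?k - j) * ?g j)"
      proof (rule sum.cong[OF refl])
        fix j assume "j \<in> {..<?k}"
        then have "?k - j = Suc (?k - 1 - j)" by auto
        then show "y i * (y i ^ (?k - 1 - j) * ?g j) = y i ^ (?k - j) * ?g j" by (simp add: mult.assoc)
      qed
      finally show "LI i (TI i q) (e \<mu> # xs) = q (e \<mu> # xs)" by (simp add: update_same)
    qed (rule lq)
    then show ?thesis using Cons by simp
  qed
qed

lemma LI_TI_comm: assumes q: "IC m q" and il: "l \<noteq> i" shows "LI l (TI i q) = TI i (LI l q)"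
proof
  fix zs show "LI l (TI i q) zs = TI i (LI l q) zs"
  proof (cases zs)
    case (Cons c xs)
    have "LI l (TI i q) (c # xs) = TI i (LI l q) (c # xs)"
    proof (rule lin_eqI[of "\<lambda>c. LI l (TI i q) (c # xs)" "\<lambda>c. TI i (LI l q) (c # xs)"])
      show "lin (\<lambda>c. LI l (TI i q) (c # xs))"
        using IC_LI[OF IC_TI[OF q]] by (simp add: IC_def del: LI.simps TI.simps)
      show "lin (\<lambda>c. TI i (LI l q) (c # xs))"
        using IC_TI[OF IC_LI[OF q]] by (simp add: IC_def del: LI.simps TI.simps)
      fix \<mu>
      show "LI l (TI i q) (e \<mu> # xs) = TI i (LI l q) (e \<mu> # xs)"
        using update_add_single[OF il[symmetric]] il
        by (simp only: LI.simps y_e TI_e)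
          (simp add: lookup_add lookup_single sum_distrib_left right_diff_distrib sum_subtractf mult.left_commute)
    qed
    then show ?thesis using Cons by simp
  qed simp
qed

lemma TI_add: "TI i (p + q) = TI i p + TI i q"
proof
  fix zs show "TI i (p + q) zs = (TI i p + TI i q) zs"
  proof (cases zs)
    case (Cons c xs)
    show ?thesis unfolding Cons TI.simps plus_fun_apply
      by (subst ext_comb[of 1, simplified, symmetric]) (simp add: algebra_simps sum.distrib)
  qed simp
qed

section \<open>Koszul complexes with values in normalized and in coinduced cochains\<close>

sublocale Q: koszul ord L "{q. NC m q}" for m
proof
  fix i j :: 'i and p q :: "'a list \<Rightarrow> 'a"
  show "L i (p + q) = L i p + L i q"
    unfolding L_def by (rule ext) (simp add: plus_fun_def rm_add algebra_simps)
  show "q \<in> {q. NC m q} \<Longrightarrow> L i q \<in> {q. NC m q}"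
    by (simp add: L_def NC_diff NC_scale NC_rm)
  show "L i (L j q) = L j (L i q)"
    unfolding L_def by (rule ext) (simp add: rm_diff rm_scale rm_rm right_diff_distrib, simp add: algebra_simps)
qed (simp_all add: zero_fun_def plus_fun_def fun_Compl_def NC_zero NC_add NC_neg)

sublocale I: koszul ord LI "{q. IC m q}" for m
proof
  fix i j :: 'i and p q :: "'a list \<Rightarrow> 'a"
  show "LI i (p + q) = LI i p + LI i q"
  proof
    fix zs show "LI i (p + q) zs = (LI i p + LI i q) zs" by (cases zs) (simp_all add: algebra_simps)
  qed
  show "q \<in> {q. IC m q} \<Longrightarrow> LI i q \<in> {q. IC m q}" by (simp add: IC_LI)
  show "LI i (LI j q) = LI j (LI i q)"
  proof
    fix zs show "LI i (LI j q) zs = LI j (LI i q) zs" by (cases zs) (simp_all add: algebra_simps)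
  qed
  show "p \<in> {q. IC m q} \<Longrightarrow> q \<in> {q. IC m q} \<Longrightarrow> p + q \<in> {q. IC m q}"
    using IC_comb[of m p q 1] by (simp add: plus_fun_def)
  show z: "0 \<in> {q. IC m q}" by (simp add: IC_def zero_fun_def NC_zero lin_const0)
  show "p \<in> {q. IC m q} \<Longrightarrow> - p \<in> {q. IC m q}"
    using IC_comb[of m p 0 "-1"] z by (simp add: fun_Compl_def)
qed

lemma kd_apply: "kd L \<phi> I zs = (\<Sum>i\<in>I. sg i I * L i (\<phi> (I - {i})) zs)"
  for L :: "'i \<Rightarrow> ('a list \<Rightarrow> 'a) \<Rightarrow> 'a list \<Rightarrow> 'a"
  by (simp add: kd_def sum_fun_apply sg_fun_apply)

lemma contract_kd: "contract (kd L \<phi>) I zs = - kd L (contract \<phi>) I zs"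
proof -
  \<comment> \<open>S is symmetric in i and j because the y i commute, so its signed sum vanishes.
    The summand with y i in front is added to complete the symmetry; subtracting it again produces L
    i of the contracted cochain.\<close>
  define S where "S i j = y j * \<phi> (I - {i,j}) (y i # zs) + y i * \<phi> (I - {i,j}) (y j # zs)
      - \<phi> (I - {i,j}) (y j * y i # zs)" for i j
  have minus: "I - {i} - {j} = I - {i, j}" for i j by auto
  have "contract (kd L \<phi>) I zs = (\<Sum>i\<in>I. \<Sum>j\<in>I - {i}. sg i I * sg j (I - {i}) * L j (\<phi> (I - {i,j})) (y i # zs))"
    by (simp add: contract_def kd_apply sum_distrib_left mult.assoc minus)
  also have "\<dots> = (\<Sum>i\<in>I. \<Sum>j\<in>I - {i}. sg i I * sg j (I - {i}) * S i j)
     - (\<Sum>i\<in>I. \<Sum>j\<in>I - {i}. sg i I * sg j (I - {i}) * L i (\<lambda>xs. \<phi> (I - {i,j}) (y j # xs)) zs)"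
    unfolding sum_subtractf[symmetric] S_def L_def by (intro sum.cong refl) (simp add: algebra_simps)
  also have "(\<Sum>i\<in>I. \<Sum>j\<in>I - {i}. sg i I * sg j (I - {i}) * S i j) = 0"
    by (rule sum_sym_zero) (simp add: S_def insert_commute mult.commute)
  also have "(\<Sum>i\<in>I. \<Sum>j\<in>I - {i}. sg i I * sg j (I - {i}) * L i (\<lambda>xs. \<phi> (I - {i,j}) (y j # xs)) zs)
     = kd L (contract \<phi>) I zs"
    by (simp add: kd_apply contract_def L_def rm_sum rm_scale minus sum_distrib_left
        right_diff_distrib sum_subtractf mult.assoc mult.left_commute)
  finally show ?thesis by simp
qed

text \<open>A cocycle for L, viewed in the coinduced bimodule, has as differential the image of
  minus its contraction. This is why \<open>contract\<close> represents the connecting homomorphism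
  up to sign.\<close>

lemma kd_LI: "kd LI \<phi> I (c # xs) = kd L \<phi> I (c # xs) - rm c (contract \<phi> I) xs"
  by (simp add: kd_apply contract_def L_def rm_sum rm_scale algebra_simps sum.distrib sum_subtractf)

lemma L_to_NC: "L i (to_NC q) = to_NC (LI i q)"
proof
  fix zs show "L i (to_NC q) zs = to_NC (LI i q) zs"
    by (cases zs) (simp_all add: L_def rm_diff rm_scale rm_rm algebra_simps)
qed

lemma kd_to_NC: "kd L (\<lambda>J. to_NC (\<eta> J)) I = to_NC (kd LI \<eta> I)"
proof
  fix zs show "kd L (\<lambda>J. to_NC (\<eta> J)) I zs = to_NC (kd LI \<eta> I) zs"
    by (cases zs) (simp_all add: L_to_NC kd_apply rm_diff rm_sum rm_scale right_diff_distrib sum_subtractf)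
qed

lemma NC_to_NC: assumes "IC m q" shows "NC (Suc m) (to_NC q)"
proof -
  have q1: "NC m (\<lambda>xs. q (1 # xs))" using assms by (simp add: IC_def)
  have "lin (\<lambda>c. to_NC q (c # xs))" for xs
    using assms q1 by (auto simp: IC_def NC_def intro!: lin_diff rm_lin mlin_lin_head[of m "\<lambda>xs. q (1 # xs)"])
  moreover have "NC m (\<lambda>xs. to_NC q (c # xs))" for c
    using assms by (simp add: IC_def NC_diff NC_rm)
  moreover have "van 0 (to_NC q)" using q1 by (simp add: van_0 rm_1 NC_def)
  ultimately show ?thesis by (simp add: NC_Suc IC_def)
qed

lemma to_NC_id: "NC (Suc m) q \<Longrightarrow> to_NC q = q"
proof
  fix zs assume "NC (Suc m) q" then show "to_NC q zs = q zs"
    by (cases zs) (simp_all add: NC_Suc IC_def van_0)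
qed

lemma alt_homogeneous: "card I \<noteq> k \<Longrightarrow> alt k f I = 0"
proof (induction k arbitrary: I)
  case (Suc k)
  have "alt k f (I - {i}) = 0" if "i \<in> I" for i
    using Suc that by (intro Suc.IH) (metis card.remove finite)
  then show ?case by (simp add: contract_def fun_eq_iff)
qed auto

text \<open>For k = 0 this is the cocycle condition, by which every L i kills f; contraction
  anticommutes with the differential and carries it to larger k.\<close>

lemma kd_alt: "cocycle f \<Longrightarrow> kd L (alt k f) I = 0"
proof (induction k arbitrary: I)
  case 0
  then have "L i (if b then f else 0) = 0" for i b
    by (cases b) (simp_all add: L_def cocycle_def fun_eq_iff zero_fun_def)
  then show ?case by (simp add: kd_def)
next
  case (Suc k)
  have "kd L (alt (Suc k) f) I zs = - contract (kd L (alt k f)) I zs" for zs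
    by (simp add: contract_kd)
  also have "\<dots> zs = 0" for zs using Suc by (simp add: contract_def)
  finally show ?case by (simp add: fun_eq_iff)
qed

lemma NC_contract: "(\<And>I. NC (Suc m) (\<phi> I)) \<Longrightarrow> NC m (contract \<phi> I)"
  unfolding contract_def by (intro NC_sum NC_scale) (simp add: NC_Suc IC_def)

lemma NC_alt: "NC n f \<Longrightarrow> k \<le> n \<Longrightarrow> NC (n - k) (alt k f I)"
proof (induction k arbitrary: I)
  case 0 then show ?case by (simp add: NC_zero[unfolded] zero_fun_def)
next
  case (Suc k)
  have "NC (Suc (n - Suc k)) (alt k f I)" for I
    using Suc by (metis Suc_diff_Suc Suc_leD Suc_le_lessD)
  then show ?case by (simp add: NC_contract)
qed

lemma y_eq_e: "y l = e (Poly_Mapping.single l 1)"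
  using e_add[of 0 l] by (simp add: e_0)

text \<open>The value of \<psi> at I is stored at I without its largest element t, with the
  functional dual to y t in the new slot. Among the terms of the contraction at I only i = t then
  contributes, and the factor (-1) ^ card J compensates its sign. The functionals vanish on 1, which
  keeps \<theta> normalized.\<close>

lemma contract_surj:
  assumes \<psi>: "\<And>J. NC m (\<psi> J)" and \<psi>0: "\<psi> {} = 0"
  obtains \<theta> where "\<And>J. NC (Suc m) (\<theta> J)" "\<And>I. contract \<theta> I = \<psi> I"
proof -
  define \<ll> where "\<ll> i c = ext (\<lambda>\<mu>. if \<mu> = Poly_Mapping.single i 1 then 1 else 0) c" for i c
  have \<ll>y: "\<ll> i (y l) = (if l = i then 1 else 0)" for i l
    by (simp add: \<ll>_def y_eq_e ext_e poly_mapping_eq_iff fun_eq_iff lookup_single when_def)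
  have \<ll>1: "\<ll> i 1 = 0" for i
    using ext_e[of "\<lambda>\<mu>. if \<mu> = Poly_Mapping.single i 1 then 1 else 0" 0]
    by (auto simp: \<ll>_def e_0 poly_mapping_eq_iff fun_eq_iff lookup_single when_def)
  define top where "top J = {i. \<forall>j\<in>J. ord j < ord i}" for J
  define \<theta> where "\<theta> J = (\<lambda>zs. case zs of [] \<Rightarrow> 0 | c # xs \<Rightarrow>
      (\<Sum>i\<in>top J. \<ll> i c * ((-1) ^ card J * \<psi> (insert i J) xs)))" for J
  have "NC (Suc m) (\<theta> J)" for J
    unfolding NC_Suc IC_def
  proof (intro conjI allI)
    show "NC m (\<lambda>xs. \<theta> J (c # xs))" for c
      by (simp add: \<theta>_def) (intro NC_sum NC_scale \<psi>)
    show "lin (\<lambda>c. \<theta> J (c # xs))" for xs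
    proof -
      have "lin (\<lambda>c. \<ll> i c * r)" for i r
        using lin_ext unfolding lin_def \<ll>_def by (simp add: algebra_simps)
      then show ?thesis by (simp add: \<theta>_def lin_sum)
    qed
  qed (simp_all add: \<theta>_def van_0 \<ll>1)
  moreover have "contract \<theta> I zs = \<psi> I zs" for I zs
  proof (cases "I = {}")
    case True
    then show ?thesis by (simp add: contract_def \<psi>0)
  next
    case False
    define t where "t = (ARG_MAX ord i. i \<in> I)"
    have t: "t \<in> I" "\<And>i. i \<in> I \<Longrightarrow> ord i \<le> ord t"
      using arg_max_natI[of "\<lambda>i. i \<in> I" _ ord "Suc (Max (range ord))"]
        arg_max_nat_le[of "\<lambda>i. i \<in> I" _ ord "Suc (Max (range ord))"] False
      by (auto simp: t_def less_Suc_eq_le)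
    have lt: "ord i < ord t" if "i \<in> I" "i \<noteq> t" for i
      using t(2)[OF that(1)] that(2) inj_ord by (metis injD le_neq_implies_less)
    have "sg i I * \<theta> (I - {i}) (y i # zs) = (if i = t then \<psi> I zs else 0)" if "i \<in> I" for i
    proof -
      have "i \<in> top (I - {i}) \<longleftrightarrow> i = t"
      proof
        assume "i \<in> top (I - {i})"
        then have "i \<noteq> t \<Longrightarrow> ord t < ord i" using t(1) by (auto simp: top_def)
        then show "i = t" using t(2)[OF that] by fastforce
      qed (use lt in \<open>auto simp: top_def\<close>)
      moreover have "{j \<in> I. ord j < ord t} = I - {t}" using lt by auto
      then have "sg t I * (-1) ^ card (I - {t}) = (1 :: 'a)"
        by (simp add: sg_def flip: power_add)
      moreover have "insert i (I - {i}) = I" using that by auto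
      ultimately show ?thesis
        by (cases "i = t") (simp_all add: \<theta>_def \<ll>y if_distrib[of "\<lambda>x. x * _"] sum.delta
            del: card_Diff_insert insert_Diff_single cong: if_cong flip: mult.assoc)
    qed
    then show ?thesis using t(1) by (simp add: contract_def)
  qed
  ultimately show ?thesis using that[of \<theta>] by (simp add: fun_eq_iff)
qed

text \<open>The connecting homomorphism of \<open>0 \<rightarrow> NC m \<rightarrow> IC m \<rightarrow> NC (Suc m) \<rightarrow> 0\<close> in Koszul cohomology
  is induced by \<open>contract\<close>; it is injective because \<open>IC m\<close> is acyclic.\<close>

lemma contract_reflects_exact:
  assumes \<phi>: "\<And>I. NC (Suc m) (\<phi> I)" and closed: "\<And>I. kd L \<phi> I = 0" and \<phi>0: "\<phi> {} = 0"
    and \<psi>: "\<And>J. NC m (\<psi> J)" "\<psi> {} = 0" and eq: "\<And>I. contract \<phi> I = kd L \<psi> I"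
  shows "\<exists>\<eta>. (\<forall>J. NC (Suc m) (\<eta> J)) \<and> (\<forall>I. \<phi> I = kd L \<eta> I)"
proof -
  obtain \<theta> where \<theta>: "\<And>J. NC (Suc m) (\<theta> J)" "\<And>I. contract \<theta> I = \<psi> I"
    using contract_surj[of m \<psi>, OF \<psi>] by blast
  \<comment> \<open>Contraction anticommutes with the differential, so this exact correction makes
    the contraction vanish on the nose. By \<open>kd_LI\<close> the result is also a cocycle in the
    coinduced bimodule.\<close>
  define \<phi>' where "\<phi>' I = \<phi> I + kd L \<theta> I" for I
  have kdNC: "NC (Suc m) (kd L \<theta> I)" for I using Q.kd_closed[of \<theta> "Suc m"] \<theta>(1) by simp
  have \<phi>'NC: "NC (Suc m) (\<phi>' I)" for I
    unfolding \<phi>'_def plus_fun_def by (intro NC_add \<phi> kdNC)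
  have \<phi>'c: "kd L \<phi>' I = 0" for I
    unfolding \<phi>'_def Q.kd_add closed using Q.kd_kd[of \<theta> "Suc m"] \<theta>(1) by simp
  have "contract \<phi>' I zs = contract \<phi> I zs + contract (kd L \<theta>) I zs" for I zs
    by (simp add: contract_def \<phi>'_def algebra_simps sum.distrib)
  also have "\<dots> I zs = 0" for I zs
  proof -
    have "contract \<theta> = \<psi>" using \<theta>(2) by auto
    then show ?thesis by (simp add: contract_kd eq)
  qed
  finally have con: "contract \<phi>' I = (\<lambda>_. 0)" for I by (simp add: fun_eq_iff)
  have LIc: "kd LI \<phi>' I = 0" for I
  proof
    fix zs show "kd LI \<phi>' I zs = 0 zs"
      by (cases zs) (simp add: kd_apply, simp add: kd_LI \<phi>'c con)
  qed
  have "\<exists>\<eta>. (\<forall>J. \<eta> J \<in> {q. IC m q}) \<and> (\<forall>I. \<phi>' I = kd LI \<eta> I)"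
  proof (rule I.koszul_acyclic[where T = TI])
    show "\<phi>' {} = 0" by (simp add: \<phi>'_def \<phi>0 kd_def)
  qed (use \<phi>'NC in \<open>auto simp: TI_add IC_TI LI_TI LI_TI_comm LIc NC_Suc\<close>)
  then obtain \<eta> where \<eta>: "\<And>J. IC m (\<eta> J)" "\<And>I. \<phi>' I = kd LI \<eta> I" by auto
  \<comment> \<open>Project the primitive back to normalized cochains; \<open>to_NC\<close> is a
    chain map and fixes \<phi>'.\<close>
  have "kd L (\<lambda>J. to_NC (\<eta> J)) I = \<phi>' I" for I
    using to_NC_id[OF \<phi>'NC] by (simp add: kd_to_NC flip: \<eta>(2))
  then have "\<phi> I = kd L (\<lambda>J. to_NC (\<eta> J) - \<theta> J) I" for I
    by (simp add: Q.kd_diff \<phi>'_def)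
  then show ?thesis
    using NC_to_NC[OF \<eta>(1)] \<theta>(1)
    by (intro exI[of _ "\<lambda>J. to_NC (\<eta> J) - \<theta> J"]) (simp add: fun_diff_def NC_diff)
qed

lemma e_induct:
  assumes "P 1" "\<And>i a. P a \<Longrightarrow> P (y i * a)"
  shows "P (e \<mu>)"
  by (induction \<mu> rule: monomial_induct) (simp_all only: e_0 e_add assms)

text \<open>Exactness descends from \<open>alt n f\<close> to \<open>alt 1 f\<close>, one
  contraction being undone at a time. A primitive of \<open>alt 1 f\<close> has at the empty set a
  cochain h for which f and \<open>delta h\<close> agree whenever the first argument is some y i; as
  derivations in that argument they agree everywhere.\<close>

theorem coboundary_if_alt_exact:
  assumes f: "cocycle f" "NC n f" and "n > 0"
    and \<psi>: "\<And>J. NC 0 (\<psi> J)" "\<And>I. alt n f I = kd L \<psi> I"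
  shows "\<exists>h. NC (n - 1) h \<and> f = delta h"
proof -
  \<comment> \<open>The support condition makes the primitive vanish at the empty set for k > 1, as
    \<open>contract_reflects_exact\<close> demands.\<close>
  have "\<exists>\<psi>. (\<forall>J. NC (n - k) (\<psi> J)) \<and> (\<forall>J. Suc (card J) \<noteq> k \<longrightarrow> \<psi> J = 0) \<and> (\<forall>I. alt k f I = kd L \<psi> I)"
    if "k \<le> n" "1 \<le> k" for k
    using that
  proof (induction k rule: inc_induct)
    case base
    let ?\<psi> = "\<lambda>J. if Suc (card J) = n then \<psi> J else 0"
    have "alt n f I = kd L ?\<psi> I" for I
      using alt_homogeneous[of I n f] by (simp add: Q.kd_trunc flip: \<psi>(2))
    then show ?case using \<psi>(1) NC_zero by (intro exI[of _ ?\<psi>]) (simp add: zero_fun_def)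
  next
    case (step k)
    have "1 \<le> Suc k" by simp
    from step.IH[OF this] obtain \<psi> where "(\<forall>J. NC (n - Suc k) (\<psi> J)) \<and>
      (\<forall>J. Suc (card J) \<noteq> Suc k \<longrightarrow> \<psi> J = 0) \<and> (\<forall>I. alt (Suc k) f I = kd L \<psi> I)"
      by (elim exE)
    then have \<psi>: "\<And>J. NC (n - Suc k) (\<psi> J)" "\<And>J. Suc (card J) \<noteq> Suc k \<Longrightarrow> \<psi> J = 0"
      "\<And>I. alt (Suc k) f I = kd L \<psi> I" by blast+
    have nk: "n - k = Suc (n - Suc k)" using step by simp
    have "\<exists>\<eta>. (\<forall>J. NC (Suc (n - Suc k)) (\<eta> J)) \<and> (\<forall>I. alt k f I = kd L \<eta> I)"
    proof (rule contract_reflects_exact[OF _ kd_alt[OF f(1)] _ \<psi>(1)])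
      show "NC (Suc (n - Suc k)) (alt k f I)" for I
        using NC_alt[OF f(2), of k I] step nk by simp
    qed (use step \<psi>(2)[of "{}"] \<psi>(3) alt_homogeneous[of "{}" k f] in auto)
    then obtain \<eta> where \<eta>: "\<And>J. NC (n - k) (\<eta> J)" "\<And>I. alt k f I = kd L \<eta> I" by (auto simp: nk)
    let ?\<eta> = "\<lambda>J. if Suc (card J) = k then \<eta> J else 0"
    have "alt k f I = kd L ?\<eta> I" for I
      using alt_homogeneous[of I k f] by (simp add: Q.kd_trunc flip: \<eta>(2))
    then show ?case using \<eta>(1) NC_zero by (intro exI[of _ ?\<eta>]) (simp add: zero_fun_def)
  qed
  from this[of 1] \<open>n > 0\<close> obtain \<psi> where \<psi>: "\<And>J. NC (n - 1) (\<psi> J)" "\<And>I. alt 1 f I = kd L \<psi> I" by auto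
  define h where "h = \<psi> {}"
  have h: "NC (n - 1) h" unfolding h_def by (rule \<psi>(1))
  have sg1: "sg i {i} = (1 :: 'a)" for i
  proof -
    have none: "{j \<in> {i}. ord j < ord i} = {}" by auto
    show ?thesis by (simp only: sg_def none card.empty power_0)
  qed
  have fy: "f (y i # xs) = y i * h xs - rm (y i) h xs" for i xs
  proof -
    have "alt 1 f {i} xs = kd L \<psi> {i} xs" by (rule fun_cong[OF \<psi>(2)])
    then show ?thesis by (simp add: contract_def kd_apply sg1 h_def L_def)
  qed
  obtain m where n: "n = Suc m" using \<open>n > 0\<close> by (cases n) auto
  have "f (c # xs) = c * h xs - rm c h xs" for c xs
  proof -
    \<comment> \<open>The cocycle condition, read as a Leibniz rule in the first argument.\<close>
    have prod: "f (a * b # zs) = a * f (b # zs) + rm b (\<lambda>xs. f (a # xs)) zs" for a b zs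
    proof -
      have "rm a f (b # zs) = a * f (b # zs)" by (rule f(1)[unfolded cocycle_def, rule_format])
      then show ?thesis by (simp add: algebra_simps)
    qed
    have fl: "lin (\<lambda>c. f (c # xs))" for xs using f(2) n by (simp add: NC_Suc IC_def)
    have hl: "lin (\<lambda>c. c * h xs - rm c h xs)" for xs
      by (intro lin_diff rm_lin mlin_lin_head[of "n - 1"]) (use h in \<open>auto simp: NC_def lin_def algebra_simps\<close>)
    have "\<forall>xs. f (e \<mu> # xs) = e \<mu> * h xs - rm (e \<mu>) h xs" for \<mu>
    proof (rule e_induct[where P = "\<lambda>a. \<forall>xs. f (a # xs) = a * h xs - rm a h xs"])
      show "\<forall>xs. f (1 # xs) = 1 * h xs - rm 1 h xs"
      proof
        fix xs
        have "f (1 # xs) = 0" using f(2) by (simp add: n NC_Suc van_0)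
        moreover have "rm 1 h xs = h xs" by (rule rm_1) (use h in \<open>simp add: NC_def\<close>)
        ultimately show "f (1 # xs) = 1 * h xs - rm 1 h xs" by simp
      qed
      fix i a assume IH: "\<forall>xs. f (a # xs) = a * h xs - rm a h xs"
      show "\<forall>xs. f (y i * a # xs) = y i * a * h xs - rm (y i * a) h xs"
      proof
        fix xs
        have "rm a (\<lambda>xs. f (y i # xs)) xs = y i * rm a h xs - rm (y i * a) h xs"
          unfolding fy rm_diff rm_scale rm_rm by (simp only: mult.commute)
        then show "f (y i * a # xs) = y i * a * h xs - rm (y i * a) h xs"
          unfolding prod by (simp add: IH right_diff_distrib mult.assoc)
      qed
    qed
    then show ?thesis using lin_eqI[OF fl hl] by blast
  qed
  moreover have "f [] = 0" using f(2) n by (simp add: NC_Suc IC_def)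
  ultimately have "f zs = delta h zs" for zs by (cases zs) auto
  then show ?thesis using h by blast
qed

end

section \<open>Splitting a cocycle into prescribed cocycles and a coboundary\<close>

context bar_coords begin

lemma alt_comb: "alt k (\<lambda>xs. r * p xs + q xs) I zs = r * alt k p I zs + alt k q I zs"
proof (induction k arbitrary: I zs)
  case (Suc k)
  then show ?case by (simp add: contract_def algebra_simps sum.distrib sum_distrib_left)
qed simp

lemma alt_zero: "alt k (\<lambda>xs. 0) I zs = 0"
  using alt_comb[of k 1 "\<lambda>_. 0" "\<lambda>_. 0" I zs] by simp

lemma alt_sum: "alt k (\<lambda>xs. \<Sum>a\<in>A. r a * w a xs) I zs = (\<Sum>a\<in>A. r a * alt k (w a) I zs)"
  by (induction A rule: infinite_finite_induct) (simp_all add: alt_zero alt_comb)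

text \<open>Only one ordering of one index set meets the support of f. After k contractions the
  first k entries of js have been absorbed into I. The list js need not be increasing for
  \<open>ord\<close>, which leaves an undetermined sign \<epsilon>.\<close>

lemma alt_dual:
  assumes "distinct js" and dual: "\<And>is. f (map y is) = (if is = js then 1 else 0)"
  shows "\<exists>\<epsilon>. \<epsilon> * \<epsilon> = 1 \<and> (\<forall>I. alt (length js) f I [] = (if I = set js then \<epsilon> else 0))"
proof -
  have "\<exists>\<epsilon>. \<epsilon> * \<epsilon> = 1 \<and> (\<forall>I is. alt k f I (map y is)
      = (if I = set (take k js) \<and> is = drop k js then \<epsilon> else 0))" if "k \<le> length js" for k
    using that
  proof (induction k)
    case 0
    then show ?case by (intro exI[of _ 1]) (simp add: dual)
  next
    case (Suc k)
    then obtain \<epsilon> where \<epsilon>: "\<epsilon> * \<epsilon> = 1" "\<And>I is. alt k f I (map y is)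
      = (if I = set (take k js) \<and> is = drop k js then \<epsilon> else 0)" by (meson Suc_leD)
    let ?j = "js ! k" and ?S = "set (take (Suc k) js)"
    have k: "k < length js" using Suc.prems by simp
    have S: "?S = insert ?j (set (take k js))" by (simp add: take_Suc_conv_app_nth[OF k])
    have jn: "?j \<notin> set (take k js)"
      using \<open>distinct js\<close> k by (auto simp: in_set_conv_nth nth_eq_iff_index_eq)
    have dr: "drop k js = ?j # drop (Suc k) js" by (simp add: Cons_nth_drop_Suc[OF k])
    have "alt (Suc k) f I (map y is) = (if I = ?S \<and> is = drop (Suc k) js then sg ?j ?S * \<epsilon> else 0)" for I "is"
    proof -
      have "alt (Suc k) f I (map y is) = (\<Sum>i\<in>I. sg i I * alt k f (I - {i}) (map y (i # is)))"
        by (simp add: contract_def)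
      also have "\<dots> = (\<Sum>i\<in>I. if i = ?j then (if I = ?S \<and> is = drop (Suc k) js then sg ?j ?S * \<epsilon> else 0) else 0)"
      proof (rule sum.cong[OF refl])
        fix i assume "i \<in> I"
        then have "I - {i} = set (take k js) \<and> i # is = drop k js \<longleftrightarrow> i = ?j \<and> I = ?S \<and> is = drop (Suc k) js"
          unfolding dr S using jn by auto
        then show "sg i I * alt k f (I - {i}) (map y (i # is))
          = (if i = ?j then (if I = ?S \<and> is = drop (Suc k) js then sg ?j ?S * \<epsilon> else 0) else 0)"
          unfolding \<epsilon>(2) by auto
      qed
      also have "\<dots> = (if ?j \<in> I then (if I = ?S \<and> is = drop (Suc k) js then sg ?j ?S * \<epsilon> else 0) else 0)"
        by simp
      also have "\<dots> = (if I = ?S \<and> is = drop (Suc k) js then sg ?j ?S * \<epsilon> else 0)"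
        by (auto simp: S)
      finally show ?thesis .
    qed
    moreover have "(sg ?j ?S * \<epsilon>) * (sg ?j ?S * \<epsilon>) = 1"
      using \<epsilon>(1) sg_sq[of ?j ?S, where 'x='a] by (metis mult.assoc mult.left_commute mult_1)
    ultimately show ?case by blast
  qed
  from this[of "length js"] obtain \<epsilon> where "\<epsilon> * \<epsilon> = 1"
    "\<And>I is. alt (length js) f I (map y is) = (if I = set js \<and> is = [] then \<epsilon> else 0)" by auto
  then show ?thesis by (intro exI[of _ \<epsilon>]) (metis list.simps(8))
qed

text \<open>The full antisymmetrization of f is a cocycle in the ordinary Koszul complex of the u i.
  By \<open>koszul_regular\<close> it is exact up to its values on index sets containing K; the w I
  realize these values, and \<open>coboundary_if_alt_exact\<close> disposes of the rest.\<close>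

theorem cocycle_decomposition:
  fixes T :: "'i \<Rightarrow> 'a \<Rightarrow> 'a"
  defines "u i \<equiv> y i - \<sigma> (y i)"
  assumes T_add: "\<And>j a b. j \<in> K \<Longrightarrow> T j (a + b) = T j a + T j b"
    and T_self: "\<And>j a. j \<in> K \<Longrightarrow> T j (u j * a) = a"
    and T_other: "\<And>i j a. j \<in> K \<Longrightarrow> i \<noteq> j \<Longrightarrow> T j (u i * a) = u i * T j a"
    and js: "\<And>I. K \<subseteq> I \<Longrightarrow> distinct (js I) \<and> set (js I) = I"
    and w: "\<And>I. K \<subseteq> I \<Longrightarrow> cocycle (w I) \<and> NC (card I) (w I)"
    and dual: "\<And>I is. K \<subseteq> I \<Longrightarrow> w I (map y is) = (if is = js I then 1 else 0)"
    and f: "cocycle f" "mlin n f"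
  shows "\<exists>p h. mlin (n - 1) h \<and>
    (\<forall>zs. f zs = (\<Sum>I | K \<subseteq> I \<and> card I = n. p I * w I zs) + (if n = 0 then 0 else delta h zs))"
proof -
  let ?\<I> = "{I. K \<subseteq> I \<and> card I = n}"
  obtain h1 where h1: "mlin (n - 1) h1" "NC n (\<lambda>xs. f xs - (if n = 0 then 0 else delta h1 xs))"
    using normalize[OF f] by blast
  define f1 where "f1 = (\<lambda>xs. f xs - (if n = 0 then 0 else delta h1 xs))"
  have f1: "NC n f1" "cocycle f1"
    using h1 f(1) cocycle_diff[OF f(1) cocycle_delta[of h1]] by (cases "n = 0"; simp add: f1_def)+
  define L0 where "L0 i a = u i * a" for i a
  interpret K0: koszul ord L0 UNIV
    by unfold_locales (simp_all add: L0_def algebra_simps)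
  have kd0: "kd L \<phi> I [] = kd L0 (\<lambda>J. \<phi> J []) I" for \<phi> I
    unfolding kd_apply by (simp add: kd_def L_def L0_def u_def algebra_simps)
  define \<phi> where "\<phi> I = alt n f1 I []" for I
  have "kd L0 \<phi> I = 0" for I
    unfolding \<phi>_def kd0[symmetric] by (simp add: kd_alt f1)
  then obtain \<eta> where \<eta>: "\<And>I. \<not> K \<subseteq> I \<Longrightarrow> \<phi> I = kd L0 \<eta> I"
    using K0.koszul_regular[of K T \<phi>] by (auto simp: L0_def T_add T_self T_other)
  have "\<exists>\<epsilon>. \<epsilon> * \<epsilon> = 1 \<and> (\<forall>J. alt n (w I) J [] = (if J = I then \<epsilon> else 0))" if "I \<in> ?\<I>" for I
  proof -
    have "K \<subseteq> I" "length (js I) = n"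
      using that js[of I] distinct_card[of "js I"] by auto
    then show ?thesis using alt_dual[of "js I" "w I"] js[of I] dual[of I] by simp
  qed
  then obtain \<epsilon> where \<epsilon>: "\<And>I. I \<in> ?\<I> \<Longrightarrow> \<epsilon> I * \<epsilon> I = 1"
    "\<And>I J. I \<in> ?\<I> \<Longrightarrow> alt n (w I) J [] = (if J = I then \<epsilon> I else 0)" by metis
  \<comment> \<open>The value left at I by the elimination, divided by the sign with which w I
    antisymmetrizes; \<epsilon> I is its own inverse.\<close>
  define p where "p I = (\<phi> I - kd L0 \<eta> I) * \<epsilon> I" for I
  define f2 where "f2 = (\<lambda>xs. f1 xs - (\<Sum>I\<in>?\<I>. p I * w I xs))"
  have f2: "cocycle f2" "NC n f2"
    unfolding f2_def using w f1
    by (auto intro!: cocycle_diff cocycle_sum cocycle_scale NC_diff NC_sum NC_scale)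
  have altf2: "alt n f2 J [] = (if card J = n then kd L0 \<eta> J else 0)" for J
  proof -
    have "alt n f2 J [] = \<phi> J - (\<Sum>I\<in>?\<I>. p I * alt n (w I) J [])"
      using alt_comb[of n "-1" "\<lambda>xs. \<Sum>I\<in>?\<I>. p I * w I xs" f1 J "[]"]
      by (simp add: f2_def \<phi>_def alt_sum)
    also have "(\<Sum>I\<in>?\<I>. p I * alt n (w I) J []) = (\<Sum>I\<in>?\<I>. if I = J then \<phi> I - kd L0 \<eta> I else 0)"
      using \<epsilon> by (intro sum.cong refl) (auto simp: p_def mult.assoc)
    also have "\<dots> = (if J \<in> ?\<I> then \<phi> J - kd L0 \<eta> J else 0)" by simp
    finally show ?thesis using \<eta>[of J] alt_homogeneous[of J n f1] by (auto simp: \<phi>_def)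
  qed
  \<comment> \<open>\<eta> is a primitive in all degrees at once, whereas \<open>alt n f2\<close>
    lives on sets of size n, so it is cut down to size n - 1.\<close>
  define \<psi> where "\<psi> J = (\<lambda>zs :: 'a list. if zs = [] then (if Suc (card J) = n then \<eta> J else 0) else 0)"
    for J
  have \<psi>: "NC 0 (\<psi> J)" for J by (simp add: NC_def \<psi>_def van_def)
  have eq: "alt n f2 I = kd L \<psi> I" for I
  proof
    fix zs show "alt n f2 I zs = kd L \<psi> I zs"
    proof (cases zs)
      case Nil
      then show ?thesis by (simp add: kd0 altf2 \<psi>_def K0.kd_trunc)
    next
      case (Cons z zs')
      have "NC 0 (alt n f2 I)" using NC_alt[OF f2(2), of n I] by simp
      moreover have "NC 0 (kd L \<psi> I)" using Q.kd_closed[of \<psi> 0 I] \<psi> by simp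
      ultimately show ?thesis using Cons by (simp add: NC_def)
    qed
  qed
  show ?thesis
  proof (cases "n = 0")
    case True
    have "f2 = 0" using eq[of "{}"] True by (simp add: kd_def)
    then have "f zs = (\<Sum>I\<in>?\<I>. p I * w I zs)" for zs
      using True by (simp add: f2_def f1_def fun_eq_iff)
    then show ?thesis using True h1(1) by auto
  next
    case False
    then obtain h2 where h2: "NC (n - 1) h2" "f2 = delta h2"
      using coboundary_if_alt_exact[OF f2 _ \<psi> eq] by auto
    have "mlin (n - 1) (\<lambda>xs. h1 xs + h2 xs)"
      using mlin_comb[OF h1(1), of h2 1] h2(1) by (simp add: NC_def)
    moreover have "f zs = (\<Sum>I\<in>?\<I>. p I * w I zs) + delta (\<lambda>xs. h1 xs + h2 xs) zs" for zs
      using fun_cong[OF h2(2), of zs] False by (simp add: delta_add f2_def f1_def algebra_simps)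
    ultimately show ?thesis using False by auto
  qed
qed

end

section \<open>Linear maps and automorphisms of the polynomial ring\<close>

abbreviation pmon :: "('n \<Rightarrow>\<^sub>0 nat) \<Rightarrow> 'n spoly" where
  "pmon \<mu> \<equiv> Poly_Mapping.single \<mu> 1"

definition plin :: "('n spoly \<Rightarrow> 'n spoly) \<Rightarrow> bool" where
  "plin \<phi> \<longleftrightarrow> (\<forall>c a b. \<phi> (pconst c * a + b) = pconst c * \<phi> a + \<phi> b)"

definition psum :: "(('n \<Rightarrow>\<^sub>0 nat) \<Rightarrow> 'n spoly) \<Rightarrow> 'n spoly \<Rightarrow> 'n spoly" where
  "psum t p = (\<Sum>\<mu>\<in>Poly_Mapping.keys p. pconst (Poly_Mapping.lookup p \<mu>) * t \<mu>)"

lemma pconst_add: "pconst (a + b) = pconst a + pconst b" by (simp add: pconst_def single_add)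
lemma pconst_mult: "pconst (a * b) = pconst a * pconst b" by (simp add: pconst_def mult_single)
lemma pconst_1: "pconst 1 = 1" by (simp add: pconst_def)
lemma pconst_0: "pconst 0 = 0" by (simp add: pconst_def)
lemma pconst_neg: "pconst (- a) = - pconst a" by (simp add: pconst_def single_uminus)
lemma pconst_sum: "pconst (sum f A) = (\<Sum>a\<in>A. pconst (f a))"
  by (induction A rule: infinite_finite_induct) (simp_all add: pconst_0 pconst_add)

lemma lookup_pconst_mult: "Poly_Mapping.lookup (pconst c * p) \<mu> = c * Poly_Mapping.lookup p \<mu>"
  unfolding pconst_def mult_map_scale_conv_mult[symmetric] by (simp add: Poly_Mapping.map.rep_eq when_def)

lemma psum_superset:
  assumes "finite A" "Poly_Mapping.keys p \<subseteq> A"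
  shows "psum t p = (\<Sum>\<mu>\<in>A. pconst (Poly_Mapping.lookup p \<mu>) * t \<mu>)"
  unfolding psum_def using assms
  by (intro sum.mono_neutral_left) (auto simp: in_keys_iff pconst_0)

lemma plin_psum: "plin (psum t)"
  unfolding plin_def
proof (intro allI)
  fix c and a b :: "'a spoly"
  let ?A = "Poly_Mapping.keys a \<union> Poly_Mapping.keys b"
  have "Poly_Mapping.keys (pconst c * a + b) \<subseteq> ?A"
    by (auto simp: in_keys_iff lookup_add lookup_pconst_mult)
  then have "psum t (pconst c * a + b) = (\<Sum>\<mu>\<in>?A. pconst (Poly_Mapping.lookup (pconst c * a + b) \<mu>) * t \<mu>)"
    by (intro psum_superset) auto
  also have "\<dots> = pconst c * psum t a + psum t b"
    by (simp add: psum_superset[of ?A] lookup_add lookup_pconst_mult pconst_add pconst_mult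
        distrib_right sum.distrib sum_distrib_left mult.assoc)
  finally show "psum t (pconst c * a + b) = pconst c * psum t a + psum t b" .
qed

lemma psum_mono: "psum t (pmon \<mu>) = t \<mu>"
  by (simp add: psum_def pconst_1)

lemma plinD: "plin \<phi> \<Longrightarrow> \<phi> (pconst c * a + b) = pconst c * \<phi> a + \<phi> b"
  by (simp add: plin_def)

lemma plin_add: "plin \<phi> \<Longrightarrow> \<phi> (a + b) = \<phi> a + \<phi> b"
  using plinD[of \<phi> 1 a b] by (simp add: pconst_1)

lemma plin_0: "plin \<phi> \<Longrightarrow> \<phi> 0 = 0"
  using plin_add[of \<phi> 0 0] by simp

lemma plin_scale: "plin \<phi> \<Longrightarrow> \<phi> (pconst c * a) = pconst c * \<phi> a"
  using plinD[of \<phi> c a 0] by (simp add: plin_0)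

lemma plin_sum: "plin \<phi> \<Longrightarrow> \<phi> (sum f A) = (\<Sum>a\<in>A. \<phi> (f a))"
  by (induction A rule: infinite_finite_induct) (simp_all add: plin_0 plin_add)

lemma plin_diff: "plin \<phi> \<Longrightarrow> \<phi> (a - b) = \<phi> a - \<phi> b"
  using plinD[of \<phi> "-1" b a] by (simp add: pconst_neg pconst_1)

lemma plin_comp: "plin \<phi> \<Longrightarrow> plin \<psi> \<Longrightarrow> plin (\<lambda>a. \<phi> (\<psi> a))" by (simp add: plin_def)
lemma plin_minus: "plin \<phi> \<Longrightarrow> plin \<psi> \<Longrightarrow> plin (\<lambda>a. \<phi> a - \<psi> a)" by (simp add: plin_def algebra_simps)
lemma plin_plus: "plin \<phi> \<Longrightarrow> plin \<psi> \<Longrightarrow> plin (\<lambda>a. \<phi> a + \<psi> a)" by (simp add: plin_def algebra_simps)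
lemma plin_lmult: "plin \<phi> \<Longrightarrow> plin (\<lambda>a. r * \<phi> a)" by (simp add: plin_def algebra_simps)
lemma plin_rmult: "plin \<phi> \<Longrightarrow> plin (\<lambda>a. \<phi> a * r)" by (simp add: plin_def algebra_simps)
lemma plin_id: "plin (\<lambda>a. a)" by (simp add: plin_def)
lemma plin_arg_lmult: "plin \<phi> \<Longrightarrow> plin (\<lambda>a. \<phi> (r * a))"
  by (rule plin_comp) (simp_all add: plin_def algebra_simps)
lemma plin_arg_rmult: "plin \<phi> \<Longrightarrow> plin (\<lambda>a. \<phi> (a * r))"
  by (rule plin_comp) (simp_all add: plin_def algebra_simps)

lemma poly_expand: "p = (\<Sum>\<mu>\<in>Poly_Mapping.keys p. pconst (Poly_Mapping.lookup p \<mu>) * pmon \<mu>)"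
proof (rule poly_mapping_eqI)
  fix \<nu>
  show "Poly_Mapping.lookup p \<nu> = Poly_Mapping.lookup (\<Sum>\<mu>\<in>Poly_Mapping.keys p. pconst (Poly_Mapping.lookup p \<mu>) * pmon \<mu>) \<nu>"
    by (simp add: lookup_sum lookup_pconst_mult lookup_single when_def if_distrib sum.delta in_keys_iff cong: if_cong)
qed

lemma plin_eqI:
  assumes "plin \<phi>" "plin \<psi>" "\<And>\<mu>. \<phi> (pmon \<mu>) = \<psi> (pmon \<mu>)"
  shows "\<phi> p = \<psi> p"
  by (subst (1 2) poly_expand[of p]) (simp add: plin_sum plin_scale assms)

lemma mono_add_single: "pmon (\<mu> + Poly_Mapping.single i 1) = pvar i * pmon \<mu>"
  by (simp add: pvar_def mult_single add.commute)

lemma pvar_mono: "pvar i * pmon \<mu> = pmon (\<mu> + Poly_Mapping.single i (Suc 0))"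
  by (simp add: pvar_def mult_single add.commute)

lemma plin_eq_induct:
  fixes \<phi> :: "'n::finite spoly \<Rightarrow> 'n spoly"
  assumes "plin \<phi>" "plin \<psi>" "\<phi> 1 = \<psi> 1" "\<And>i a. \<phi> a = \<psi> a \<Longrightarrow> \<phi> (pvar i * a) = \<psi> (pvar i * a)"
  shows "\<phi> p = \<psi> p"
proof (rule plin_eqI[OF assms(1,2)])
  fix \<mu> :: "'n \<Rightarrow>\<^sub>0 nat"
  show "\<phi> (pmon \<mu>) = \<psi> (pmon \<mu>)"
    by (induction \<mu> rule: monomial_induct) (simp add: assms(3), simp only: mono_add_single assms(4))
qed

lemma act_psum: "act g = psum (\<lambda>\<mu>. \<Prod>i\<in>UNIV. lin_img g i ^ Poly_Mapping.lookup \<mu> i)"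
  by (rule ext) (simp add: act_def psum_def)

lemma plin_act: "plin (act g)" unfolding act_psum by (rule plin_psum)

lemma act_1: "act g 1 = 1"
proof -
  have "act g (pmon 0) = 1" unfolding act_psum psum_mono by simp
  then show ?thesis by simp
qed

lemma act_pvar_mono: "act g (pvar i * pmon \<mu>) = lin_img g i * act g (pmon \<mu>)"
proof -
  have "(\<Prod>l\<in>UNIV. lin_img g l ^ Poly_Mapping.lookup (Poly_Mapping.single i (Suc 0)) l) = (\<Prod>l\<in>UNIV. if l = i then lin_img g l else 1)"
    by (intro prod.cong) (auto simp: lookup_single)
  also have "\<dots> = lin_img g i" by simp
  finally show ?thesis
    unfolding pvar_mono act_psum psum_mono by (simp add: lookup_add power_add prod.distrib)
qed

lemma act_pvar: "act g (pvar i) = lin_img g i"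
  using act_pvar_mono[of g i 0] by (simp add: act_1)

lemma act_pvar_mult: "act g (pvar i * a) = lin_img g i * act g a"
  by (rule plin_eqI[of "\<lambda>a. act g (pvar i * a)"])
    (simp_all only: plin_arg_lmult plin_lmult plin_act act_pvar_mono)

lemma act_mult: "act g (a * b) = act g a * act g b"
proof (rule plin_eq_induct[of "\<lambda>a. act g (a * b)" "\<lambda>a. act g a * act g b"])
  show "plin (\<lambda>a. act g (a * b))" "plin (\<lambda>a. act g a * act g b)"
    by (simp_all add: plin_arg_rmult plin_rmult plin_act)
qed (simp_all add: act_1 act_pvar_mult mult.assoc)

lemma act_pconst: "act g (pconst c) = pconst c"
  using plin_scale[OF plin_act, of g c 1] by (simp add: act_1)

section \<open>Linear forms and the functoriality of the action\<close>

definition lform :: "complex^'n::finite \<Rightarrow> 'n spoly" where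
  "lform v = (\<Sum>k\<in>UNIV. pconst (v $ k) * pvar k)"

lemma lform_add: "lform (v + w) = lform v + lform w"
  by (simp add: lform_def pconst_add algebra_simps sum.distrib)

lemma lform_diff: "lform (v - w) = lform v - lform w"
  using lform_add[of "v - w" w] by simp

lemma lform_scale: "lform (c *s v) = pconst c * lform v"
  by (simp add: lform_def pconst_mult mult.assoc sum_distrib_left)

lemma lform_0: "lform 0 = 0" using lform_diff[of 0 0] by simp

lemma lform_axis: "lform (axis i 1) = pvar i"
  by (simp add: lform_def axis_def if_distrib[of pconst] pconst_0 pconst_1 if_distrib[of "\<lambda>x. x * _"] cong: if_cong)

lemma lin_img_lform: "lin_img g i = lform (column i g)"
  by (simp add: lin_img_def lform_def column_def)

lemma act_lform: "act g (lform v) = lform (g *v v)"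
proof -
  have "act g (lform v) = (\<Sum>k\<in>UNIV. \<Sum>j\<in>UNIV. pconst (v $ k) * (pconst (g $ j $ k) * pvar j))"
    by (simp add: lform_def plin_sum[OF plin_act] plin_scale[OF plin_act] act_pvar lin_img_def sum_distrib_left)
  also have "\<dots> = (\<Sum>j\<in>UNIV. \<Sum>k\<in>UNIV. pconst (v $ k) * (pconst (g $ j $ k) * pvar j))"
    by (rule sum.swap)
  also have "\<dots> = lform (g *v v)"
    by (simp add: lform_def matrix_vector_mult_def pconst_sum pconst_mult sum_distrib_left sum_distrib_right mult_ac)
  finally show ?thesis .
qed

lemma act_act: "act g (act h p) = act (g ** h) p"
proof (rule plin_eq_induct[of "\<lambda>p. act g (act h p)"])
  fix i a assume "act g (act h a) = act (g ** h) a"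
  then show "act g (act h (pvar i * a)) = act (g ** h) (pvar i * a)"
    by (simp add: act_mult act_lform matrix_vector_mul_assoc flip: lform_axis)
qed (simp_all add: plin_act plin_comp act_1)

lemma act_id: "act (mat 1) p = p"
  by (rule plin_eq_induct[of "act (mat 1)" "\<lambda>p. p"])
    (simp_all add: plin_act plin_id act_1 act_mult act_lform flip: lform_axis)

section \<open>Division by a linear form and twisted derivations\<close>

text \<open>Division by the j-th variable with the remainder dropped. This is a linear left inverse
  of multiplication by that variable, the kind of operator that \<open>cocycle_decomposition\<close>
  takes as T.\<close>

definition pdiv :: "'n \<Rightarrow> 'n spoly \<Rightarrow> 'n spoly" where
  "pdiv j = psum (\<lambda>\<mu>. if Poly_Mapping.lookup \<mu> j = 0 then 0 else pmon (\<mu> - Poly_Mapping.single j 1))"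

lemma pdiv_pvar: "pdiv j (pvar j * p) = p"
proof (rule plin_eqI[of "\<lambda>p. pdiv j (pvar j * p)" "\<lambda>p. p"])
  fix \<mu> show "pdiv j (pvar j * pmon \<mu>) = pmon \<mu>"
    by (simp add: pdiv_def pvar_mono psum_mono lookup_add)
qed (simp_all add: plin_arg_lmult plin_id pdiv_def plin_psum)

lemma pdiv_pvar_neq:
  assumes "i \<noteq> j" shows "pdiv j (pvar i * p) = pvar i * pdiv j p"
proof (rule plin_eqI[of "\<lambda>p. pdiv j (pvar i * p)" "\<lambda>p. pvar i * pdiv j p"])
  fix \<mu> :: "'a \<Rightarrow>\<^sub>0 nat"
  have "Poly_Mapping.lookup \<mu> j \<noteq> 0 \<Longrightarrow> \<mu> + Poly_Mapping.single i (Suc 0) - Poly_Mapping.single j (Suc 0)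
     = \<mu> - Poly_Mapping.single j (Suc 0) + Poly_Mapping.single i (Suc 0)"
    using assms by (intro poly_mapping_eqI) (auto simp: lookup_add lookup_minus lookup_single when_def)
  then show "pdiv j (pvar i * pmon \<mu>) = pvar i * pdiv j (pmon \<mu>)"
    using assms by (simp add: pdiv_def pvar_mono psum_mono lookup_add lookup_single)
qed (simp_all add: plin_arg_lmult plin_lmult pdiv_def plin_psum)

text \<open>With B' inverse to B, \<open>act B'\<close> turns the form given by column j of B into a
  variable; the quotient is then carried back by \<open>act B\<close>.\<close>

definition lindiv :: "'n::finite cmat \<Rightarrow> 'n cmat \<Rightarrow> 'n \<Rightarrow> 'n spoly \<Rightarrow> 'n spoly" where
  "lindiv B B' j p = act B (pdiv j (act B' p))"

lemma plin_lindiv: "plin (lindiv B B' j)"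
  unfolding lindiv_def[abs_def] pdiv_def by (intro plin_comp[OF plin_act] plin_comp[OF plin_psum] plin_act)

lemma act_inverse_column: "B' ** B = mat 1 \<Longrightarrow> act B' (lform (column i B)) = pvar i"
  by (simp add: act_act act_id flip: lin_img_lform act_pvar)

lemma lindiv_self:
  assumes "B ** B' = mat 1" "B' ** B = mat 1"
  shows "lindiv B B' j (lform (column j B) * p) = p"
  using assms by (simp add: lindiv_def act_mult act_inverse_column pdiv_pvar act_act act_id)

lemma lindiv_other:
  assumes "B' ** B = mat 1" "i \<noteq> j"
  shows "lindiv B B' j (lform (column i B) * p) = lform (column i B) * lindiv B B' j p"
  using assms
  by (simp add: lindiv_def act_mult act_inverse_column pdiv_pvar_neq act_pvar lin_img_lform)

text \<open>The Leibniz rule of a Hochschild 1-cocycle with values in S s.\<close>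

definition twisted_der :: "'n::finite cmat \<Rightarrow> ('n spoly \<Rightarrow> 'n spoly) \<Rightarrow> bool" where
  "twisted_der s D \<longleftrightarrow> plin D \<and> (\<forall>a b. D (a * b) = a * D b + D a * act s b)"

definition dird :: "('n::finite \<Rightarrow> complex) \<Rightarrow> 'n spoly \<Rightarrow> 'n spoly" where
  "dird c = psum (\<lambda>\<mu>. \<Sum>i\<in>UNIV. pconst (c i * of_nat (Poly_Mapping.lookup \<mu> i)) * pmon (\<mu> - Poly_Mapping.single i 1))"

lemma dird_pvar_mono: "dird c (pvar i * pmon \<mu>) = pconst (c i) * pmon \<mu> + pvar i * dird c (pmon \<mu>)"
proof -
  have "dird c (pvar i * pmon \<mu>) = (\<Sum>l\<in>UNIV. (if l = i then pconst (c i) * pmon \<mu> else 0)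
      + pvar i * (pconst (c l * of_nat (Poly_Mapping.lookup \<mu> l)) * pmon (\<mu> - Poly_Mapping.single l 1)))"
    unfolding dird_def pvar_mono psum_mono
  proof (rule sum.cong[OF refl])
    fix l
    let ?k = "Poly_Mapping.lookup \<mu> l" and ?\<nu> = "\<mu> + Poly_Mapping.single i (Suc 0)"
    have \<nu>: "\<mu> - Poly_Mapping.single l 1 + Poly_Mapping.single i (Suc 0) = ?\<nu> - Poly_Mapping.single l 1" if "?k \<noteq> 0"
      using that by (intro poly_mapping_eqI) (auto simp: lookup_add lookup_minus lookup_single when_def)
    have *: "pvar i * (pconst (c l * of_nat ?k) * pmon (\<mu> - Poly_Mapping.single l 1))
        = pconst (c l * of_nat ?k) * pmon (?\<nu> - Poly_Mapping.single l 1)"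
      unfolding mult.left_commute[of "pvar i"] pvar_mono using \<nu> by (cases "?k = 0") (simp_all add: pconst_0)
    show "pconst (c l * of_nat (Poly_Mapping.lookup ?\<nu> l)) * pmon (?\<nu> - Poly_Mapping.single l 1)
       = (if l = i then pconst (c i) * pmon \<mu> else 0)
       + pvar i * (pconst (c l * of_nat ?k) * pmon (\<mu> - Poly_Mapping.single l 1))"
      unfolding * by (cases "l = i") (simp_all add: lookup_add lookup_single ring_distribs pconst_add)
  qed
  then show ?thesis by (simp add: sum.distrib sum_distrib_left dird_def psum_mono)
qed

lemma plin_dird: "plin (dird c)" by (simp add: dird_def plin_psum)

lemma dird_pvar_mult: "dird c (pvar i * a) = pconst (c i) * a + pvar i * dird c a"
  by (rule plin_eqI[of "\<lambda>a. dird c (pvar i * a)"])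
    (simp_all only: plin_arg_lmult plin_plus plin_lmult plin_id plin_dird dird_pvar_mono)

lemma twisted_der_1: "twisted_der s D \<Longrightarrow> D 1 = 0"
  unfolding twisted_der_def by (metis act_1 add_cancel_right_left mult_1 mult.right_neutral)

lemma dird_1: "dird c 1 = 0"
proof -
  have "dird c (pmon 0) = 0" unfolding dird_def psum_mono by (simp add: pconst_0)
  then show ?thesis by simp
qed

lemma dird_pvar: "dird c (pvar i) = pconst (c i)"
  using dird_pvar_mult[of c i 1] by (simp add: dird_1)

lemma twisted_der_dird: "twisted_der (mat 1) (dird c)"
  unfolding twisted_der_def act_id
proof (intro conjI allI)
  fix a b
  show "dird c (a * b) = a * dird c b + dird c a * b"
  proof (rule plin_eq_induct[of "\<lambda>a. dird c (a * b)" "\<lambda>a. a * dird c b + dird c a * b"])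
    show "plin (\<lambda>a. dird c (a * b))" "plin (\<lambda>a. a * dird c b + dird c a * b)"
      by (simp_all add: plin_arg_rmult plin_plus plin_rmult plin_id plin_dird)
  qed (simp_all add: dird_1 dird_pvar_mult mult.assoc, simp add: algebra_simps)
qed (rule plin_dird)

lemma twisted_der_lform:
  assumes "twisted_der s D" "\<And>i. D (pvar i) = pconst (c i)"
  shows "D (lform v) = pconst (\<Sum>i\<in>UNIV. c i * v $ i)"
proof -
  have "plin D" using assms(1) by (simp add: twisted_der_def)
  then show ?thesis
    by (simp add: lform_def plin_sum plin_scale pconst_sum pconst_mult assms(2)) (simp add: mult.commute)
qed

text \<open>The divided difference \<open>(p - s p) / \<alpha>\<close> of a reflection \<open>s\<close> with root \<open>\<alpha>\<close>.\<close>

lemma twisted_der_reflection: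
  fixes s B B' :: "'n::finite cmat"
  assumes B: "B ** B' = mat 1" "B' ** B = mat 1"
    and s: "\<And>i. axis i 1 - s *v axis i 1 = c i *s column j B"
  shows "\<exists>D. twisted_der s D \<and> (\<forall>i. D (pvar i) = pconst (c i))"
proof (intro exI conjI allI)
  let ?\<alpha> = "lform (column j B)" and ?T = "lindiv B B' j"
  define D where "D p = ?T (p - act s p)" for p
  have T: "?T (?\<alpha> * p) = p" for p by (rule lindiv_self[OF B])
  have pv: "pvar i - act s (pvar i) = pconst (c i) * ?\<alpha>" for i
    by (simp add: act_lform s flip: lform_axis lform_diff lform_scale)
  have lD: "plin D"
    unfolding D_def[abs_def] by (intro plin_comp[OF plin_lindiv] plin_minus plin_id plin_act)
  \<comment> \<open>\<open>?T\<close> merely undoes a multiplication by the root, so divisibility of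
    p - s p has to be proved. It is inherited from a by x_i a, since x_i - s x_i is itself a
    multiple of the root.\<close>
  have mul: "?\<alpha> * D p = p - act s p" for p
  proof (rule plin_eq_induct[of "\<lambda>p. ?\<alpha> * D p" "\<lambda>p. p - act s p"])
    show "plin (\<lambda>p. ?\<alpha> * D p)" "plin (\<lambda>p. p - act s p)"
      by (simp_all add: plin_lmult lD plin_minus plin_id plin_act)
    show "?\<alpha> * D 1 = 1 - act s 1" by (simp add: act_1 D_def plin_0[OF plin_lindiv])
    fix i a assume IH: "?\<alpha> * D a = a - act s a"
    have "pvar i * a - act s (pvar i * a) = (pvar i - act s (pvar i)) * a + act s (pvar i) * (a - act s a)"
      by (simp add: act_mult algebra_simps)
    also have "\<dots> = ?\<alpha> * (pconst (c i) * a + act s (pvar i) * D a)"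
      unfolding pv IH[symmetric] by (simp add: algebra_simps)
    finally have "pvar i * a - act s (pvar i * a) = \<dots>" .
    then show "?\<alpha> * D (pvar i * a) = pvar i * a - act s (pvar i * a)"
      unfolding D_def by (simp add: T)
  qed
  have "D (a * b) = a * D b + D a * act s b" for a b
  proof -
    have "a * b - act s (a * b) = a * (b - act s b) + (a - act s a) * act s b"
      by (simp add: act_mult algebra_simps)
    also have "\<dots> = ?\<alpha> * (a * D b + D a * act s b)"
      unfolding mul[symmetric] by (simp add: algebra_simps)
    finally show ?thesis unfolding D_def[of "a * b"] by (simp only: T)
  qed
  then show "twisted_der s D" using lD by (simp add: twisted_der_def)
  show "D (pvar i) = pconst (c i)" for i
    using T[of "pconst (c i)"] by (simp add: D_def pv mult.commute)
qed

section \<open>Reflections and roots\<close>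

text \<open>Bilinear, without conjugation, so that c stands for a complex-linear functional.\<close>

definition cdot :: "complex^'n::finite \<Rightarrow> complex^'n \<Rightarrow> complex" where
  "cdot c v = (\<Sum>i\<in>UNIV. c $ i * v $ i)"

lemma cdot_scale_left: "cdot (a *s c) v = a * cdot c v"
  by (simp add: cdot_def sum_distrib_left mult.assoc)
lemma cdot_add_left: "cdot (c + d) v = cdot c v + cdot d v"
  by (simp add: cdot_def algebra_simps sum.distrib)
lemma cdot_zero [simp]: "cdot 0 v = 0" "cdot c 0 = 0" by (simp_all add: cdot_def)
lemma cdot_axis: "cdot c (axis i 1) = c $ i"
  by (simp add: cdot_def axis_def if_distrib[of "\<lambda>x. _ * x"] cong: if_cong)

lemma cdot_row: "cdot (row j A) v = (A *v v) $ j"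
  by (simp add: cdot_def row_def matrix_vector_mult_def)

lemma subspace_cdot: "vec.subspace {c. cdot c v = 0}"
  by (simp add: vec.subspace_def cdot_add_left cdot_scale_left)

lemma subspace_fixed_space: "vec.subspace (fixed_space g)"
  by (simp add: vec.subspace_def fixed_space_def vec.add vec.scale)

text \<open>The fixed hyperplane and any moved vector w span V, so 1 - r maps V to the line through
  w - r w.\<close>

lemma reflection_root:
  assumes "is_reflection r"
  obtains c \<alpha> where "\<alpha> \<noteq> 0" "\<And>v. v - r *v v = cdot c v *s \<alpha>"
proof -
  obtain H where H: "vec.subspace H" "vec.dim H = CARD('a) - 1" "H \<subseteq> fixed_space r"
    and "r \<noteq> mat 1" using assms unfolding is_reflection_def by blast
  have "\<exists>w. r *v w \<noteq> mat 1 *v w" using \<open>r \<noteq> mat 1\<close> matrix_eq by metis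
  then obtain w where w: "r *v w \<noteq> w" by auto
  define \<alpha> where "\<alpha> = w - r *v w"
  have "\<alpha> \<noteq> 0" using w by (simp add: \<alpha>_def)
  have "w \<notin> H" using w H(3) by (auto simp: fixed_space_def)
  then have "w \<notin> vec.span H" using H(1) by (metis vec.span_eq_iff)
  then have "vec.dim (insert w H) = CARD('a)" using H(2) by (simp add: vec.dim_insert)
  then have sp: "vec.span (insert w H) = UNIV"
    using vec.dim_eq_full[of "insert w H"] vec_dim_card[where 'a=complex and 'n='a]
    by (simp add: vec.dimension_def)
  have ex: "\<exists>t. v - r *v v = t *s \<alpha>" for v
  proof -
    obtain t where "v - t *s w \<in> vec.span H" using sp unfolding vec.span_insert by blast
    then have "v - t *s w \<in> H" using H(1) by (metis vec.span_eq_iff)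
    then have "r *v (v - t *s w) = v - t *s w" using H(3) by (auto simp: fixed_space_def)
    then have "r *v v - t *s (r *v w) = v - t *s w" by (simp add: vec.diff vec.scale)
    then have "v - r *v v = t *s \<alpha>" unfolding \<alpha>_def by (simp add: vec.scale_right_diff_distrib algebra_simps)
    then show ?thesis ..
  qed
  define t where "t v = (SOME t. v - r *v v = t *s \<alpha>)" for v
  have t: "v - r *v v = t v *s \<alpha>" for v unfolding t_def by (rule someI_ex[OF ex])
  define c where "c = (\<chi> i. t (axis i 1))"
  have "v - r *v v = cdot c v *s \<alpha>" for v
  proof -
    have v: "v = (\<Sum>i\<in>UNIV. v $ i *s axis i 1)" by (rule basis_expansion[symmetric])
    have "v - r *v v = (\<Sum>i\<in>UNIV. v $ i *s (axis i 1 - r *v axis i 1))"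
      by (subst (1 2) v) (simp add: vec.sum vec.scale vec.scale_right_diff_distrib sum_subtractf)
    also have "\<dots> = cdot c v *s \<alpha>"
      by (simp add: t cdot_def c_def vec.scale_sum_left mult.commute)
    finally show ?thesis .
  qed
  then show ?thesis using that \<open>\<alpha> \<noteq> 0\<close> by blast
qed

text \<open>Completion to a basis, with the given vectors kept at their row indices; a bijection
  distributes the new basis vectors over the remaining rows.\<close>

lemma extend_to_invertible:
  fixes u :: "'n::finite \<Rightarrow> complex^'n"
  assumes inj: "inj_on u K" and ind: "vec.independent (u ` K)"
  obtains A A' where "A ** A' = mat 1" "A' ** A = mat 1" "\<And>j. j \<in> K \<Longrightarrow> row j A = u j"
proof -
  obtain B where B: "u ` K \<subseteq> B" "vec.independent B" "UNIV \<subseteq> vec.span B"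
    using vec.maximal_independent_subset_extend[OF subset_UNIV ind] by metis
  have finB: "finite B" using B(2) by (rule vec.finiteI_independent)
  have "card B = vec.dim (UNIV :: (complex^'n) set)"
    using B by (intro vec.basis_card_eq_dim) auto
  then have cardB: "card B = CARD('n)" by (simp only: vec_dim_card)
  have "card (UNIV - K) = card (B - u ` K)"
    using B(1) cardB inj by (simp add: card_Diff_subset card_image)
  then obtain h where h: "bij_betw h (UNIV - K) (B - u ` K)"
    using finite_same_card_bij[of "UNIV - K" "B - u ` K"] finB by auto
  define f where "f j = (if j \<in> K then u j else h j)" for j
  have "bij_betw f (K \<union> (UNIV - K)) (u ` K \<union> (B - u ` K))"
  proof (rule bij_betw_combine)
    show "bij_betw f K (u ` K)"
      using inj by (auto simp: bij_betw_def f_def inj_on_def)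
    show "bij_betw f (UNIV - K) (B - u ` K)"
      using h by (rule bij_betw_cong[THEN iffD1, rotated]) (simp add: f_def)
  qed auto
  moreover have "u ` K \<union> (B - u ` K) = B" "K \<union> (UNIV - K) = UNIV" using B(1) by auto
  ultimately have bij: "bij_betw f UNIV B" by simp
  define A where "A = (\<chi> i. f i)"
  have rowA: "row i A = f i" for i by (simp add: A_def row_def vec_eq_iff)
  have "\<forall>c. (\<Sum>i\<in>UNIV. c i *s row i A) = 0 \<longrightarrow> (\<forall>i. c i = 0)"
  proof (intro allI impI)
    fix c i assume c: "(\<Sum>i\<in>UNIV. c i *s row i A) = 0"
    let ?g = "the_inv_into UNIV f"
    have g: "?g (f i) = i" for i using bij by (simp add: bij_betw_def the_inv_into_f_f)
    have "(\<Sum>v\<in>B. c (?g v) *s v) = (\<Sum>i\<in>UNIV. c (?g (f i)) *s f i)"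
      by (rule sum.reindex_bij_betw[OF bij, symmetric])
    also have "\<dots> = 0" using c by (simp add: g rowA)
    finally have "(\<Sum>v\<in>B. c (?g v) *s v) = 0" .
    then have "c (?g (f i)) = 0"
      using vec.independentD[OF B(2) finB order_refl, of "\<lambda>v. c (?g v)" "f i"] bij
      by (auto simp: bij_betw_def)
    then show "c i = 0" by (simp add: g)
  qed
  then obtain A' where "A ** A' = mat 1" unfolding matrix_right_invertible_independent_rows[symmetric] ..
  moreover then have "A' ** A = mat 1" by (simp add: matrix_left_right_inverse)
  ultimately show ?thesis using that[of A A'] rowA by (simp add: f_def)
qed

section \<open>Words of reflections and coordinates adapted to a word\<close>

lemma mat_prod_append: "mat_prod (rs @ ss) = mat_prod rs ** mat_prod ss"
  by (induction rs) (simp_all add: mat_prod_def matrix_mul_assoc)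

lemma mat_prod_Cons: "mat_prod (r # rs) = r ** mat_prod rs"
  by (simp add: mat_prod_def)

lemma mat_prod_Nil: "mat_prod [] = mat 1"
  by (simp add: mat_prod_def)

lemma mat_prod_in_group: "is_matgroup G \<Longrightarrow> set rs \<subseteq> G \<Longrightarrow> mat_prod rs \<in> G"
  by (induction rs) (auto simp: mat_prod_Nil mat_prod_Cons is_matgroup_def)

lemma reflection_inverse:
  assumes "is_reflection r" "r ** h = mat 1" "h ** r = mat 1"
  shows "is_reflection h"
proof -
  have "fixed_space r \<subseteq> fixed_space h"
  proof
    fix v assume "v \<in> fixed_space r"
    then have "r *v v = v" by (simp add: fixed_space_def)
    then have "h *v v = h *v (r *v v)" by simp
    also have "\<dots> = v" using assms(3) by (simp add: matrix_vector_mul_assoc)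
    finally show "v \<in> fixed_space h" by (simp add: fixed_space_def)
  qed
  moreover have "h \<noteq> mat 1" using assms by (auto simp: is_reflection_def)
  ultimately show ?thesis using assms unfolding is_reflection_def is_GL_def by blast
qed

text \<open>The inverse of a reflection in G is again a reflection in G, so the products of words
  form a group and contain the generated one.\<close>

lemma reflection_word_exists:
  assumes "is_reflection_group G" "g \<in> G"
  shows "\<exists>rs. set rs \<subseteq> refls G \<and> mat_prod rs = g"
proof -
  have G: "is_matgroup G" "G = matgroup_generated (refls G)"
    using assms by (auto simp: is_reflection_group_def)
  let ?H = "{mat_prod rs | rs. set rs \<subseteq> refls G}"
  have inv: "\<exists>ss. set ss \<subseteq> refls G \<and> mat_prod rs ** mat_prod ss = mat 1 \<and> mat_prod ss ** mat_prod rs = mat 1"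
    if "set rs \<subseteq> refls G" for rs
    using that
  proof (induction rs)
    case Nil
    then show ?case by (intro exI[of _ "[]"]) (simp add: mat_prod_Nil)
  next
    case (Cons r rs)
    then obtain ss where ss: "set ss \<subseteq> refls G" "mat_prod rs ** mat_prod ss = mat 1" "mat_prod ss ** mat_prod rs = mat 1"
      by auto
    obtain h where h: "h \<in> G" "r ** h = mat 1" "h ** r = mat 1"
      using Cons.prems G(1) by (auto simp: refls_def is_matgroup_def)
    have "h \<in> refls G" using h Cons.prems reflection_inverse by (auto simp: refls_def)
    moreover have "mat_prod (r # rs) ** mat_prod (ss @ [h]) = mat 1"
    proof -
      have "mat_prod (r # rs) ** mat_prod (ss @ [h]) = r ** (mat_prod rs ** mat_prod ss) ** h"
        by (simp add: mat_prod_append mat_prod_Cons mat_prod_Nil matrix_mul_assoc)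
      then show ?thesis using ss h by simp
    qed
    ultimately show ?case using ss(1)
      by (intro exI[of _ "ss @ [h]"]) (simp add: matrix_left_right_inverse)
  qed
  have "is_matgroup ?H"
    unfolding is_matgroup_def
  proof (intro conjI ballI)
    show "mat 1 \<in> ?H" using mat_prod_Nil by (metis (mono_tags, lifting) empty_set empty_subsetI mem_Collect_eq)
  next
    fix g assume "g \<in> ?H"
    then obtain rs where rs: "g = mat_prod rs" "set rs \<subseteq> refls G" by auto
    then obtain ss where "set ss \<subseteq> refls G" "g ** mat_prod ss = mat 1" "mat_prod ss ** g = mat 1"
      using inv by blast
    then show "\<exists>h\<in>?H. g ** h = mat 1 \<and> h ** g = mat 1" by blast
    then show "is_GL g" unfolding is_GL_def by blast
  next
    fix g h assume "g \<in> ?H" "h \<in> ?H"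
    then obtain rs ss where "g = mat_prod rs" "set rs \<subseteq> refls G" "h = mat_prod ss" "set ss \<subseteq> refls G" by auto
    then show "g ** h \<in> ?H" by (intro CollectI exI[of _ "rs @ ss"]) (auto simp: mat_prod_append)
  qed
  moreover have "refls G \<subseteq> ?H"
  proof
    fix r assume "r \<in> refls G"
    then show "r \<in> ?H" by (intro CollectI exI[of _ "[r]"]) (simp add: mat_prod_Cons mat_prod_Nil)
  qed
  ultimately have "matgroup_generated (refls G) \<subseteq> ?H" unfolding matgroup_generated_def by blast
  then show ?thesis using assms(2) G(2) by auto
qed

lemma reflection_word:
  assumes "is_reflection_group G" "g \<in> G"
  obtains rs where "length rs = refl_length G g" "set rs \<subseteq> refls G" "mat_prod rs = g"
proof -
  obtain rs where "set rs \<subseteq> refls G" "mat_prod rs = g" using reflection_word_exists[OF assms] by blast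
  then have "\<exists>rs'. length rs' = length rs \<and> set rs' \<subseteq> refls G \<and> mat_prod rs' = g" by blast
  then have "\<exists>rs. length rs = refl_length G g \<and> set rs \<subseteq> refls G \<and> mat_prod rs = g"
    unfolding refl_length_def by (rule LeastI)
  then show ?thesis using that by blast
qed

text \<open>Independence of a set does not see repetitions in a family, so injectivity is extracted
  from the same vanishing of coefficients.\<close>

lemma independent_family:
  fixes u :: "'i \<Rightarrow> complex^'n::finite"
  assumes fin: "finite K" and zero: "\<And>t j. (\<Sum>j\<in>K. t j *s u j) = 0 \<Longrightarrow> j \<in> K \<Longrightarrow> t j = 0"
  shows "inj_on u K" "vec.independent (u ` K)"
proof -
  show inj: "inj_on u K"
  proof (rule inj_onI, rule ccontr)
    fix i j assume ij: "i \<in> K" "j \<in> K" "u i = u j" "i \<noteq> j"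
    let ?t = "\<lambda>l. (if l = i then 1 else 0) - (if l = j then 1 else (0::complex))"
    have "(\<Sum>l\<in>K. ?t l *s u l) = (\<Sum>l\<in>K. (if l = i then u i else 0) - (if l = j then u j else 0))"
      by (rule sum.cong) (auto simp: vec.scale_left_diff_distrib)
    also have "\<dots> = 0" using fin ij by (simp add: sum_subtractf)
    finally show False using zero[of ?t i] ij by auto
  qed
  show "vec.independent (u ` K)"
  proof (rule vec.independent_if_scalars_zero)
    fix f x assume s: "(\<Sum>x\<in>u ` K. f x *s x) = 0" and "x \<in> u ` K"
    then obtain j where j: "x = u j" "j \<in> K" by auto
    have "(\<Sum>j\<in>K. f (u j) *s u j) = 0" using s inj by (simp add: sum.reindex)
    then show "f x = 0" using zero[of "\<lambda>j. f (u j)" j] j by simp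
  qed (use fin in simp)
qed

lemma extend_to_invertible_columns:
  fixes u :: "'n::finite \<Rightarrow> complex^'n"
  assumes "inj_on u K" "vec.independent (u ` K)"
  obtains B B' where "B ** B' = mat 1" "B' ** B = mat 1" "\<And>j. j \<in> K \<Longrightarrow> column j B = u j"
proof -
  obtain A A' where A: "A ** A' = mat 1" "A' ** A = mat 1" "\<And>j. j \<in> K \<Longrightarrow> row j A = u j"
    using extend_to_invertible[OF assms] by metis
  have "transpose A ** transpose A' = mat 1" "transpose A' ** transpose A = mat 1"
    using A(1,2) by (metis matrix_transpose_mul transpose_mat)+
  then show ?thesis using that[of "transpose A" "transpose A'"] A(3) by (simp add: column_transpose)
qed

lemma matrix_column_axis: "column i P = P *v axis i 1"
  by (simp add: vec_eq_iff column_def matrix_vector_mult_def axis_def if_distrib[of "\<lambda>x. _ * x"] cong: if_cong)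

lemma inverse_coordinates:
  fixes C P :: "'n::finite cmat"
  assumes "C ** P = mat 1"
  shows "(C *v (\<Sum>i\<in>K. t i *s column i P)) $ j = (if j \<in> K then t j else 0)"
proof -
  have "C *v (\<Sum>i\<in>K. t i *s column i P) = (\<Sum>i\<in>K. t i *s axis i 1)"
    using assms by (simp add: vec.sum vec.scale matrix_column_axis matrix_vector_mul_assoc)
  then show ?thesis by (simp add: axis_def if_distrib[of "\<lambda>x. _ * x"] cong: if_cong)
qed

text \<open>Carter's lemma: the rows for the reflections are independent because the columns of \<open>P\<close>
  outside a maximal independent subset already fill up the fixed space of \<open>g\<close>.\<close>

lemma reflection_frame:
  fixes g :: "'n::finite cmat"
  assumes refl: "\<And>r. r \<in> set rs \<Longrightarrow> is_reflection r" and g: "mat_prod rs = g"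
    and len: "length rs = codim_fix g"
  obtains ks :: "'n list" and s and C P B B' :: "'n cmat" where "distinct ks" "map s ks = rs" "C ** P = mat 1" "P ** C = mat 1"
    "\<And>j. j \<in> set ks \<Longrightarrow> \<exists>\<alpha>. \<alpha> \<noteq> 0 \<and> (\<forall>v. v - s j *v v = cdot (row j C) v *s \<alpha>)"
    "\<And>i. i \<notin> set ks \<Longrightarrow> g *v column i P = column i P"
    "B ** B' = mat 1" "B' ** B = mat 1"
    "\<And>j. j \<in> set ks \<Longrightarrow> column j B = column j P - g *v column j P"
proof -
  have "\<forall>r\<in>set rs. \<exists>c \<alpha>. \<alpha> \<noteq> 0 \<and> (\<forall>v. v - r *v v = cdot c v *s \<alpha>)"
    using reflection_root[OF refl] by metis
  then obtain cf \<alpha>f where root: "\<And>r. r \<in> set rs \<Longrightarrow> \<alpha>f r \<noteq> 0"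
    "\<And>r v. r \<in> set rs \<Longrightarrow> v - r *v v = cdot (cf r) v *s \<alpha>f r" by metis
  have fix_prod: "mat_prod rs' *v v = v" if "\<forall>r\<in>set rs'. cdot (cf r) v = 0" "set rs' \<subseteq> set rs" for rs' v
    using that
  proof (induction rs')
    case (Cons r rs')
    then have "v - r *v v = 0" using root(2)[of r v] by simp
    then show ?case using Cons by (simp add: mat_prod_Cons flip: matrix_vector_mul_assoc)
  qed (simp add: mat_prod_Nil)
  let ?S = "cf ` set rs"
  obtain Bs where Bs: "Bs \<subseteq> ?S" "vec.independent Bs" "?S \<subseteq> vec.span Bs"
    using vec.maximal_independent_subset by metis
  have finBs: "finite Bs" using Bs(1) finite_subset by blast
  have "card Bs \<le> vec.dim (UNIV :: (complex^'n) set)"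
    using Bs(2) by (intro vec.independent_card_le_dim) auto
  then have "card Bs \<le> CARD('n)" by (simp only: vec_dim_card)
  \<comment> \<open>The independent functionals receive distinct indices of the coordinate type, to
    become rows of a square matrix.\<close>
  then obtain \<nu> :: "_ \<Rightarrow> 'n" where \<nu>: "inj_on \<nu> Bs"
    using card_le_inj[OF finBs, of "UNIV :: 'n set"] by auto
  define K where "K = \<nu> ` Bs"
  have cardK: "card K = card Bs" using \<nu> by (simp add: K_def card_image)
  have inv\<nu>: "inv_into Bs \<nu> ` K = Bs" using \<nu> by (simp add: K_def)
  have injinv: "inj_on (inv_into Bs \<nu>) K" unfolding K_def by (rule inj_on_inv_into) simp
  have indinv: "vec.independent (inv_into Bs \<nu> ` K)" using Bs(2) inv\<nu> by simp
  obtain C P where CP: "C ** P = mat 1" "P ** C = mat 1"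
    and row: "\<And>j. j \<in> K \<Longrightarrow> row j C = inv_into Bs \<nu> j"
    using extend_to_invertible[OF injinv indinv] by metis
  have rowBs: "row (\<nu> c) C = c" if "c \<in> Bs" for c
    using that \<nu> row[of "\<nu> c"] by (simp add: K_def)
  have fixed: "g *v v = v" if "\<And>j. j \<in> K \<Longrightarrow> (C *v v) $ j = 0" for v
  proof -
    have "Bs \<subseteq> {c. cdot c v = 0}"
    proof
      fix c assume c: "c \<in> Bs"
      then have "cdot (row (\<nu> c) C) v = 0" using that[of "\<nu> c"] by (simp add: cdot_row K_def)
      then show "c \<in> {c. cdot c v = 0}" by (simp add: rowBs c)
    qed
    then have "vec.span Bs \<subseteq> {c. cdot c v = 0}" by (intro vec.span_minimal subspace_cdot)
    then have "\<forall>r\<in>set rs. cdot (cf r) v = 0" using Bs(3) by blast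
    then show ?thesis using fix_prod[of rs v] g by simp
  qed
  have coord: "(C *v column i P) $ j = (if j = i then 1 else 0)" for i j
    using inverse_coordinates[OF CP(1), of "\<lambda>_. 1" "{i}" j] by simp
  have colfix: "g *v column i P = column i P" if "i \<notin> K" for i
    using that by (intro fixed) (auto simp: coord)
  have zero: "t j = 0" if "(\<Sum>j\<in>A. t j *s column j P) = 0" "j \<in> A" for t j A
    using inverse_coordinates[OF CP(1), of t A j] that by simp
  let ?Q = "(\<lambda>i. column i P) ` (UNIV - K)"
  have indQ: "inj_on (\<lambda>i. column i P) (UNIV - K)" "vec.independent ?Q"
    by (rule independent_family, simp, rule zero, assumption+)+
  have cardQ: "card ?Q = CARD('n) - card Bs"
    using indQ(1) by (simp add: card_image card_Diff_subset cardK)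
  have Qfix: "?Q \<subseteq> fixed_space g" using colfix by (auto simp: fixed_space_def)
  have "card ?Q \<le> vec.dim (fixed_space g)"
    using Qfix indQ(2) by (rule vec.independent_card_le_dim)
  moreover have dimle: "vec.dim (fixed_space g) \<le> CARD('n)"
    using vec.dim_subset[OF subset_UNIV, of "fixed_space g"] by (simp only: vec_dim_card)
  moreover have cle: "card Bs \<le> card ?S" "card ?S \<le> card (set rs)" "card (set rs) \<le> length rs"
    using Bs(1) by (auto intro: card_mono card_image_le card_length)
  \<comment> \<open>The columns fixed by g give codim V^g \<le> \<open>card Bs\<close>, while
    \<open>card Bs\<close> is at most the length of the word, which is codim V^g. All inequalities
    collapse: the letters are distinct, and so are their functionals, which are independent.\<close>
  ultimately have eqs: "card Bs = length rs" "card ?S = card (set rs)" "card (set rs) = length rs"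
    and dimfix: "vec.dim (fixed_space g) = card ?Q"
    using len \<open>card Bs \<le> CARD('n)\<close> unfolding codim_fix_def cardQ by linarith+
  have "Bs = ?S" using Bs(1) eqs by (intro card_subset_eq) auto
  have "distinct rs" using eqs(3) by (rule card_distinct)
  have "inj_on cf (set rs)" using eqs(2) by (intro eq_card_imp_inj_on) auto
  then have inj\<nu>cf: "inj_on (\<nu> \<circ> cf) (set rs)" using \<nu> \<open>Bs = ?S\<close> by (simp add: comp_inj_on)
  define ks where "ks = map (\<nu> \<circ> cf) rs"
  define s where "s = inv_into (set rs) (\<nu> \<circ> cf)"
  have setks: "set ks = K" by (simp add: ks_def K_def \<open>Bs = ?S\<close> image_comp)
  have "distinct ks" using \<open>distinct rs\<close> inj\<nu>cf by (simp add: ks_def distinct_map)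
  moreover have "map s ks = rs"
    unfolding ks_def s_def map_map by (rule map_idI) (simp add: inv_into_f_f[OF inj\<nu>cf, simplified])
  moreover note CP
  moreover have "\<exists>\<alpha>. \<alpha> \<noteq> 0 \<and> (\<forall>v. v - s j *v v = cdot (row j C) v *s \<alpha>)" if jks: "j \<in> set ks" for j
  proof -
    obtain r where r: "r \<in> set rs" "j = \<nu> (cf r)" using jks by (auto simp: ks_def)
    then have "s j = r" using inv_into_f_f[OF inj\<nu>cf r(1)] by (simp add: s_def)
    moreover have "row j C = cf r" using rowBs[of "cf r"] r \<open>Bs = ?S\<close> by simp
    ultimately show ?thesis using root r(1) by (intro exI[of _ "\<alpha>f r"]) auto
  qed
  moreover have "g *v column i P = column i P" if "i \<notin> set ks" for i
    using that colfix setks by simp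
  moreover
  have "vec.span ?Q = fixed_space g"
  proof (rule vec.subspace_dim_equal[OF vec.subspace_span subspace_fixed_space])
    show "vec.span ?Q \<subseteq> fixed_space g" using Qfix by (intro vec.span_minimal subspace_fixed_space)
    show "vec.dim (vec.span ?Q) \<ge> vec.dim (fixed_space g)"
      using indQ(2) by (simp add: dimfix vec.dim_eq_card_independent)
  qed
  have kerC: "(C *v v) $ j = 0" if "g *v v = v" "j \<in> K" for v j
  proof -
    have "vec.subspace {v. (C *v v) $ j = 0}" by (simp add: vec.subspace_def vec.add vec.scale)
    moreover have "?Q \<subseteq> {v. (C *v v) $ j = 0}" using that(2) by (auto simp: coord)
    ultimately have "vec.span ?Q \<subseteq> {v. (C *v v) $ j = 0}" by (intro vec.span_minimal)
    moreover have "v \<in> vec.span ?Q" using that(1) \<open>vec.span ?Q = fixed_space g\<close> by (simp add: fixed_space_def)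
    ultimately show ?thesis by blast
  qed
  define u where "u j = column j P - g *v column j P" for j
  \<comment> \<open>A relation among the u j says that the same combination of columns of P is fixed
    by g; by \<open>kerC\<close> its coordinates in K vanish, and these are the
    coefficients.\<close>
  have zu: "t j = 0" if "(\<Sum>j\<in>K. t j *s u j) = 0" "j \<in> K" for t j
  proof -
    let ?w = "\<Sum>j\<in>K. t j *s column j P"
    have "(\<Sum>j\<in>K. t j *s u j) = ?w - g *v ?w"
      by (simp add: u_def vec.scale_right_diff_distrib sum_subtractf vec.sum vec.scale)
    then have "g *v ?w = ?w" using that by simp
    then have "(C *v ?w) $ j = 0" using that(2) by (rule kerC)
    then show ?thesis using inverse_coordinates[OF CP(1), of t K j] that(2) by simp
  qed
  have "inj_on u K" "vec.independent (u ` K)"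
    by (rule independent_family, simp, rule zu, assumption+)+
  then obtain B B' where "B ** B' = mat 1" "B' ** B = mat 1" "\<And>j. j \<in> K \<Longrightarrow> column j B = u j"
    using extend_to_invertible_columns[of u K] by metis
  ultimately show ?thesis using that[of ks s C P B B'] setks by (simp add: u_def)
qed

text \<open>The root is made a column of some invertible matrix, at an arbitrary index, so that
  division by it is available. Dividing v - s v = c(v) \<alpha> by \<alpha> shows that the divided
  difference restricts to the functional c on V.\<close>

lemma twisted_der_of_root:
  fixes s :: "'n::finite cmat"
  assumes "\<alpha> \<noteq> 0" "\<And>v. v - s *v v = cdot c v *s \<alpha>"
  obtains D where "twisted_der s D" "\<And>i. D (pvar i) = pconst (c $ i)"
proof -
  obtain j :: 'n where True by simp
  have ind: "vec.independent ((\<lambda>_::'n. \<alpha>) ` {j})" using assms(1) by (simp add: vec.dependent_single)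
  obtain B B' where B: "B ** B' = mat 1" "B' ** B = mat 1" "column j B = \<alpha>"
    using extend_to_invertible_columns[OF _ ind] by (auto intro: that)
  have "axis i 1 - s *v axis i 1 = c $ i *s column j B" for i
    using assms(2)[of "axis i 1"] by (simp add: cdot_axis B(3))
  from twisted_der_reflection[OF B(1,2) this] show ?thesis using that by blast
qed

section \<open>The Hochschild complex of the skew group algebra\<close>

lemma bar_cochains_act: "bar_cochains (act g) pconst"
  by unfold_locales
    (simp_all add: plin_add[OF plin_act] act_mult act_1 act_pconst)

interpretation hoch: bar_cochains "act g" pconst for g :: "'n::finite cmat"
  by (rule bar_cochains_act)

abbreviation multilin :: "nat \<Rightarrow> ('n spoly list \<Rightarrow> 'n spoly) \<Rightarrow> bool" where
  "multilin \<equiv> bar_cochains.mlin pconst"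

abbreviation hrm :: "'n::finite cmat \<Rightarrow> 'n spoly \<Rightarrow> ('n spoly list \<Rightarrow> 'n spoly) \<Rightarrow> 'n spoly list \<Rightarrow> 'n spoly" where
  "hrm g \<equiv> bar_cochains.rm (act g)"

abbreviation hdelta :: "'n::finite cmat \<Rightarrow> ('n spoly list \<Rightarrow> 'n spoly) \<Rightarrow> 'n spoly list \<Rightarrow> 'n spoly" where
  "hdelta g \<equiv> bar_cochains.delta (act g)"

lemma lin_iff_plin:
  fixes \<phi> :: "'n::finite spoly \<Rightarrow> 'n spoly"
  shows "bar_cochains.lin pconst \<phi> \<longleftrightarrow> plin \<phi>"
  by (simp add: hoch.lin_def plin_def)

lemma (in bar_cochains) rm_cong:
  "(\<And>xs. length xs = length zs \<Longrightarrow> p xs = q xs) \<Longrightarrow> rm b p zs = rm b q zs"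
proof (induction zs arbitrary: b p q)
  case (Cons a zs)
  then have "rm a (\<lambda>xs. p (b # xs)) zs = rm a (\<lambda>xs. q (b # xs)) zs"
    by (intro Cons.IH) simp
  then show ?case using Cons.prems by simp
qed simp

text \<open>The bridge from the recursive action to the sum over adjacent products in
  \<open>hoch_d\<close>.\<close>

lemma (in bar_cochains) rm_explicit:
  "rm b q zs = (\<Sum>i<length zs. (-1) ^ i *
       q (take i (b # zs) @ [(b # zs) ! i * (b # zs) ! Suc i] @ drop (i + 2) (b # zs)))
     + (-1) ^ length zs * (q (take (length zs) (b # zs)) * \<sigma> ((b # zs) ! length zs))"
proof (induction zs arbitrary: b q)
  case (Cons a zs)
  show ?case
    by (simp add: Cons.IH sum.lessThan_Suc_shift sum_negf del: sum.lessThan_Suc)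
qed simp

lemma hoch_d_eq:
  fixes g :: "'n::finite cmat"
  assumes "length zs = Suc n"
  shows "hoch_d G n f zs g = hdelta g (\<lambda>xs. f xs g) zs"
proof -
  obtain a zs' where zs: "zs = a # zs'" "length zs' = n" using assms by (cases zs) auto
  show ?thesis
    unfolding hoch_d_def zs(1) hoch.delta.simps hoch.rm_explicit[where zs = zs'] skew_lmult_def skew_rmult_def
    using zs(2) by (simp add: sum.atLeast1_atMost_eq sum_negf)
qed

lemma multilinI:
  fixes q :: "'n::finite spoly list \<Rightarrow> 'n spoly"
  assumes "\<And>xs. length xs \<noteq> n \<Longrightarrow> q xs = 0"
    and "\<And>xs i a b c. length xs = n \<Longrightarrow> i < n \<Longrightarrow>
      q (xs[i := pconst c * a + b]) = pconst c * q (xs[i := a]) + q (xs[i := b])"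
  shows "multilin n q"
  using assms
proof (induction n arbitrary: q)
  case (Suc n)
  have "multilin n (\<lambda>xs. q (a # xs))" for a
  proof (rule Suc.IH)
    fix xs :: "'n spoly list" and i b c and d :: complex
    assume "length xs = n" "i < n"
    then show "q (a # xs[i := pconst d * b + c]) = pconst d * q (a # xs[i := b]) + q (a # xs[i := c])"
      using Suc.prems(2)[of "a # xs" "Suc i" d b c] by simp
  qed (simp add: Suc.prems(1))
  moreover have "plin (\<lambda>a. q (a # xs))" for xs
  proof (cases "length xs = n")
    case True
    then show ?thesis using Suc.prems(2)[of "0 # xs" 0] by (simp add: plin_def)
  qed (simp add: Suc.prems(1) plin_def)
  ultimately show ?case using Suc.prems(1) by (simp add: lin_iff_plin)
qed simp

lemma multilin_update:
  fixes q :: "'n::finite spoly list \<Rightarrow> 'n spoly"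
  assumes "multilin n q" "length xs = n" "i < n"
  shows "q (xs[i := pconst c * a + b]) = pconst c * q (xs[i := a]) + q (xs[i := b])"
  using assms
proof (induction n arbitrary: q xs i)
  case (Suc n)
  then obtain x xs' where xs: "xs = x # xs'" "length xs' = n" by (auto simp: length_Suc_conv)
  show ?case
  proof (cases i)
    case 0
    then show ?thesis using Suc.prems(1) xs by (simp add: lin_iff_plin plin_def)
  next
    case (Suc i')
    then show ?thesis using Suc.IH[of "\<lambda>ys. q (x # ys)" xs' i'] Suc.prems xs by simp
  qed
qed simp

section \<open>Cup products of twisted derivations\<close>

type_synonym 'n word = "('n cmat \<times> ('n spoly \<Rightarrow> 'n spoly)) list"

text \<open>The coefficient D1 a1 * s1 (D2 a2) * s1 s2 (D3 a3) * ... of a cup product of 1-cocycles,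
  living in the component of the product of the s. The last clause gives the vanishing on lists of
  wrong length that \<open>mlin\<close> requires.\<close>

fun cup_word :: "'n::finite word \<Rightarrow> 'n spoly list \<Rightarrow> 'n spoly" where
  "cup_word [] [] = 1"
| "cup_word ((s, D) # r) (a # zs) = D a * act s (cup_word r zs)"
| "cup_word _ _ = 0"

definition der_word :: "'n::finite word \<Rightarrow> bool" where
  "der_word r \<longleftrightarrow> (\<forall>(s, D)\<in>set r. twisted_der s D)"

lemma hrm_act: "hrm (s ** g) b (\<lambda>xs. act s (q xs)) zs = act s (hrm g b q zs)"
  by (induction zs arbitrary: b q) (simp_all add: act_mult act_act plin_diff[OF plin_act])

text \<open>The Leibniz rule splits D (b * a) in two; the part with D b cancels against the rest of
  the expansion, which the induction hypothesis evaluates.\<close>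

lemma cup_word_cocycle:
  "der_word r \<Longrightarrow> hrm (mat_prod (map fst r)) b (cup_word r) zs = b * cup_word r zs"
proof (induction r arbitrary: b zs)
  case Nil
  show ?case
  proof (cases zs)
    case (Cons z zs')
    then show ?thesis by (simp add: mat_prod_Nil)
  next
    case Nil
    show ?thesis
      unfolding Nil list.map mat_prod_Nil hoch.rm.simps cup_word.simps by (simp add: act_id)
  qed
next
  case (Cons x r)
  obtain s D where x: "x = (s, D)" by (cases x)
  have D: "twisted_der s D" and r: "der_word r" using Cons.prems x by (auto simp: der_word_def)
  show ?case
  proof (cases zs)
    case Nil
    then show ?thesis by (simp add: x)
  next
    case (Cons a zs')
    have "hrm (mat_prod (map fst (x # r))) a (\<lambda>xs. D b * act s (cup_word r xs)) zs'
        = D b * act s (a * cup_word r zs')"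
      by (simp add: x mat_prod_Cons hoch.rm_scale hrm_act Cons.IH[OF r])
    moreover have "D (b * a) = b * D a + D b * act s a" using D by (simp add: twisted_der_def)
    ultimately show ?thesis using Cons by (simp add: x act_mult algebra_simps)
  qed
qed

lemma multilin_act: "multilin m q \<Longrightarrow> multilin m (\<lambda>xs. p * act s (q xs))"
proof (induction m arbitrary: q)
  case 0
  then show ?case by (simp add: plin_0[OF plin_act])
next
  case (Suc m)
  then show ?case
    by (auto simp: lin_iff_plin plin_0[OF plin_act] intro!: plin_lmult plin_comp[OF plin_act])
qed

lemma multilin_cup_word: "der_word r \<Longrightarrow> multilin (length r) (cup_word r)"
proof (induction r)
  case (Cons x r)
  obtain s D where x: "x = (s, D)" by (cases x)
  have "plin D" "der_word r" using Cons.prems x by (auto simp: der_word_def twisted_der_def)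
  then show ?case using Cons.IH
    by (auto simp: x lin_iff_plin intro!: multilin_act plin_rmult)
qed simp

lemma van_cup_word: "der_word r \<Longrightarrow> bar_cochains.van j (cup_word r)"
proof (induction r arbitrary: j)
  case Nil
  have "cup_word [] (us @ 1 # vs) = 0" for us vs :: "'a spoly list" by (cases us) auto
  then show ?case by (simp add: hoch.van_def)
next
  case (Cons x r)
  obtain s D where x: "x = (s, D)" by (cases x)
  have D: "twisted_der s D" "der_word r" using Cons.prems x by (auto simp: der_word_def)
  show ?case
  proof (cases j)
    case 0
    then show ?thesis using twisted_der_1[OF D(1)] by (simp add: hoch.van_0 x)
  next
    case (Suc j')
    then show ?thesis using Cons.IH[OF D(2), of j']
      by (simp add: hoch.van_Suc x) (simp add: hoch.van_def plin_0[OF plin_act])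
  qed
qed

text \<open>The D j send the y i to 0 or 1, which every s fixes, so the twists disappear and a
  product of Kronecker symbols remains.\<close>

lemma cup_word_dual:
  assumes "\<And>i j. D j (y i) = (if i = j then 1 else 0)"
  shows "cup_word (map (\<lambda>j. (s j, D j)) js) (map y is) = (if is = js then 1 else 0)"
proof (induction js arbitrary: "is")
  case Nil
  then show ?case by (cases "is") auto
next
  case (Cons j js)
  then show ?case by (cases "is") (auto simp: assms act_1 plin_0[OF plin_act])
qed

definition conc :: "'n cmat \<Rightarrow> 'n spoly \<Rightarrow> 'n::finite skew" where
  "conc s a = (\<lambda>g. if g = s then a else 0)"

lemma skew_mult_conc:
  assumes "finite G" "s \<in> G" "t \<in> G"
  shows "skew_mult G (conc s a) (conc t b) = conc (s ** t) (a * act s b)"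
proof
  fix k
  let ?P = "{(g, h). g \<in> G \<and> h \<in> G \<and> g ** h = k}"
  have fin: "finite ?P" by (rule finite_subset[of _ "G \<times> G"]) (use assms(1) in auto)
  have "skew_mult G (conc s a) (conc t b) k = (\<Sum>p\<in>?P. if p = (s, t) then a * act s b else 0)"
    unfolding skew_mult_def conc_def
    by (intro sum.cong refl) (auto simp: plin_0[OF plin_act] split: if_splits)
  also have "\<dots> = conc (s ** t) (a * act s b) k"
    using fin assms by (simp add: conc_def)
  finally show "skew_mult G (conc s a) (conc t b) k = conc (s ** t) (a * act s b) k" .
qed

definition der_cochain :: "'n cmat \<times> ('n spoly \<Rightarrow> 'n spoly) \<Rightarrow> 'n::finite cochain" where
  "der_cochain x xs = conc (fst x) (snd x (hd xs))"

lemma cup_list_word: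
  assumes G: "is_matgroup G" "finite G" and r: "fst ` set r \<subseteq> G" "length xs = length r"
  shows "cup_list G (map (\<lambda>x. (1, der_cochain x)) r) xs = conc (mat_prod (map fst r)) (cup_word r xs)"
  using r
proof (induction r arbitrary: xs)
  case Nil
  then show ?case by (simp add: skew_embed_def conc_def mat_prod_Nil)
next
  case (Cons x r)
  then obtain a xs' where xs: "xs = a # xs'" "length xs' = length r" by (auto simp: length_Suc_conv)
  have "mat_prod (map fst r) \<in> G" using Cons.prems G(1) by (intro mat_prod_in_group) auto
  then show ?case
    using Cons xs G(2)
    by (cases x) (simp add: cup_def der_cochain_def skew_mult_conc mat_prod_Cons)
qed

lemma der_cochain_cocycle:
  assumes "twisted_der s D" "s \<in> G"
  shows "is_cocycle G 1 (der_cochain (s, D))"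
  unfolding is_cocycle_def is_cochain_def
proof (intro conjI allI impI)
  have lD: "plin D" using assms(1) by (simp add: twisted_der_def)
  show "der_cochain (s, D) xs \<in> skew_carrier G" for xs
    using assms(2) by (auto simp: der_cochain_def conc_def skew_carrier_def)
  show "der_cochain (s, D) (xs[i := pconst c * a + b])
      = (\<lambda>g. pconst c * der_cochain (s, D) (xs[i := a]) g + der_cochain (s, D) (xs[i := b]) g)"
    if "length xs = 1" "i < 1" for xs i a b c
    using that plinD[OF lD] by (cases xs) (auto simp: der_cochain_def conc_def)
  fix xs :: "'a spoly list" assume "length xs = 1 + 1"
  then obtain a b where xs: "xs = [a, b]" by (auto simp: length_Suc_conv)
  show "hoch_d G 1 (der_cochain (s, D)) xs = (\<lambda>g. 0)"
  proof
    fix g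
    have "hoch_d G 1 (der_cochain (s, D)) xs g = hdelta g (\<lambda>xs. der_cochain (s, D) xs g) xs"
      by (rule hoch_d_eq) (simp add: xs)
    also have "\<dots> = 0"
      using assms(1) by (simp add: xs der_cochain_def conc_def twisted_der_def algebra_simps)
    finally show "hoch_d G 1 (der_cochain (s, D)) xs g = 0" .
  qed
qed

text \<open>In the component of 1 the right action is untwisted, so commutativity of S makes every
  polynomial a class of degree 0.\<close>

lemma const_cocycle:
  assumes "mat 1 \<in> G"
  shows "is_cocycle G 0 (\<lambda>xs. conc (mat 1) p)"
proof -
  have "hoch_d G 0 (\<lambda>xs. conc (mat 1) p) xs g = 0" if "length xs = 1" for xs g
  proof -
    have "hoch_d G 0 (\<lambda>xs. conc (mat 1) p) xs g = hdelta g (\<lambda>xs. conc (mat 1) p g) xs"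
      using that by (intro hoch_d_eq) simp
    also have "\<dots> = 0"
      using that by (cases xs) (auto simp: conc_def act_id algebra_simps)
    finally show ?thesis .
  qed
  then show ?thesis
    using assms by (auto simp: is_cocycle_def is_cochain_def skew_carrier_def conc_def)
qed

section \<open>The contribution of a single group element\<close>

lemma decomposition_at:
  fixes G :: "'n::finite cmat set"
  assumes G: "is_reflection_group G" and g: "g \<in> G" and len: "refl_length G g = codim_fix g"
    and q: "multilin n q" "\<And>b zs. hrm g b q zs = b * q zs"
  obtains ps :: "('n spoly \<times> 'n word) list" and h where
    "\<And>p r. (p, r) \<in> set ps \<Longrightarrow> length r = n \<and> fst ` set r \<subseteq> G \<and> der_word r \<and> mat_prod (map fst r) = g"
    "multilin (n - 1) h"
    "\<And>zs. q zs = (\<Sum>(p, r)\<leftarrow>ps. p * cup_word r zs) + (if n = 0 then 0 else hdelta g h zs)"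
proof -
  have grp: "is_matgroup G" using G by (simp add: is_reflection_group_def)
  obtain rs where rs: "length rs = refl_length G g" "set rs \<subseteq> refls G" "mat_prod rs = g"
    using reflection_word[OF G g] by blast
  have refl: "\<And>r. r \<in> set rs \<Longrightarrow> is_reflection r" using rs(2) by (auto simp: refls_def)
  have lenrs: "length rs = codim_fix g" using rs(1) len by simp
  obtain ks :: "'n list" and s' and C P B B' :: "'n cmat" where ks: "distinct ks" "map s' ks = rs"
    and CP: "C ** P = mat 1" "P ** C = mat 1"
    and root: "\<And>j. j \<in> set ks \<Longrightarrow> \<exists>\<alpha>. \<alpha> \<noteq> 0 \<and> (\<forall>v. v - s' j *v v = cdot (row j C) v *s \<alpha>)"
    and fixed: "\<And>i. i \<notin> set ks \<Longrightarrow> g *v column i P = column i P"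
    and B: "B ** B' = mat 1" "B' ** B = mat 1"
    and colB: "\<And>j. j \<in> set ks \<Longrightarrow> column j B = column j P - g *v column j P"
    using reflection_frame[OF refl rs(3) lenrs] by blast
  \<comment> \<open>Indices outside the frame carry ordinary derivations in the component of 1; they
    raise the degree of a word without changing its product.\<close>
  define s where "s j = (if j \<in> set ks then s' j else mat 1)" for j
  have sG: "s j \<in> G" for j
  proof (cases "j \<in> set ks")
    case True
    then have "s' j \<in> set rs" using ks(2) by auto
    then show ?thesis using rs(2) True by (auto simp: s_def refls_def)
  qed (use grp in \<open>simp add: s_def is_matgroup_def\<close>)
  have "\<exists>D. twisted_der (s j) D \<and> (\<forall>i. D (pvar i) = pconst (C $ j $ i))" for j
  proof (cases "j \<in> set ks")
    case True
    then obtain \<alpha> where "\<alpha> \<noteq> 0" "\<And>v. v - s j *v v = cdot (row j C) v *s \<alpha>"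
      using root by (auto simp: s_def)
    then obtain D where "twisted_der (s j) D" "\<And>i. D (pvar i) = pconst (row j C $ i)"
      using twisted_der_of_root by metis
    then show ?thesis by (auto simp: row_def)
  next
    case False
    then show ?thesis
      by (intro exI[of _ "dird (\<lambda>i. C $ j $ i)"]) (simp add: s_def twisted_der_dird dird_pvar)
  qed
  then obtain D where D: "\<And>j. twisted_der (s j) (D j)" "\<And>j i. D j (pvar i) = pconst (C $ j $ i)" by metis
  define y where "y i = lform (column i P)" for i
  have dual: "D j (y i) = (if i = j then 1 else 0)" for i j
  proof -
    have "D j (y i) = pconst ((C ** P) $ j $ i)"
      unfolding y_def twisted_der_lform[OF D] by (simp add: matrix_matrix_mult_def column_def)
    then show ?thesis by (simp add: CP mat_def pconst_0 pconst_1)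
  qed
  obtain ord :: "'n \<Rightarrow> nat" where "inj ord"
    using finite_imp_inj_to_nat_seg[of "UNIV :: 'n set"] by auto
  \<comment> \<open>The monomials in the y i are the images of the standard monomials under
    \<open>act P\<close>, so \<open>act C\<close> followed by linear extension reads off coordinates
    in them.\<close>
  have coord_lin: "bar_cochains.lin pconst (\<lambda>c. psum t (act C c))" for t
    by (simp add: lin_iff_plin plin_comp[OF plin_psum plin_act])
  have coord_basis: "psum t (act C (act P (pmon \<mu>))) = t \<mu>" for t \<mu>
    by (simp add: act_act CP act_id psum_mono)
  have coord_comb: "psum (\<lambda>\<mu>. r * t \<mu> + t' \<mu>) (act C c) = r * psum t (act C c) + psum t' (act C c)" for r t t' c
    by (simp add: psum_def algebra_simps sum.distrib sum_distrib_left)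
  have coord_eq: "\<phi> c = \<psi> c" if lin: "bar_cochains.lin pconst \<phi>" "bar_cochains.lin pconst \<psi>"
    and eq: "\<And>\<mu>. \<phi> (act P (pmon \<mu>)) = \<psi> (act P (pmon \<mu>))" for \<phi> \<psi> c
  proof -
    have "plin (\<lambda>c. \<phi> (act P c))" "plin (\<lambda>c. \<psi> (act P c))"
      using lin unfolding lin_iff_plin by (simp_all only: plin_comp[OF _ plin_act])
    then have "\<phi> (act P (act C c)) = \<psi> (act P (act C c))"
      using plin_eqI[of "\<lambda>c. \<phi> (act P c)" "\<lambda>c. \<psi> (act P c)" "act C c"] eq by simp
    then show ?thesis by (simp add: act_act CP act_id)
  qed
  have coord_0: "act P (pmon 0) = 1" by (simp add: act_1)
  have coord_add: "act P (pmon (\<mu> + Poly_Mapping.single i 1)) = y i * act P (pmon \<mu>)" for \<mu> i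
    by (simp only: mono_add_single act_mult act_pvar lin_img_lform y_def)
  interpret bar_coords "act g" pconst ord y "\<lambda>\<mu>. act P (pmon \<mu>)" "\<lambda>t c. psum t (act C c)"
    by (intro bar_coords.intro bar_coords_axioms.intro ordered_index.intro bar_cochains_act \<open>inj ord\<close>
        coord_lin coord_basis coord_comb coord_0 coord_add) (rule coord_eq)
  define rest where "rest I = (SOME xs. distinct xs \<and> set xs = I - set ks)" for I
  have rest: "distinct (rest I)" "set (rest I) = I - set ks" for I
  proof -
    have "\<exists>xs. distinct xs \<and> set xs = I - set ks" using finite_distinct_list[of "I - set ks"] by auto
    from someI_ex[OF this] show "distinct (rest I)" "set (rest I) = I - set ks" by (simp_all add: rest_def)
  qed
  \<comment> \<open>The reflections must keep the order in which they multiply to g, so this list is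
    in general not sorted by \<open>ord\<close>.\<close>
  define js where "js I = ks @ rest I" for I
  have js: "distinct (js I) \<and> set (js I) = I" if "set ks \<subseteq> I" for I
    using that ks(1) rest[of I] by (auto simp: js_def)
  define word where "word I = map (\<lambda>j. (s j, D j)) (js I)" for I
  have der: "der_word (word I)" for I using D(1) by (auto simp: word_def der_word_def)
  have prod: "mat_prod (map fst (word I)) = g" for I
  proof -
    have "map s ks = rs" using ks(2) by (auto simp: s_def)
    moreover have "mat_prod (map s xs) = mat 1" if "set xs \<inter> set ks = {}" for xs
      using that by (induction xs) (auto simp: mat_prod_Nil mat_prod_Cons s_def)
    then have "mat_prod (map s (rest I)) = mat 1" using rest(2)[of I] by blast
    ultimately show ?thesis
      using rs(3) by (simp add: word_def js_def mat_prod_append comp_def)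
  qed
  have lenword: "length (word I) = card I" if "set ks \<subseteq> I" for I
    using js[OF that] distinct_card[of "js I"] by (simp add: word_def)
  have u: "y i - act g (y i) = (if i \<in> set ks then lform (column i B) else 0)" for i
    using fixed colB by (simp add: y_def act_lform lform_0 flip: lform_diff)
  have "\<exists>p h. multilin (n - 1) h \<and> (\<forall>zs. q zs =
      (\<Sum>I | set ks \<subseteq> I \<and> card I = n. p I * cup_word (word I) zs) + (if n = 0 then 0 else hdelta g h zs))"
  proof (rule cocycle_decomposition[where T = "lindiv B B'" and js = js])
    show "lindiv B B' j (a + b) = lindiv B B' j a + lindiv B B' j b" for j a b
      by (rule plin_add[OF plin_lindiv])
    show "lindiv B B' j ((y j - act g (y j)) * a) = a" if "j \<in> set ks" for j a
      using that by (simp add: u lindiv_self B)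
    show "lindiv B B' j ((y i - act g (y i)) * a) = (y i - act g (y i)) * lindiv B B' j a"
      if "j \<in> set ks" "i \<noteq> j" for i j a
      using that by (simp add: u lindiv_other B plin_0[OF plin_lindiv])
    show "hoch.cocycle g (cup_word (word I)) \<and> hoch.NC (card I) (cup_word (word I))" if "set ks \<subseteq> I" for I
      using cup_word_cocycle[OF der, of I] multilin_cup_word[OF der, of I] van_cup_word[OF der, of _ I]
      by (simp add: hoch.cocycle_def prod hoch.NC_def lenword[OF that])
    show "cup_word (word I) (map y is) = (if is = js I then 1 else 0)" for I "is"
      unfolding word_def by (rule cup_word_dual) (rule dual)
  qed (use js q in \<open>auto simp: hoch.cocycle_def\<close>)
  then obtain p h where ph: "multilin (n - 1) h" "\<And>zs. q zs =
      (\<Sum>I | set ks \<subseteq> I \<and> card I = n. p I * cup_word (word I) zs) + (if n = 0 then 0 else hdelta g h zs)" by blast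
  obtain Is where Is: "distinct Is" "set Is = {I. set ks \<subseteq> I \<and> card I = n}"
    using finite_distinct_list[of "{I. set ks \<subseteq> I \<and> card I = n}"] by auto
  show ?thesis
  proof (rule that[of "map (\<lambda>I. (p I, word I)) Is" h])
    show "length r = n \<and> fst ` set r \<subseteq> G \<and> der_word r \<and> mat_prod (map fst r) = g"
      if "(p', r) \<in> set (map (\<lambda>I. (p I, word I)) Is)" for p' r
      using that Is(2) lenword der prod sG by (auto simp: word_def)
    show "q zs = (\<Sum>(p, r)\<leftarrow>map (\<lambda>I. (p I, word I)) Is. p * cup_word r zs) + (if n = 0 then 0 else hdelta g h zs)" for zs
      by (simp add: ph(2) comp_def sum_list_distinct_conv_sum_set Is)
  qed (rule ph(1))
qed

section \<open>Assembling the contributions of all group elements\<close>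

theorem theorem10p3:
  fixes G :: "(complex^'n::finite^'n) set"
  assumes "is_reflection_group G"
    and "\<forall>g\<in>G. refl_length G g = codim_fix g"
  shows "HH_generated_deg01 G"
  unfolding HH_generated_deg01_def
proof (intro allI impI)
  fix n and f :: "'n cochain" assume f: "is_cocycle G n f"
  have finG: "finite G" and grp: "is_matgroup G" using assms(1) by (auto simp: is_reflection_group_def)
  have oneG: "mat 1 \<in> G" using grp by (simp add: is_matgroup_def)
  \<comment> \<open>A cochain is unconstrained on lists of other lengths, so each component is cut
    off there to become multilinear in the sense of \<open>mlin\<close>.\<close>
  define q where "q g = (\<lambda>zs. if length zs = n then f zs g else 0)" for g
  have fc: "f xs \<in> skew_carrier G" if "length xs = n" for xs
    using f that by (simp add: is_cocycle_def is_cochain_def)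
  have qm: "multilin n (q g)" for g
  proof (rule multilinI)
    fix xs :: "'n spoly list" and i a b c assume "length xs = n" "i < n"
    then have "f (xs[i := pconst c * a + b]) = (\<lambda>g. pconst c * f (xs[i := a]) g + f (xs[i := b]) g)"
      using f by (simp add: is_cocycle_def is_cochain_def)
    then show "q g (xs[i := pconst c * a + b]) = pconst c * q g (xs[i := a]) + q g (xs[i := b])"
      using \<open>length xs = n\<close> by (simp add: q_def)
  qed (simp add: q_def)
  have qc: "hrm g b (q g) zs = b * q g zs" for g b zs
  proof (cases "length zs = n")
    case True
    have "hoch_d G n f (b # zs) g = 0" using f True by (simp add: is_cocycle_def)
    then have "hdelta g (\<lambda>xs. f xs g) (b # zs) = 0" using True by (simp add: hoch_d_eq)
    moreover have "hrm g b (q g) zs = hrm g b (\<lambda>xs. f xs g) zs"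
      using True by (intro hoch.rm_cong) (simp add: q_def)
    ultimately show ?thesis using True by (simp add: q_def)
  next
    case False
    then show ?thesis using hoch.mlin_length[OF hoch.mlin_rm[OF qm]] by (simp add: q_def)
  qed
  define good where "good g ps h \<longleftrightarrow>
      (\<forall>p r. (p, r) \<in> set ps \<longrightarrow> length r = n \<and> fst ` set r \<subseteq> G \<and> der_word r \<and> mat_prod (map fst r) = g)
      \<and> multilin (n - 1) h
      \<and> (\<forall>zs. q g zs = (\<Sum>(p, r)\<leftarrow>ps. p * cup_word r zs) + (if n = 0 then 0 else hdelta g h zs))"
    for g :: "'n cmat" and ps :: "('n spoly \<times> 'n word) list" and h
  have "\<exists>x. good g (fst x) (snd x)" if "g \<in> G" for g
  proof -
    have "refl_length G g = codim_fix g" using assms(2) that by blast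
    from decomposition_at[OF assms(1) that this qm qc] obtain ps h where "good g ps h"
      unfolding good_def by metis
    then show ?thesis by (intro exI[of _ "(ps, h)"]) simp
  qed
  then obtain X where X: "\<And>g. g \<in> G \<Longrightarrow> good g (fst (X g)) (snd (X g))" by metis
  define ps where "ps g = fst (X g)" for g
  define h where "h g = snd (X g)" for g
  have gd: "good g (ps g) (h g)" if "g \<in> G" for g unfolding ps_def h_def using that by (rule X)
  have ps: "length r = n \<and> fst ` set r \<subseteq> G \<and> der_word r \<and> mat_prod (map fst r) = g"
    if "g \<in> G" "(p, r) \<in> set (ps g)" for g p r
    using gd[OF that(1)] that(2) unfolding good_def by blast
  have hm: "multilin (n - 1) (h g)" if "g \<in> G" for g
    using gd[OF that] unfolding good_def by blast
  have qeq: "q g zs = (\<Sum>(p, r)\<leftarrow>ps g. p * cup_word r zs) + (if n = 0 then 0 else hdelta g (h g) zs)"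
    if "g \<in> G" for g zs
    using gd[OF that] unfolding good_def by blast
  obtain Gl where Gl: "distinct Gl" "set Gl = G" using finite_distinct_list[OF finG] by blast
  \<comment> \<open>The coefficient becomes a factor of degree 0 in the component of 1, so neither
    the degree n nor the component g of the word changes.\<close>
  define tm :: "'n spoly \<times> 'n word \<Rightarrow> (nat \<times> 'n cochain) list" where
    "tm x = (0, \<lambda>xs. conc (mat 1) (fst x)) # map (\<lambda>x. (1, der_cochain x)) (snd x)" for x
  have tmval: "cup_list G (tm (p, r)) xs k = (if k = g then p * cup_word r xs else 0)"
    if "g \<in> G" "(p, r) \<in> set (ps g)" "length xs = n" for g p r xs k
  proof -
    have r: "length r = n" "fst ` set r \<subseteq> G" "mat_prod (map fst r) = g" using ps[OF that(1,2)] by auto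
    have "cup_list G (map (\<lambda>x. (1, der_cochain x)) r) xs = conc g (cup_word r xs)"
      using cup_list_word[OF grp finG r(2), of xs] r that(3) by simp
    then show ?thesis
      using skew_mult_conc[OF finG oneG that(1)] by (simp add: tm_def cup_def act_id) (simp add: conc_def)
  qed
  define tms where "tms = concat (map (\<lambda>g. map tm (ps g)) Gl)"
  have val: "(\<Sum>t\<leftarrow>tms. cup_list G t xs k) = (if k \<in> G then \<Sum>(p, r)\<leftarrow>ps k. p * cup_word r xs else 0)"
    if "length xs = n" for xs k
  proof -
    have inner: "(\<Sum>x\<leftarrow>ps g. cup_list G (tm x) xs k) = (if g = k then \<Sum>(p, r)\<leftarrow>ps k. p * cup_word r xs else 0)"
      if g: "g \<in> G" for g
    proof -
      have "(\<Sum>x\<leftarrow>ps g. cup_list G (tm x) xs k) = (\<Sum>x\<leftarrow>ps g. if g = k then fst x * cup_word (snd x) xs else 0)"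
        by (intro arg_cong[of _ _ sum_list] map_cong refl) (use tmval[OF g] \<open>length xs = n\<close> in auto)
      then show ?thesis by (auto simp: split_def)
    qed
    have "(\<Sum>t\<leftarrow>tms. cup_list G t xs k) = (\<Sum>g\<leftarrow>Gl. \<Sum>x\<leftarrow>ps g. cup_list G (tm x) xs k)"
      unfolding tms_def by (induction Gl) (simp_all add: comp_def)
    also have "\<dots> = (\<Sum>g\<in>G. if g = k then \<Sum>(p, r)\<leftarrow>ps k. p * cup_word r xs else 0)"
      using Gl by (simp add: sum_list_distinct_conv_sum_set inner)
    finally show ?thesis using finG by simp
  qed
  have deg: "\<forall>t\<in>set tms. (\<forall>(k, z)\<in>set t. k \<le> 1 \<and> is_cocycle G k z) \<and> sum_list (map fst t) = n"
  proof
    fix t assume "t \<in> set tms"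
    then obtain g p r where t: "g \<in> G" "(p, r) \<in> set (ps g)" "t = tm (p, r)" using Gl by (auto simp: tms_def)
    have r: "length r = n" "fst ` set r \<subseteq> G" "der_word r" using ps[OF t(1,2)] by auto
    have "is_cocycle G 1 (der_cochain x)" if "x \<in> set r" for x
      using that r(2,3) der_cochain_cocycle[of "fst x" "snd x" G] by (force simp: der_word_def)
    moreover have "sum_list (map fst (tm (p, r))) = n"
      by (simp add: tm_def comp_def r(1) sum_list_triv)
    ultimately show "(\<forall>(k, z)\<in>set t. k \<le> 1 \<and> is_cocycle G k z) \<and> sum_list (map fst t) = n"
      using const_cocycle[OF oneG] by (auto simp: t(3) tm_def)
  qed
  have "cohomologous G n f (\<lambda>xs g. \<Sum>t\<leftarrow>tms. cup_list G t xs g)"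
  proof (cases "n = 0")
    case True
    have "f [] g = (\<Sum>t\<leftarrow>tms. cup_list G t [] g)" for g
      using val[of "[]" g] qeq[of g "[]"] fc[of "[]"] True by (auto simp: q_def skew_carrier_def)
    then show ?thesis using True by (auto simp: cohomologous_def)
  next
    case False
    \<comment> \<open>The primitives of the components form one cochain; it has to vanish outside G
      to take values in the skew group algebra.\<close>
    define H where "H xs = (\<lambda>g. if g \<in> G then h g xs else 0)" for xs
    have "is_cochain G (n - 1) H"
      by (auto simp: is_cochain_def H_def skew_carrier_def fun_eq_iff multilin_update[OF hm])
    moreover have "f xs g - (\<Sum>t\<leftarrow>tms. cup_list G t xs g) = hoch_d G (n - 1) H xs g" if xs: "length xs = n" for xs g
    proof -
      have "hoch_d G (n - 1) H xs g = hdelta g (\<lambda>xs. H xs g) xs" using xs False by (intro hoch_d_eq) simp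
      also have "\<dots> = (if g \<in> G then hdelta g (h g) xs else 0)"
        by (simp add: H_def hoch.delta_zero)
      also have "\<dots> = f xs g - (\<Sum>t\<leftarrow>tms. cup_list G t xs g)"
        using val[OF xs, of g] qeq[of g xs] fc[OF xs] False xs by (auto simp: q_def skew_carrier_def)
      finally show ?thesis ..
    qed
    ultimately show ?thesis using False by (auto simp: cohomologous_def)
  qed
  with deg show "\<exists>terms :: (nat \<times> 'n cochain) list list.
      (\<forall>t\<in>set terms. (\<forall>(k, z)\<in>set t. k \<le> 1 \<and> is_cocycle G k z) \<and> sum_list (map fst t) = n) \<and>
      cohomologous G n f (\<lambda>xs g. \<Sum>t\<leftarrow>terms. cup_list G t xs g)" by blast
qed

end
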